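(* Let $\xi_1,\ldots,\xi_n$ be independent centered real random variables with variances at least $1$ and fourth moments at most $B$. Let $A$ be an $n \times n$ matrix whose rows are independent copies of the random vector $(\xi_1,\ldots,\xi_n)$. Let $K \ge 1$. Then for every $\varepsilon \ge 0$ one has $$\mathbb{P} \big( s_n(A) \le \varepsilon n^{-1/2} \big) \le C\varepsilon + c^n + \mathbb{P} \big(\|A\| > K n^{1/2}\big),$$ where $C > 0$ and $c \in (0,1)$ depend (polynomially) only on $B$ and $K$.
   Context: For a real $n\times n$ matrix $A$, $s_n(A) = \inf_{\|x\|_2 = 1} \|Ax\|_2$ is its smallest singular value and $\|A\| = \sup_{\|x\|_2=1}\|Ax\|_2$ is its spectral norm. "Fourth moment at most $B$" means $\mathbb{E}|\xi_k|^4 \le B$; "centered" means mean zero.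
   Formalization: The bound is shown for all n ≥ 1 with C polynomial in B, K and some c in (0,1) depending on B, K; polynomial dependence of c, i.e. 1/(1-c) ≤ poly(B,K), fails for small n (sparse entries, B = K = 10n) and is shown for n ≥ N(B,K) with N polynomially bounded. *)

theory Defs
  imports "HOL-Probability.Probability" "Jordan_Normal_Form.Matrix"
begin

definition euclid_norm :: "real vec \<Rightarrow> real" where
  "euclid_norm v = sqrt (scalar_prod v v)"

text \<open>In dimension 0 the unit sphere is empty and the next two quantities are unspecified.\<close>

definition smallest_singular_value :: "real mat \<Rightarrow> real" where
  "smallest_singular_value A =
     (INF x \<in> {x \<in> carrier_vec (dim_col A). euclid_norm x = 1}. euclid_norm (A *\<^sub>v x))"

definition spectral_norm :: "real mat \<Rightarrow> real" where
  "spectral_norm A =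
     (SUP x \<in> {x \<in> carrier_vec (dim_col A). euclid_norm x = 1}. euclid_norm (A *\<^sub>v x))"

context prob_space
begin

text \<open>Indices run over \<open>0, \<dots>, n - 1\<close>. Integrability of the fourth power makes the
  Bochner integrals below the actual moments; without it they would be 0 by convention.\<close>

definition admissible_variables :: "nat \<Rightarrow> real \<Rightarrow> (nat \<Rightarrow> 'a \<Rightarrow> real) \<Rightarrow> bool" where
  "admissible_variables n B \<xi> \<longleftrightarrow>
     indep_vars (\<lambda>_. borel) \<xi> {..<n} \<and>
     (\<forall>k<n. integrable M (\<xi> k) \<and> expectation (\<xi> k) = 0 \<and>
            variance (\<xi> k) \<ge> 1 \<and>
            integrable M (\<lambda>\<omega>. \<bar>\<xi> k \<omega>\<bar> ^ 4) \<and> expectation (\<lambda>\<omega>. \<bar>\<xi> k \<omega>\<bar> ^ 4) \<le> B)"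

definition rows_indep_copies ::
    "nat \<Rightarrow> (nat \<Rightarrow> 'a \<Rightarrow> real) \<Rightarrow> ('a \<Rightarrow> real mat) \<Rightarrow> bool" where
  "rows_indep_copies n \<xi> A \<longleftrightarrow>
     (\<forall>\<omega>\<in>space M. A \<omega> \<in> carrier_mat n n) \<and>
     indep_vars (\<lambda>_. PiM {..<n} (\<lambda>_. borel)) (\<lambda>i \<omega>. \<lambda>j\<in>{..<n}. A \<omega> $$ (i, j)) {..<n} \<and>
     (\<forall>i<n. distr M (PiM {..<n} (\<lambda>_. borel)) (\<lambda>\<omega>. \<lambda>j\<in>{..<n}. A \<omega> $$ (i, j)) =
            distr M (PiM {..<n} (\<lambda>_. borel)) (\<lambda>\<omega>. \<lambda>j\<in>{..<n}. \<xi> j \<omega>))"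

end

text \<open>Upper bound by a polynomial in the two parameters. On the range \<open>B, K \<ge> 1\<close> every
  polynomial is dominated by one of the form \<open>a (B K)\<^sup>m\<close>. Variances at least 1 force
  fourth moments at least 1, so \<open>B \<ge> 1\<close> is the only range of interest.\<close>

definition polynomially_bounded :: "(real \<Rightarrow> real \<Rightarrow> real) \<Rightarrow> bool" where
  "polynomially_bounded f \<longleftrightarrow> (\<exists>(a::real) (m::nat). \<forall>B\<ge>1. \<forall>K\<ge>1. f B K \<le> a * (B * K) ^ m)"

text \<open>
  For a constant \<open>c\<close> in \<open>(0,1)\<close> occurring as \<open>c ^ n\<close>, polynomial dependence
  means that \<open>1 / (1 - c)\<close> is polynomially bounded. This cannot hold uniformly down to
  \<open>n = 1\<close>: let every entry be 0 with probability \<open>1 - 1/B\<close> and \<open>\<plusminus>\<surd>B\<close> with probability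
  \<open>1/(2B)\<close> each, and take \<open>K = B = 10 n\<close>. Then the norm is never larger than
  \<open>K \<surd>n\<close>, while the matrix has a zero row, and so is singular, with probability at least
  \<open>1 - 10 ^ (-n)\<close>; so \<open>c ^ n \<ge> 1 - 10 ^ (-n)\<close>, and \<open>1 - c\<close> is exponentially small in \<open>B\<close>.
  Hence the theorem uses two bases, with the same polynomially bounded factor \<open>C\<close>: \<open>c\<close> for all
  dimensions, and \<open>c'\<close> with polynomial dependence for all dimensions \<open>n \<ge> N\<close>, where the
  threshold \<open>N\<close> is itself polynomially bounded.
\<close>

end

theory Submission
  imports Defs "Jordan_Normal_Form.Determinant"
begin

text \<open>
  Suppose \<open>\<parallel>A x\<parallel> \<le> \<epsilon> / \<surd>n\<close> for a unit vector \<open>x\<close> while \<open>\<parallel>A\<parallel> \<le> K \<surd>n\<close>. Vectors \<open>x\<close> with few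
  coordinates of order \<open>1 / \<surd>n\<close> are excluded by a lattice net, because a fixed unit vector satisfies
  \<open>\<parallel>A x\<parallel> \<le> c \<surd>n\<close> only with exponentially small probability. For every other \<open>x\<close> a positive
  proportion of the columns of \<open>A\<close> lies within \<open>O(\<epsilon>)\<close> of the span of the remaining ones. Such a distance is at
  least \<open>\<bar>\<langle>a, X\<^sub>k\<rangle>\<bar>\<close>, where the unit vector \<open>a\<close> is orthogonal to the other columns and independent of
  \<open>X\<^sub>k\<close>, so it remains to see that \<open>a\<close> has exponentially large least common denominator; vectors with smaller
  denominators are close to few rational directions and are excluded by a union bound over dyadic levels.

  Small balls and their tensorized version both come from \<open>exp (- z\<^sup>2 / 2) = E cos (g z)\<close> with
  \<open>g\<close> standard normal, which turns \<open>E exp (- Z\<^sup>2 / (2 t\<^sup>2))\<close> into a Gaussian average of a product of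
  characteristic functions.

  In dimensions below the threshold, \<open>E (\<Sum> minors\<^sup>2) \<le> n E det\<^sup>2\<close> shows that
  \<open>\<parallel>A\<inverse>\<parallel>\<^sup>2 < 2 n\<close> with a probability bounded away from 0 in terms of \<open>n\<close> and \<open>B\<close>.
\<close>

section \<open>Distance to the integer lattice and Gaussian averages\<close>

text \<open>The small ball bound for a weighted sum sees the arithmetic of the weights only when all
  summands have one law. A row of the matrix mixes n laws, but the rows are copies of each other, so
  the entries of a single column are identically distributed; this is why columns, and not rows, are
  compared with the span of the others. The union bound at level D has no room to spare: there are
  about (D / \<surd>n)^n lattice points, each with small ball probability of order (K \<mu> \<surd>n
  / D)^(n - 1). The powers of D cancel except for one, and only the smallness of \<mu> beats the
  remaining constants, which fixes \<mu>. The surviving factor D and the term exp (- b \<mu>^2 n) of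
  the small ball bound confine the levels to D \<le> exp (\<eta> n), and exp (- \<eta> n) is
  therefore an error left in the distance estimate. The norm bound enters only in passing from a net
  point to a nearby vector, so the event of a large norm is split off once, at the end. No constant
  comes from compactness: the basic ones are products of powers of 1 / B, 1 / K and numbers, as
  polynomial dependence demands.\<close>

definition lattice_dist :: "nat \<Rightarrow> (nat \<Rightarrow> real) \<Rightarrow> real" where
  "lattice_dist n y = L2_set (\<lambda>k. y k - of_int (round (y k))) {..<n}"

lemma lattice_dist_le: "lattice_dist n y \<le> L2_set (\<lambda>k. y k - of_int (p k)) {..<n}"
proof -
  have "L2_set (\<lambda>k. \<bar>y k - of_int (round (y k))\<bar>) {..<n} \<le> L2_set (\<lambda>k. \<bar>y k - of_int (p k)\<bar>) {..<n}"
    by (rule L2_set_mono) (use round_diff_minimal in \<open>auto simp: abs_minus_commute\<close>)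
  then show ?thesis by (simp add: lattice_dist_def L2_set_def)
qed

lemma lattice_dist_nonneg [simp]: "0 \<le> lattice_dist n y"
  by (simp add: lattice_dist_def)

lemma lattice_dist_diff: "lattice_dist n (\<lambda>k. u k - v k) \<le> lattice_dist n u + lattice_dist n v"
proof -
  have "lattice_dist n (\<lambda>k. u k - v k) \<le> L2_set (\<lambda>k. (u k - v k) - of_int (round (u k) - round (v k))) {..<n}"
    by (rule lattice_dist_le)
  also have "\<dots> = L2_set (\<lambda>k. (u k - of_int (round (u k))) + (- (v k - of_int (round (v k))))) {..<n}"
    by (intro L2_set_cong) auto
  also have "\<dots> \<le> lattice_dist n u + L2_set (\<lambda>k. - (v k - of_int (round (v k)))) {..<n}"
    unfolding lattice_dist_def by (rule L2_set_triangle_ineq)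
  also have "L2_set (\<lambda>k. - (v k - of_int (round (v k)))) {..<n} = lattice_dist n v"
    unfolding lattice_dist_def L2_set_def by (simp add: power2_commute)
  finally show ?thesis .
qed

lemma lattice_dist_perturb: "lattice_dist n u \<le> lattice_dist n v + L2_set (\<lambda>k. u k - v k) {..<n}"
proof -
  have "lattice_dist n u \<le> L2_set (\<lambda>k. u k - of_int (round (v k))) {..<n}"
    by (rule lattice_dist_le)
  also have "\<dots> = L2_set (\<lambda>k. (v k - of_int (round (v k))) + (u k - v k)) {..<n}"
    by (intro L2_set_cong) auto
  also have "\<dots> \<le> lattice_dist n v + L2_set (\<lambda>k. u k - v k) {..<n}"
    unfolding lattice_dist_def by (rule L2_set_triangle_ineq)
  finally show ?thesis .
qed

lemma L2_set_scale: "L2_set (\<lambda>k. c * f k) A = \<bar>c\<bar> * L2_set f A"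
  by (simp add: L2_set_def power_mult_distrib real_sqrt_mult flip: sum_distrib_left)

text \<open>Rounding jumps, but the distance to a fixed set is 1-Lipschitz. Continuity provides both
  measurability in g and the attained minimum that \<open>window_integral\<close> works
  with.\<close>

lemma continuous_lattice_dist: "continuous_on UNIV (\<lambda>g. lattice_dist n (\<lambda>k. g * c k))"
proof (rule lipschitz_on_continuous_on, rule lipschitz_onI)
  fix x y :: real
  have *: "lattice_dist n (\<lambda>k. x * c k) \<le> lattice_dist n (\<lambda>k. y * c k) + \<bar>x - y\<bar> * L2_set c {..<n}" for x y
    using lattice_dist_perturb[of n "\<lambda>k. x * c k" "\<lambda>k. y * c k"]
    by (simp flip: left_diff_distrib L2_set_scale)
  show "dist (lattice_dist n (\<lambda>k. x * c k)) (lattice_dist n (\<lambda>k. y * c k)) \<le> L2_set c {..<n} * dist x y"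
    using *[of x y] *[of y x] by (auto simp: dist_real_def abs_minus_commute mult.commute)
qed simp

text \<open>
  \<open>lcd_ge \<gamma> \<alpha> D n a\<close> says that the least common denominator of \<open>a\<close> (with parameters \<open>\<alpha>\<close>, \<open>\<gamma>\<close>) is at least \<open>D\<close>.
\<close>

definition lcd_ge :: "real \<Rightarrow> real \<Rightarrow> real \<Rightarrow> nat \<Rightarrow> (nat \<Rightarrow> real) \<Rightarrow> bool" where
  "lcd_ge \<gamma> \<alpha> D n a \<longleftrightarrow>
     (\<forall>\<theta>. 0 \<le> \<theta> \<and> \<theta> \<le> D \<longrightarrow> min (\<gamma> * \<theta>) \<alpha> \<le> lattice_dist n (\<lambda>k. \<theta> * a k))"

lemma sin_ge_linear:
  fixes w :: real assumes "0 \<le> w" "w \<le> 1/2" shows "2 * w \<le> sin (pi * w)"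
proof -
  have "convex_on {0..pi/2} (\<lambda>x. - sin x)"
  proof (rule f''_ge0_imp_convex[where f' = "\<lambda>x. - cos x" and f'' = sin])
    show "0 \<le> sin x" if "x \<in> {0..pi/2}" for x using that by (intro sin_ge_zero) (auto simp: field_simps)
  qed (auto intro!: derivative_eq_intros)
  from convex_onD[OF this, of "2*w" 0 "pi/2"] assms show ?thesis by (simp add: mult.commute)
qed

text \<open>By periodicity u may be replaced by its offset w from the nearest integer, where 1 - cos
  (2 pi w) = 2 sin^2 (pi w) and concavity of the sine applies. This is the bridge from
  characteristic functions to \<open>lattice_dist\<close>.\<close>

lemma one_minus_cos_ge: "8 * (u - of_int (round u))\<^sup>2 \<le> 1 - cos (2 * pi * u)"
proof -
  define w where "w = u - of_int (round u)"
  have w: "\<bar>w\<bar> \<le> 1/2" unfolding w_def using of_int_round_abs_le[of u] by (simp add: abs_minus_commute)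
  have "cos (2 * pi * u) = cos (2 * pi * w + 2 * pi * of_int (round u))"
    by (simp add: w_def algebra_simps)
  also have "\<dots> = cos (2 * pi * w)"
    by (simp add: cos_add cos_int_2pin sin_int_2pin)
  also have "\<dots> = 1 - 2 * (sin (pi * w))\<^sup>2"
    using cos_double_sin[of "pi * w"] by (simp add: mult_ac)
  finally have 1: "1 - cos (2 * pi * u) = 2 * (sin (pi * w))\<^sup>2" by simp
  have "(sin (pi * w))\<^sup>2 = (sin (pi * \<bar>w\<bar>))\<^sup>2" by (cases "w \<ge> 0") auto
  moreover have "(2 * \<bar>w\<bar>)\<^sup>2 \<le> (sin (pi * \<bar>w\<bar>))\<^sup>2"
    using sin_ge_linear[of "\<bar>w\<bar>"] w by (intro power_mono) auto
  ultimately show ?thesis unfolding 1 by (simp add: w_def power_mult_distrib)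
qed

lemma nn_integral_gaussian:
  assumes "c > 0"
  shows "(\<integral>\<^sup>+y. ennreal (exp (- c * (y - m)\<^sup>2)) \<partial>lborel) = ennreal (sqrt (pi / c))"
proof -
  define \<sigma> where "\<sigma> = sqrt (1 / (2 * c))"
  have s: "\<sigma> > 0" "\<sigma>\<^sup>2 = 1 / (2 * c)" using assms by (auto simp: \<sigma>_def)
  have eq: "exp (- c * (y - m)\<^sup>2) = sqrt (pi / c) * normal_density m \<sigma> y" for y
    using assms unfolding normal_density_def s(2) by (simp add: field_simps real_sqrt_divide)
  have "(\<integral>\<^sup>+y. ennreal (normal_density m \<sigma> y) \<partial>lborel) = 1"
    using s by (simp add: nn_integral_eq_integral)
  then show ?thesis
    unfolding eq using assms by (simp add: ennreal_mult' nn_integral_cmult)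
qed

lemma window_integral:
  fixes f :: "real \<Rightarrow> real"
  assumes cont: "continuous_on UNIV f" and f0: "\<And>y. 0 \<le> f y" and L: "0 < L" and s: "0 < s" and b: "0 < b" and al: "0 \<le> \<alpha>"
    and sep: "\<And>y y'. \<bar>y - y'\<bar> \<le> L \<Longrightarrow> min (s * \<bar>y - y'\<bar>) \<alpha> \<le> f y + f y'"
  shows "(\<integral>\<^sup>+y. ennreal (exp (- 4 * b * (f y)\<^sup>2)) * indicator {x - L/2..x + L/2} y \<partial>lborel)
     \<le> ennreal (sqrt pi / (s * sqrt b) + L * exp (- b * \<alpha>\<^sup>2))"
proof -
  have "compact {x - L/2..x + L/2}" "{x - L/2..x + L/2} \<noteq> {}" using L by auto
  from continuous_attains_inf[OF this continuous_on_subset[OF cont]]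
  obtain y0 where y0: "y0 \<in> {x - L/2..x + L/2}" "\<And>y. y \<in> {x - L/2..x + L/2} \<Longrightarrow> f y0 \<le> f y" by auto
  \<comment> \<open>\<open>4 * (f y)\<^sup>2\<close> is the square of 2 f y, which is at least one
    of the two arguments of the minimum; the sum of the two exponentials covers both cases.\<close>
  have pw: "exp (- 4 * b * (f y)\<^sup>2) \<le> exp (- (b * s\<^sup>2) * (y - y0)\<^sup>2) + exp (- b * \<alpha>\<^sup>2)"
    if y: "y \<in> {x - L/2..x + L/2}" for y
  proof -
    have "min (s * \<bar>y - y0\<bar>) \<alpha> \<le> 2 * f y"
    proof -
      have "\<bar>y - y0\<bar> \<le> L" using y y0(1) by (auto simp: abs_le_iff)
      from sep[OF this] y0(2)[OF y] show ?thesis by linarith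
    qed
    then consider "s * \<bar>y - y0\<bar> \<le> 2 * f y" | "\<alpha> \<le> 2 * f y" by linarith
    then show ?thesis
    proof cases
      case 1
      have "(s * \<bar>y - y0\<bar>)\<^sup>2 \<le> (2 * f y)\<^sup>2" using 1 s by (intro power_mono) auto
      then have "exp (- 4 * b * (f y)\<^sup>2) \<le> exp (- (b * s\<^sup>2) * (y - y0)\<^sup>2)"
        using b by (simp add: power_mult_distrib mult.assoc)
      then show ?thesis by (simp add: add_increasing2)
    next
      case 2
      have "\<alpha>\<^sup>2 \<le> (2 * f y)\<^sup>2" using 2 al by (intro power_mono) auto
      then have "exp (- 4 * b * (f y)\<^sup>2) \<le> exp (- b * \<alpha>\<^sup>2)" using b by (simp add: power_mult_distrib)
      then show ?thesis by (simp add: add_increasing)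
    qed
  qed
  have "(\<integral>\<^sup>+y. ennreal (exp (- 4 * b * (f y)\<^sup>2)) * indicator {x - L/2..x + L/2} y \<partial>lborel)
    \<le> (\<integral>\<^sup>+y. ennreal (exp (- (b * s\<^sup>2) * (y - y0)\<^sup>2)) + ennreal (exp (- b * \<alpha>\<^sup>2)) * indicator {x - L/2..x + L/2} y \<partial>lborel)"
    using pw by (intro nn_integral_mono) (auto simp: indicator_def simp flip: ennreal_plus)
  also have "\<dots> = ennreal (sqrt (pi / (b * s\<^sup>2))) + ennreal (exp (- b * \<alpha>\<^sup>2)) * ennreal L"
  proof -
    have "b * s\<^sup>2 > 0" using b s by simp
    from nn_integral_gaussian[OF this, of y0] show ?thesis
      using L by (subst nn_integral_add) (simp_all add: nn_integral_cmult_indicator)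
  qed
  also have "\<dots> = ennreal (sqrt pi / (s * sqrt b) + L * exp (- b * \<alpha>\<^sup>2))"
    using b s L by (simp add: real_sqrt_divide real_sqrt_mult mult.commute ennreal_plus ennreal_mult')
  finally show ?thesis .
qed

text \<open>Used to pull the density out of a window centred at x. Halving the exponent, by x^2
  \<le> 2 y^2 + 2 (x - y)^2, still leaves a Gaussian in x, so the average over all windows is
  finite.\<close>

lemma std_normal_density_shift:
  assumes "\<bar>x - y\<bar> \<le> 1/2"
  shows "std_normal_density y \<le> exp (1/8) / sqrt (2 * pi) * exp (- (1/4) * (x - 0)\<^sup>2)"
proof -
  have "x\<^sup>2 \<le> 2 * y\<^sup>2 + 2 * (x - y)\<^sup>2" using zero_le_power2[of "x - 2 * y"] by (simp add: power2_eq_square algebra_simps)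
  moreover have "(x - y)\<^sup>2 \<le> (1/2)\<^sup>2" using power_mono[OF assms, of 2] by simp
  ultimately have "- y\<^sup>2 / 2 \<le> 1/8 - x\<^sup>2/4" by (simp add: power_divide)
  then have "exp (- y\<^sup>2 / 2) \<le> exp (1/8) * exp (- (x\<^sup>2) / 4)" by (simp flip: exp_add)
  then show ?thesis by (simp add: std_normal_density_def field_simps)
qed

lemma exp_eighth: "exp (1/8) * sqrt 2 \<le> (2::real)"
proof -
  have "exp (1/8::real) \<le> 1 + 1/8 + (1/8)\<^sup>2" by (rule exp_bound) auto
  then have "exp (1/8::real) \<le> 1.15" by (simp add: power2_eq_square)
  moreover have "sqrt 2 \<le> (1.5::real)" by (rule real_le_lsqrt) (auto simp: power2_eq_square)
  ultimately have "exp (1/8) * sqrt 2 \<le> 1.15 * (1.5::real)" by (intro mult_mono) auto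
  then show ?thesis by simp
qed

text \<open>
  Averaging over windows \<open>{x - L/2..x + L/2}\<close> reduces the bound to a single window, where \<open>f y\<close> is compared with
  its minimum: \<open>2 f y \<ge> f y + f y0\<close>.
\<close>

lemma gaussian_recurrence:
  fixes f :: "real \<Rightarrow> real"
  assumes cont: "continuous_on UNIV f" and f0: "\<And>y. 0 \<le> f y" and L: "0 < L" "L \<le> 1" and s: "0 < s" and b: "0 < b" and al: "0 \<le> \<alpha>"
    and sep: "\<And>y y'. \<bar>y - y'\<bar> \<le> L \<Longrightarrow> min (s * \<bar>y - y'\<bar>) \<alpha> \<le> f y + f y'"
  shows "(\<integral>\<^sup>+y. ennreal (std_normal_density y * exp (- 4 * b * (f y)\<^sup>2)) \<partial>lborel)
     \<le> ennreal (4 / (L * s * sqrt b) + 2 * exp (- b * \<alpha>\<^sup>2))"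
proof -
  define W where "W = sqrt pi / (s * sqrt b) + L * exp (- b * \<alpha>\<^sup>2)"
  define F where "F y = exp (- 4 * b * (f y)\<^sup>2)" for y
  define I where "I x y = (indicator {x - L/2..x + L/2} y :: ennreal)" for x y :: real
  define \<kappa> where "\<kappa> = exp (1/8) / sqrt (2 * pi)"
  have [measurable]: "f \<in> borel_measurable borel" using cont by (rule borel_measurable_continuous_onI)
  have [measurable]: "F \<in> borel_measurable borel" unfolding F_def by measurable
  have I_meas[measurable]: "(\<lambda>(x,y). I x y) \<in> borel_measurable (borel \<Otimes>\<^sub>M borel)"
  proof -
    have "(\<lambda>(x,y). I x y) = (\<lambda>z. indicator {z. fst z - L/2 \<le> snd z \<and> snd z \<le> fst z + L/2} z)"
      by (auto simp: I_def fun_eq_iff indicator_def)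
    also have "\<dots> \<in> borel_measurable (borel \<Otimes>\<^sub>M borel)" by measurable
    finally show ?thesis .
  qed
  have k0: "\<kappa> \<ge> 0" and W0: "W \<ge> 0" using s b L by (auto simp: \<kappa>_def W_def)
  have I1: "(\<integral>\<^sup>+x. I x y \<partial>lborel) = ennreal L" for y
  proof -
    have "(\<integral>\<^sup>+x. I x y \<partial>lborel) = (\<integral>\<^sup>+x. indicator {y - L/2..y + L/2} x \<partial>lborel)"
      by (intro nn_integral_cong) (auto simp: I_def indicator_def)
    then show ?thesis using L by simp
  qed
  \<comment> \<open>The windows containing y have centres of total length L, so L is the integral of
    the window indicator over x. Exchanging the integrals leaves one window integral for each
    x.\<close>
  have "ennreal L * (\<integral>\<^sup>+y. ennreal (std_normal_density y * F y) \<partial>lborel)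
      = (\<integral>\<^sup>+y. ennreal (std_normal_density y * F y) * (\<integral>\<^sup>+x. I x y \<partial>lborel) \<partial>lborel)"
    unfolding I1 by (subst nn_integral_cmult[symmetric]) (auto simp: mult.commute)
  also have "\<dots> = (\<integral>\<^sup>+y. \<integral>\<^sup>+x. ennreal (std_normal_density y * F y) * I x y \<partial>lborel \<partial>lborel)"
    by (intro nn_integral_cong nn_integral_cmult[symmetric]) measurable
  also have "\<dots> \<le> (\<integral>\<^sup>+y. \<integral>\<^sup>+x. ennreal (\<kappa> * exp (- (1/4) * (x - 0)\<^sup>2)) * (ennreal (F y) * I x y) \<partial>lborel \<partial>lborel)"
  proof (intro nn_integral_mono)
    fix x y :: real
    show "ennreal (std_normal_density y * F y) * I x y \<le> ennreal (\<kappa> * exp (- (1/4) * (x - 0)\<^sup>2)) * (ennreal (F y) * I x y)"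
    proof (cases "y \<in> {x - L/2..x + L/2}")
      case True
      then have "\<bar>x - y\<bar> \<le> 1/2" using L by (auto simp: abs_if field_simps)
      from std_normal_density_shift[OF this]
      have "std_normal_density y * F y \<le> \<kappa> * exp (- (1/4) * (x - 0)\<^sup>2) * F y"
        unfolding \<kappa>_def by (intro mult_right_mono) (auto simp: F_def)
      then show ?thesis using True k0 by (simp add: I_def F_def flip: ennreal_mult)
    qed (auto simp: I_def)
  qed
  also have "\<dots> = (\<integral>\<^sup>+x. \<integral>\<^sup>+y. ennreal (\<kappa> * exp (- (1/4) * (x - 0)\<^sup>2)) * (ennreal (F y) * I x y) \<partial>lborel \<partial>lborel)"
    by (rule lborel_pair.Fubini') measurable
  also have "\<dots> = (\<integral>\<^sup>+x. ennreal (\<kappa> * exp (- (1/4) * (x - 0)\<^sup>2)) * (\<integral>\<^sup>+y. ennreal (F y) * I x y \<partial>lborel) \<partial>lborel)"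
    by (intro nn_integral_cong nn_integral_cmult) measurable
  also have "\<dots> \<le> (\<integral>\<^sup>+x. ennreal (\<kappa> * exp (- (1/4) * (x - 0)\<^sup>2)) * ennreal W \<partial>lborel)"
    unfolding F_def I_def W_def
    by (intro nn_integral_mono mult_left_mono window_integral[OF cont f0 L(1) s b al sep]) auto
  also have "\<dots> = (\<integral>\<^sup>+x. ennreal (\<kappa> * W) * ennreal (exp (- (1/4) * (x - 0)\<^sup>2)) \<partial>lborel)"
    using k0 W0 by (intro nn_integral_cong) (simp add: mult_ac flip: ennreal_mult)
  also have "\<dots> = ennreal (\<kappa> * W) * ennreal (sqrt (pi / (1/4)))"
    by (subst nn_integral_cmult, simp, subst nn_integral_gaussian) simp_all
  also have "\<dots> = ennreal (\<kappa> * W * sqrt (4 * pi))"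
    using k0 W0 by (simp add: mult.commute flip: ennreal_mult)
  also have "\<kappa> * W * sqrt (4 * pi) = exp (1/8) * sqrt 2 * W"
    by (simp add: \<kappa>_def real_sqrt_mult field_simps)
  also have "\<dots> \<le> 2 * W"
    by (intro mult_right_mono exp_eighth W0)
  also have "2 * W \<le> L * (4 / (L * s * sqrt b) + 2 * exp (- b * \<alpha>\<^sup>2))"
  proof -
    have "sqrt pi \<le> 2" by (rule real_le_lsqrt) (use pi_less_4 in auto)
    then have "sqrt pi / (s * sqrt b) \<le> 2 / (s * sqrt b)" using s b by (intro divide_right_mono) auto
    then have "2 * (sqrt pi / (s * sqrt b)) \<le> 4 / (s * sqrt b)" by simp
    then show ?thesis using L by (simp add: W_def distrib_left)
  qed
  finally have le: "ennreal L * (\<integral>\<^sup>+y. ennreal (std_normal_density y * F y) \<partial>lborel)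
      \<le> ennreal L * ennreal (4 / (L * s * sqrt b) + 2 * exp (- b * \<alpha>\<^sup>2))"
    using L by (simp add: ennreal_mult' ennreal_leI)
  show ?thesis
    using le L unfolding F_def by (simp add: ennreal_mult_le_mult_iff)
qed

text \<open>Subadditivity of \<open>lattice_dist\<close> turns the values at y and y' into the value
  at the single multiple |y - y'| |q|, to which the denominator bound applies as long as it is at
  most D. This dictates the window length L = min 1 (D / |q|); then 1 / (L |q|) is the larger of 1 /
  |q| and 1 / D, bounded by their sum.\<close>

lemma lcd_recurrence:
  assumes lcd: "lcd_ge \<gamma> \<alpha> D n a" and g: "0 < \<gamma>" and al: "0 \<le> \<alpha>" and D: "0 < D" and b: "0 < b" and q: "q \<noteq> 0"
  shows "(\<integral>\<^sup>+y. ennreal (std_normal_density y * exp (- 4 * b * (lattice_dist n (\<lambda>k. y * (q * a k)))\<^sup>2)) \<partial>lborel)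
     \<le> ennreal (4 * ((1 / \<bar>q\<bar> + 1 / D) / (\<gamma> * sqrt b) + exp (- b * \<alpha>\<^sup>2)))"
proof -
  define L where "L = min 1 (D / \<bar>q\<bar>)"
  have L: "0 < L" "L \<le> 1" "L * \<bar>q\<bar> \<le> D" using D q by (auto simp: L_def min_def field_simps)
  define f where "f y = lattice_dist n (\<lambda>k. y * (q * a k))" for y
  have sep: "min (\<gamma> * \<bar>q\<bar> * \<bar>y - y'\<bar>) \<alpha> \<le> f y + f y'" if "\<bar>y - y'\<bar> \<le> L" for y y'
  proof -
    have d: "lattice_dist n (\<lambda>k. \<bar>(y - y') * q\<bar> * a k) \<le> f y + f y'"
    proof (cases "(y - y') * q \<ge> 0")
      case True
      then have "\<bar>(y - y') * q\<bar> = (y - y') * q" by simp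
      then show ?thesis using lattice_dist_diff[of n "\<lambda>k. y * (q * a k)" "\<lambda>k. y' * (q * a k)"]
        by (simp add: f_def algebra_simps)
    next
      case False
      then have "\<bar>(y - y') * q\<bar> = (y' - y) * q" by (simp add: abs_if algebra_simps)
      then show ?thesis using lattice_dist_diff[of n "\<lambda>k. y' * (q * a k)" "\<lambda>k. y * (q * a k)"]
        by (simp add: f_def algebra_simps)
    qed
    have "\<bar>(y - y') * q\<bar> \<le> L * \<bar>q\<bar>" using that by (simp add: abs_mult mult_right_mono)
    then have "\<bar>(y - y') * q\<bar> \<le> D" using L by linarith
    then show ?thesis using lcd[unfolded lcd_ge_def, rule_format, of "\<bar>(y - y') * q\<bar>"] d
      by (simp add: abs_mult mult_ac)
  qed
  have "(\<integral>\<^sup>+y. ennreal (std_normal_density y * exp (- 4 * b * (f y)\<^sup>2)) \<partial>lborel)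
     \<le> ennreal (4 / (L * (\<gamma> * \<bar>q\<bar>) * sqrt b) + 2 * exp (- b * \<alpha>\<^sup>2))"
    using g q by (intro gaussian_recurrence[OF _ _ L(1,2) _ b al sep])
      (auto simp: f_def continuous_lattice_dist)
  also have "\<dots> \<le> ennreal (4 * ((1 / \<bar>q\<bar> + 1 / D) / (\<gamma> * sqrt b) + exp (- b * \<alpha>\<^sup>2)))"
  proof (rule ennreal_leI)
    have "1 / (L * \<bar>q\<bar>) \<le> 1 / \<bar>q\<bar> + 1 / D"
      using D q by (auto simp: L_def min_def field_simps)
    then have "1 / (L * \<bar>q\<bar>) * (1 / (\<gamma> * sqrt b)) \<le> (1 / \<bar>q\<bar> + 1 / D) * (1 / (\<gamma> * sqrt b))"
      using g b by (intro mult_right_mono) auto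
    then have "1 / (L * (\<gamma> * \<bar>q\<bar>) * sqrt b) \<le> (1 / \<bar>q\<bar> + 1 / D) / (\<gamma> * sqrt b)"
      by (simp add: mult_ac)
    then show "4 / (L * (\<gamma> * \<bar>q\<bar>) * sqrt b) + 2 * exp (- b * \<alpha>\<^sup>2) \<le> 4 * ((1 / \<bar>q\<bar> + 1 / D) / (\<gamma> * sqrt b) + exp (- b * \<alpha>\<^sup>2))"
    proof -
      assume h: "1 / (L * (\<gamma> * \<bar>q\<bar>) * sqrt b) \<le> (1 / \<bar>q\<bar> + 1 / D) / (\<gamma> * sqrt b)"
      have "4 / (L * (\<gamma> * \<bar>q\<bar>) * sqrt b) = 4 * (1 / (L * (\<gamma> * \<bar>q\<bar>) * sqrt b))" by simp
      also have "\<dots> \<le> 4 * ((1 / \<bar>q\<bar> + 1 / D) / (\<gamma> * sqrt b))" using h by linarith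
      finally show ?thesis unfolding distrib_left using exp_ge_zero[of "- b * \<alpha>\<^sup>2"] by linarith
    qed
  qed
  finally show ?thesis by (simp add: f_def)
qed

section \<open>Counting lattice points\<close>

text \<open>The l1 norm is chosen because weights x^|p k| multiply over the coordinates, so these
  points can be counted by a generating function; Cauchy-Schwarz brings Euclidean balls into this
  form.\<close>

definition lattice_l1 :: "nat \<Rightarrow> real \<Rightarrow> (nat \<Rightarrow> int) set" where
  "lattice_l1 n S = {p \<in> {..<n} \<rightarrow>\<^sub>E UNIV. (\<Sum>k<n. \<bar>real_of_int (p k)\<bar>) \<le> S}"

lemma lattice_l1_subset: "lattice_l1 n S \<subseteq> {..<n} \<rightarrow>\<^sub>E {- int (nat \<lfloor>S\<rfloor>)..int (nat \<lfloor>S\<rfloor>)}"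
proof
  fix p assume p: "p \<in> lattice_l1 n S"
  have "p k \<in> {- int (nat \<lfloor>S\<rfloor>)..int (nat \<lfloor>S\<rfloor>)}" if k: "k < n" for k
  proof -
    have "\<bar>real_of_int (p k)\<bar> \<le> (\<Sum>k<n. \<bar>real_of_int (p k)\<bar>)" using k by (intro member_le_sum) auto
    also have "\<dots> \<le> S" using p by (simp add: lattice_l1_def)
    finally have "of_int \<bar>p k\<bar> \<le> S" by simp
    then have "\<bar>p k\<bar> \<le> \<lfloor>S\<rfloor>" by (simp only: le_floor_iff)
    then have "\<bar>p k\<bar> \<le> int (nat \<lfloor>S\<rfloor>)" by linarith
    then show ?thesis unfolding abs_le_iff atLeastAtMost_iff by linarith
  qed
  then show "p \<in> {..<n} \<rightarrow>\<^sub>E {- int (nat \<lfloor>S\<rfloor>)..int (nat \<lfloor>S\<rfloor>)}"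
    using p by (auto simp: lattice_l1_def PiE_iff)
qed

lemma finite_lattice_l1: "finite (lattice_l1 n S)"
  by (rule finite_subset[OF lattice_l1_subset]) (simp add: finite_PiE)

lemma sum_power_abs_le:
  fixes x :: real assumes "0 < x" "x < 1"
  shows "(\<Sum>j\<in>{- int m..int m}. x ^ nat \<bar>j\<bar>) \<le> (1 + x) / (1 - x)"
proof -
  have "(1 - x) * (\<Sum>j\<in>{- int m..int m}. x ^ nat \<bar>j\<bar>) = 1 + x - 2 * x ^ Suc m"
  proof (induction m)
    case (Suc m)
    have "{- int (Suc m)..int (Suc m)} = insert (- int (Suc m)) (insert (int (Suc m)) {- int m..int m})" by auto
    moreover have "nat \<bar>- int (Suc m)\<bar> = Suc m" "nat \<bar>int (Suc m)\<bar> = Suc m" by auto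
    ultimately have "(\<Sum>j\<in>{- int (Suc m)..int (Suc m)}. x ^ nat \<bar>j\<bar>) = 2 * x ^ Suc m + (\<Sum>j\<in>{- int m..int m}. x ^ nat \<bar>j\<bar>)"
      by (simp del: of_nat_Suc)
    then have "(1 - x) * (\<Sum>j\<in>{- int (Suc m)..int (Suc m)}. x ^ nat \<bar>j\<bar>) = (1 - x) * (2 * x ^ Suc m) + (1 + x - 2 * x ^ Suc m)"
      by (simp only: distrib_left Suc)
    then show ?case by (simp add: algebra_simps)
  qed simp
  also have "\<dots> \<le> 1 + x" using assms by simp
  finally show ?thesis using assms by (simp add: field_simps)
qed

text \<open>Every counted point has weight x^(l1 norm) at least x^S, and the weights of all integer
  points of a surrounding box add up to a product of geometric sums.\<close>

lemma card_lattice_l1: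
  fixes x :: real assumes x: "0 < x" "x < 1"
  shows "real (card (lattice_l1 n S)) * x powr S \<le> ((1 + x) / (1 - x)) ^ n"
proof -
  define m where "m = nat \<lfloor>S\<rfloor>"
  have "real (card (lattice_l1 n S)) * x powr S = (\<Sum>p\<in>lattice_l1 n S. x powr S)" by simp
  also have "\<dots> \<le> (\<Sum>p\<in>lattice_l1 n S. \<Prod>k<n. x ^ nat \<bar>p k\<bar>)"
  proof (rule sum_mono)
    fix p assume p: "p \<in> lattice_l1 n S"
    have "x powr S \<le> x powr (\<Sum>k<n. \<bar>real_of_int (p k)\<bar>)"
      using p x by (intro powr_mono') (auto simp: lattice_l1_def)
    also have "\<dots> = x powr real (\<Sum>k<n. nat \<bar>p k\<bar>)" by (simp)
    also have "\<dots> = (\<Prod>k<n. x ^ nat \<bar>p k\<bar>)" using x by (simp only: powr_realpow power_sum)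
    finally show "x powr S \<le> (\<Prod>k<n. x ^ nat \<bar>p k\<bar>)" .
  qed
  also have "\<dots> \<le> (\<Sum>p\<in>{..<n} \<rightarrow>\<^sub>E {- int m..int m}. \<Prod>k<n. x ^ nat \<bar>p k\<bar>)"
    using lattice_l1_subset x by (intro sum_mono2) (auto simp: m_def finite_PiE intro!: prod_nonneg)
  also have "\<dots> = (\<Prod>k<n. \<Sum>j\<in>{- int m..int m}. x ^ nat \<bar>j\<bar>)"
    by (subst prod_sum_PiE) auto
  also have "\<dots> \<le> (\<Prod>k<n. (1 + x) / (1 - x))"
    using x sum_power_abs_le[OF x] by (intro prod_mono) (auto intro!: sum_nonneg)
  finally show ?thesis by simp
qed

text \<open>With x = R / (R + 1) the geometric factor is exactly 2 R + 1, and x^R is at least 1 / e.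
  This version serves the nets of the levels D.\<close>

lemma card_lattice_l1_large:
  assumes R: "0 < R"
  shows "real (card (lattice_l1 n (R * n))) \<le> (exp 1 * (2 * R + 1)) ^ n"
proof -
  define x where "x = R / (R + 1)"
  have x: "0 < x" "x < 1" using R by (auto simp: x_def)
  have e: "(1 + x) / (1 - x) = 2 * R + 1" using R by (simp add: x_def field_simps)
  have "ln x \<ge> - 1 / R"
  proof -
    have "ln (1 / x) \<le> 1 / x - 1" using x by (intro ln_le_minus_one) auto
    also have "1 / x - 1 = 1 / R" using R by (simp add: x_def field_simps)
    finally show ?thesis using x by (simp add: ln_div)
  qed
  then have "real n * (R * ln x) \<ge> real n * (- 1)"
    using R by (intro mult_left_mono) (auto simp: field_simps)
  then have "x powr (R * n) \<ge> exp (- real n)"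
    using x by (simp add: powr_def mult_ac)
  then have "real (card (lattice_l1 n (R * n))) * exp (- real n) \<le> real (card (lattice_l1 n (R * n))) * x powr (R * n)"
    by (intro mult_left_mono) auto
  also have "\<dots> \<le> (2 * R + 1) ^ n" using card_lattice_l1[OF x, of n "R * n"] by (simp add: e)
  finally have "real (card (lattice_l1 n (R * n))) \<le> (2 * R + 1) ^ n * exp (real n)"
    by (simp add: exp_minus field_simps)
  then show ?thesis by (simp add: power_mult_distrib exp_of_nat_mult[symmetric] mult.commute)
qed

text \<open>For a radius S that is a small fraction of n the count must have a small exponential
  rate; x stays free so that the two terms can be balanced.\<close>

lemma card_lattice_l1_small:
  assumes x: "0 < x" "x \<le> 1/2" and S: "0 \<le> S"
  shows "real (card (lattice_l1 n S)) \<le> exp (3 * x * n + S / x)"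
proof -
  have x1: "x < 1" using x by simp
  have "1 / (1 - x) \<le> exp (2 * x)"
  proof -
    have "(1 + 2 * x) * (1 - x) \<ge> 1" using x by (simp add: algebra_simps mult_left_le)
    then have "1 / (1 - x) \<le> 1 + 2 * x" using x by (simp add: field_simps)
    also have "\<dots> \<le> exp (2 * x)" by (rule exp_ge_add_one_self)
    finally show ?thesis .
  qed
  then have "(1 + x) * (1 / (1 - x)) \<le> exp x * exp (2 * x)"
    using x by (intro mult_mono) auto
  then have "((1 + x) / (1 - x)) ^ n \<le> (exp x * exp (2 * x)) ^ n" using x by (intro power_mono) auto
  also have "\<dots> = exp (3 * x * n)" by (simp flip: exp_add exp_of_nat_mult add: algebra_simps)
  finally have 1: "real (card (lattice_l1 n S)) * x powr S \<le> exp (3 * x * n)"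
    using card_lattice_l1[OF x(1) x1, of n S] by linarith
  have "ln (1 / x) \<le> 1 / x - 1" using x by (intro ln_le_minus_one) auto
  then have "- (1 / x) \<le> ln x" using x by (simp add: ln_div)
  then have "S * (- (1 / x)) \<le> S * ln x" using S by (rule mult_left_mono)
  then have "exp (- (S / x)) \<le> x powr S" using x by (simp add: powr_def)
  then have "real (card (lattice_l1 n S)) * exp (- (S / x)) \<le> exp (3 * x * n)"
    using 1 by (meson mult_left_mono of_nat_0_le_iff order_trans)
  then show ?thesis by (simp add: exp_minus exp_add field_simps)
qed

section \<open>Characteristic functions under a fourth moment bound\<close>

definition moment_class :: "real \<Rightarrow> real measure \<Rightarrow> bool" where
  "moment_class B \<nu> \<longleftrightarrow> real_distribution \<nu> \<and> integrable \<nu> (\<lambda>x. x ^ 4) \<and>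
     (\<integral>x. x \<partial>\<nu>) = 0 \<and> 1 \<le> (\<integral>x. x\<^sup>2 \<partial>\<nu>) \<and> (\<integral>x. x ^ 4 \<partial>\<nu>) \<le> B"

lemma power_le_one_plus_fourth:
  fixes x :: real assumes "k \<le> 4" shows "\<bar>x\<bar> ^ k \<le> 1 + x ^ 4"
proof (cases "\<bar>x\<bar> \<le> 1")
  case True
  then have "\<bar>x\<bar> ^ k \<le> 1" by (simp add: power_le_one)
  then show ?thesis by (simp add: add_increasing2)
next
  case False
  then have "\<bar>x\<bar> ^ k \<le> \<bar>x\<bar> ^ 4" using assms by (intro power_increasing) auto
  then show ?thesis by simp
qed

locale moment_measure = real_distribution \<nu> for \<nu> +
  fixes B :: real
  assumes mc: "moment_class B \<nu>"
begin

lemma integrable_pow: "k \<le> 4 \<Longrightarrow> integrable \<nu> (\<lambda>x. x ^ k)"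
proof (rule Bochner_Integration.integrable_bound[of _ "\<lambda>x. 1 + x ^ 4"])
  show "integrable \<nu> (\<lambda>x. 1 + x ^ 4)" using mc by (simp add: moment_class_def)
  assume "k \<le> 4"
  then show "AE x in \<nu>. norm (x ^ k) \<le> norm (1 + x ^ 4)"
    by (intro AE_I2) (simp add: power_abs power_le_one_plus_fourth)
qed simp

lemma integrable_abs_pow: "k \<le> 4 \<Longrightarrow> integrable \<nu> (\<lambda>x. \<bar>x\<bar> ^ k)"
  using integrable_abs[OF integrable_pow] by (simp add: power_abs)

lemma mean: "(\<integral>x. x \<partial>\<nu>) = 0" and var_ge: "1 \<le> (\<integral>x. x\<^sup>2 \<partial>\<nu>)" and fourth: "(\<integral>x. x ^ 4 \<partial>\<nu>) \<le> B"
  using mc by (auto simp: moment_class_def)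

text \<open>AM-GM between x^4 and 1. Its consequences are B \<ge> 1 and the bound of the variance by
  B.\<close>

lemma square_le: "2 * (\<integral>x. x\<^sup>2 \<partial>\<nu>) \<le> 1 + (\<integral>x. x ^ 4 \<partial>\<nu>)"
proof -
  have "(\<integral>x. 2 * x\<^sup>2 \<partial>\<nu>) \<le> (\<integral>x. 1 + x ^ 4 \<partial>\<nu>)"
  proof (rule integral_mono)
    show "2 * x\<^sup>2 \<le> 1 + x ^ 4" for x :: real
      using zero_le_power2[of "x\<^sup>2 - 1"] by (simp add: power2_eq_square algebra_simps power4_eq_xxxx)
  qed (auto simp: integrable_pow)
  then show ?thesis using integrable_pow prob_space by simp
qed

lemma B_ge_1: "1 \<le> B" using square_le var_ge fourth by linarith

lemma square_le_B: "(\<integral>x. x\<^sup>2 \<partial>\<nu>) \<le> B" using square_le fourth B_ge_1 by linarith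

text \<open>The third moment in the Taylor remainder is absorbed by 2 |s| |x|^3 \<le> x^2 + s^2 x^4.
  With v the variance, s^2 B \<le> 1 \<le> v makes the remainder at most s^2 v / 6, a third of the
  main term s^2 v / 2, and v \<ge> 1 finally removes v from the bound.\<close>

lemma char_near_0:
  assumes s: "s\<^sup>2 * B \<le> 1"
  shows "cmod (char \<nu> s) \<le> exp (- s\<^sup>2 / 3)"
proof -
  define v where "v = (\<integral>x. x\<^sup>2 \<partial>\<nu>)"
  have 1: "cmod (char \<nu> s - (1 - s\<^sup>2 * v / 2)) \<le> s\<^sup>2 / 6 * (\<integral>x. min (6 * x\<^sup>2) (\<bar>s\<bar> * \<bar>x\<bar> ^ 3) \<partial>\<nu>)"
    using integrable_pow[of 1] integrable_pow[of 2]
    by (intro char_approx3) (auto simp: mean v_def)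
  have "(\<integral>x. min (6 * x\<^sup>2) (\<bar>s\<bar> * \<bar>x\<bar> ^ 3) \<partial>\<nu>) \<le> (\<integral>x. (x\<^sup>2 + s\<^sup>2 * x ^ 4) / 2 \<partial>\<nu>)"
  proof (rule integral_mono)
    show "integrable \<nu> (\<lambda>x. min (6 * x\<^sup>2) (\<bar>s\<bar> * \<bar>x\<bar> ^ 3))"
      by (intro integrable_min integrable_mult_right integrable_pow integrable_abs_pow) auto
    show "min (6 * x\<^sup>2) (\<bar>s\<bar> * \<bar>x\<bar> ^ 3) \<le> (x\<^sup>2 + s\<^sup>2 * x ^ 4) / 2" for x
    proof -
      have "0 \<le> (\<bar>x\<bar> - \<bar>s\<bar> * x\<^sup>2)\<^sup>2" by simp
      also have "\<dots> = x\<^sup>2 + s\<^sup>2 * x ^ 4 - 2 * (\<bar>s\<bar> * \<bar>x\<bar> ^ 3)"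
        by (simp add: power2_diff power_mult_distrib) (simp add: power2_eq_square power3_eq_cube power4_eq_xxxx)
      finally have "\<bar>s\<bar> * \<bar>x\<bar> ^ 3 \<le> (x\<^sup>2 + s\<^sup>2 * x ^ 4) / 2"
        by (subst pos_le_divide_eq) simp_all
      then show ?thesis by (rule min.coboundedI2)
    qed
    show "integrable \<nu> (\<lambda>x. (x\<^sup>2 + s\<^sup>2 * x ^ 4) / 2)"
      using integrable_pow[of 2] integrable_pow[of 4] by simp
  qed
  also have "\<dots> = (v + s\<^sup>2 * (\<integral>x. x ^ 4 \<partial>\<nu>)) / 2"
    using integrable_pow[of 2] integrable_pow[of 4] by (simp add: v_def)
  also have "\<dots> \<le> (v + 1) / 2"
    using mult_left_mono[OF fourth, of "s\<^sup>2"] s by simp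
  also have "\<dots> \<le> v" using var_ge by (simp add: v_def)
  finally have "cmod (char \<nu> s - (1 - s\<^sup>2 * v / 2)) \<le> s\<^sup>2 / 6 * v"
    using 1 mult_left_mono[of _ v "s\<^sup>2 / 6"] by (smt (verit) divide_nonneg_nonneg zero_le_power2)
  moreover have "s\<^sup>2 * v \<le> 1" using mult_left_mono[OF square_le_B, of "s\<^sup>2"] s by (simp add: v_def)
  then have "cmod (complex_of_real (1 - s\<^sup>2 * v / 2)) = 1 - s\<^sup>2 * v / 2" by (subst norm_of_real) simp
  moreover have "cmod (char \<nu> s) \<le> cmod (complex_of_real (1 - s\<^sup>2 * v / 2)) + cmod (char \<nu> s - complex_of_real (1 - s\<^sup>2 * v / 2))"
    using norm_triangle_ineq[of "complex_of_real (1 - s\<^sup>2 * v / 2)" "char \<nu> s - complex_of_real (1 - s\<^sup>2 * v / 2)"] by simp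
  ultimately have "cmod (char \<nu> s) \<le> 1 - s\<^sup>2 * v / 3" by simp
  also have "\<dots> \<le> 1 + (- s\<^sup>2 / 3)" using mult_left_mono[OF var_ge, of "s\<^sup>2"] by (simp add: v_def)
  also have "\<dots> \<le> exp (- s\<^sup>2 / 3)" by (rule exp_ge_add_one_self)
  finally show ?thesis .
qed

end

text \<open>The standard normal law has characteristic function exp (- x^2 / 2), so Fubini turns the
  left side into the normal average of \<open>char \<mu>\<close>; absolute values are taken only
  then.\<close>

lemma gaussian_char:
  assumes "real_distribution \<mu>"
  shows "(\<integral>\<^sup>+x. ennreal (exp (- x\<^sup>2 / 2)) \<partial>\<mu>) \<le> (\<integral>\<^sup>+g. ennreal (std_normal_density g * cmod (char \<mu> g)) \<partial>lborel)"
proof -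
  interpret real_distribution \<mu> by fact
  interpret N: real_distribution std_normal_distribution by (rule real_dist_normal_dist)
  interpret P: pair_prob_space std_normal_distribution \<mu> ..
  have int: "integrable (std_normal_distribution \<Otimes>\<^sub>M \<mu>) (\<lambda>(g, x). iexp (x * g))"
    by (rule P.integrable_const_bound[of _ 1]) (auto simp: case_prod_beta)
  have m: "(\<lambda>g. cmod (char \<mu> g)) \<in> borel_measurable borel"
    by (intro borel_measurable_continuous_onI continuous_at_imp_continuous_on ballI continuous_norm isCont_char)
  have "complex_of_real (\<integral>x. exp (- x\<^sup>2 / 2) \<partial>\<mu>) = (CLINT x|\<mu>. char std_normal_distribution x)"
    by (simp add: char_std_normal_distribution)
  also have "\<dots> = (CLINT x|\<mu>. CLINT g|std_normal_distribution. iexp (x * g))" by (simp add: char_def)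
  also have "\<dots> = (CLINT g|std_normal_distribution. CLINT x|\<mu>. iexp (x * g))"
    by (rule P.Fubini_integral[OF int])
  also have "\<dots> = (CLINT g|std_normal_distribution. char \<mu> g)" by (simp add: char_def mult.commute)
  finally have eq: "complex_of_real (\<integral>x. exp (- x\<^sup>2 / 2) \<partial>\<mu>) = (CLINT g|std_normal_distribution. char \<mu> g)" .
  have "(\<integral>x. exp (- x\<^sup>2 / 2) \<partial>\<mu>) = cmod (CLINT g|std_normal_distribution. char \<mu> g)"
    unfolding eq[symmetric] norm_of_real by (rule abs_of_nonneg[symmetric]) (rule Bochner_Integration.integral_nonneg, simp)
  also have "\<dots> \<le> (\<integral>g. cmod (char \<mu> g) \<partial>std_normal_distribution)" by (rule integral_norm_bound)
  finally have le: "(\<integral>x. exp (- x\<^sup>2 / 2) \<partial>\<mu>) \<le> (\<integral>g. cmod (char \<mu> g) \<partial>std_normal_distribution)" .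
  have i1: "integrable \<mu> (\<lambda>x. exp (- x\<^sup>2 / 2))" by (rule integrable_const_bound[of _ 1]) auto
  have i2: "integrable std_normal_distribution (\<lambda>g. cmod (char \<mu> g))"
    by (rule N.integrable_const_bound[of _ 1]) (use m in \<open>auto simp: cmod_char_le_1\<close>)
  have "(\<integral>\<^sup>+x. ennreal (exp (- x\<^sup>2 / 2)) \<partial>\<mu>) \<le> (\<integral>\<^sup>+g. ennreal (cmod (char \<mu> g)) \<partial>std_normal_distribution)"
  proof -
    have "(\<integral>\<^sup>+x. ennreal (exp (- x\<^sup>2 / 2)) \<partial>\<mu>) = ennreal (\<integral>x. exp (- x\<^sup>2 / 2) \<partial>\<mu>)"
      by (rule nn_integral_eq_integral[OF i1]) simp
    moreover have "(\<integral>\<^sup>+g. ennreal (cmod (char \<mu> g)) \<partial>std_normal_distribution)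
        = ennreal (\<integral>g. cmod (char \<mu> g) \<partial>std_normal_distribution)"
      by (rule nn_integral_eq_integral[OF i2]) simp
    ultimately show ?thesis using le by (simp only: ennreal_leI)
  qed
  also have "\<dots> = (\<integral>\<^sup>+g. ennreal (std_normal_density g * cmod (char \<mu> g)) \<partial>lborel)"
    using m by (subst nn_integral_density) (auto simp: ennreal_mult)
  finally show ?thesis .
qed

lemma std_normal_density_ge: "\<bar>g\<bar> \<le> 1 \<Longrightarrow> 1/6 \<le> std_normal_density g"
proof -
  assume g: "\<bar>g\<bar> \<le> 1"
  have "g\<^sup>2 \<le> 1" using g by (simp add: abs_square_le_1)
  then have "1/2 \<le> exp (- g\<^sup>2 / 2)" using exp_ge_add_one_self[of "- g\<^sup>2 / 2"] by linarith
  moreover have "sqrt (2 * pi) \<le> 3" by (rule real_le_lsqrt) (use pi_less_4 in auto)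
  then have "1/3 \<le> 1 / sqrt (2 * pi)" by (simp add: field_simps)
  ultimately have "1/3 * (1/2) \<le> 1 / sqrt (2 * pi) * exp (- g\<^sup>2 / 2)" by (intro mult_mono) auto
  then show ?thesis by (simp add: std_normal_density_def)
qed

text \<open>Only the range 1 / (2 B) \<le> g \<le> 1 / B is exploited. There exp (- g^2 / 3) is at
  most 1 - 1 / (24 B^2) and the density at least 1 / 6, so the integrand loses 1 / (144 B^2) on a
  length 1 / (2 B), in total 1 / (288 B^3).\<close>

lemma gaussian_gap:
  fixes f :: "real \<Rightarrow> real"
  assumes B: "1 \<le> B" and [measurable]: "f \<in> borel_measurable borel"
    and f01: "\<And>g. 0 \<le> f g" "\<And>g. f g \<le> 1" and f: "\<And>g. \<bar>g\<bar> \<le> 1 / B \<Longrightarrow> f g \<le> exp (- g\<^sup>2 / 3)"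
  shows "(\<integral>\<^sup>+g. ennreal (std_normal_density g * f g) \<partial>lborel) \<le> ennreal (1 - 1 / (400 * B ^ 3))"
proof -
  define s where "s = 1 / B"
  have s: "0 < s" "s \<le> 1" using B by (auto simp: s_def)
  define c where "c = s\<^sup>2 / 144"
  have pw: "std_normal_density g * f g + c * indicator {s/2..s} g \<le> std_normal_density g" for g
  proof (cases "g \<in> {s/2..s}")
    case True
    have g: "\<bar>g\<bar> \<le> 1 / B" "\<bar>g\<bar> \<le> 1" "s\<^sup>2 / 4 \<le> g\<^sup>2" "g\<^sup>2 \<le> 1"
    proof -
      have "0 \<le> g" "g \<le> s" "s / 2 \<le> g" using True s by auto
      then show "\<bar>g\<bar> \<le> 1 / B" "\<bar>g\<bar> \<le> 1" "s\<^sup>2 / 4 \<le> g\<^sup>2" "g\<^sup>2 \<le> 1"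
        using s power_mono[of "s/2" g 2] unfolding s_def[symmetric] by (auto simp: power_divide power_le_one)
    qed
    have pos: "0 < 1 + g\<^sup>2/3" by (intro add_pos_nonneg) auto
    have "exp (- g\<^sup>2 / 3) \<le> 1 / (1 + g\<^sup>2/3)"
    proof -
      have "1 + g\<^sup>2/3 \<le> exp (g\<^sup>2/3)" by (rule exp_ge_add_one_self)
      then have "1 / exp (g\<^sup>2/3) \<le> 1 / (1 + g\<^sup>2/3)" using pos by (intro divide_left_mono mult_pos_pos) auto
      then show ?thesis by (simp add: exp_minus inverse_eq_divide)
    qed
    also have "\<dots> \<le> 1 - g\<^sup>2 / 6"
    proof -
      have "1 \<le> (1 - u / 6) * (1 + u / 3)" if "0 \<le> u" "u \<le> 1" for u :: real
        using mult_left_mono[OF that(2) that(1)] that by (simp add: algebra_simps)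
      then have "1 \<le> (1 - g\<^sup>2 / 6) * (1 + g\<^sup>2/3)" using g(4) by simp
      then show ?thesis using pos by (subst pos_divide_le_eq) auto
    qed
    finally have "f g \<le> 1 - s\<^sup>2 / 24" using f[OF g(1)] g(3) by linarith
    then have "std_normal_density g * f g \<le> std_normal_density g * (1 - s\<^sup>2/24)" by (intro mult_left_mono) auto
    moreover have "1/6 * (s\<^sup>2/24) \<le> std_normal_density g * (s\<^sup>2/24)"
      by (intro mult_right_mono std_normal_density_ge g) auto
    ultimately show ?thesis using True by (simp add: c_def algebra_simps)
  next
    case False
    then show ?thesis using f01(2)[of g] by (simp add: mult_left_le)
  qed
  have c0: "c \<ge> 0" by (simp add: c_def)
  define J where "J = (\<integral>\<^sup>+g. ennreal (std_normal_density g * f g) \<partial>lborel)"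
  have "J + ennreal (c * (s/2)) = J + (\<integral>\<^sup>+g. ennreal c * indicator {s/2..s} g \<partial>lborel)"
  proof -
    have "(\<integral>\<^sup>+g. ennreal c * indicator {s/2..s} g \<partial>lborel) = ennreal c * ennreal (s/2)"
      using s by (subst nn_integral_cmult_indicator) auto
    then show ?thesis using s c0 ennreal_mult[of c "s/2"] by simp
  qed
  also have "\<dots> = (\<integral>\<^sup>+g. ennreal (std_normal_density g * f g) + ennreal c * indicator {s/2..s} g \<partial>lborel)"
    unfolding J_def by (subst nn_integral_add) auto
  also have "\<dots> \<le> (\<integral>\<^sup>+g. ennreal (std_normal_density g) \<partial>lborel)"
  proof (intro nn_integral_mono)
    fix g
    show "ennreal (std_normal_density g * f g) + ennreal c * indicator {s/2..s} g \<le> ennreal (std_normal_density g)"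
      using pw[of g] c0 f01(1)[of g] by (auto simp: indicator_def simp flip: ennreal_plus intro!: ennreal_leI split: if_splits)
  qed
  also have "\<dots> = 1" by (simp add: nn_integral_eq_integral)
  finally have le: "J + ennreal (c * (s/2)) \<le> 1" .
  then obtain j where j: "J = ennreal j" "0 \<le> j" by (cases J) (auto simp: top_unique)
  have "j + c * (s/2) \<le> 1" using le j c0 s by (simp flip: ennreal_plus add: ennreal_le_1)
  moreover have "1 / (400 * B ^ 3) \<le> c * (s/2)"
    using B by (simp add: c_def s_def power_divide power2_eq_square power3_eq_cube field_simps)
  ultimately show ?thesis unfolding J_def[symmetric] j(1) by (intro ennreal_leI) linarith
qed

section \<open>Symmetrization and small balls for sums with one common law\<close>

context moment_measure
begin

sublocale P: pair_prob_space \<nu> \<nu> ..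

lemma char_square: "(cmod (char \<nu> s))\<^sup>2 = (\<integral>z. cos (s * (fst z - snd z)) \<partial>(\<nu> \<Otimes>\<^sub>M \<nu>))"
proof -
  define C where "C = (\<integral>x. cos (s * x) \<partial>\<nu>)"
  define S where "S = (\<integral>x. sin (s * x) \<partial>\<nu>)"
  have ic: "integrable \<nu> (\<lambda>x. cos (s * x))" and isn: "integrable \<nu> (\<lambda>x. sin (s * x))"
    by (rule integrable_const_bound[of _ 1]; simp)+
  have "char \<nu> s = (\<integral>x. complex_of_real (cos (s * x)) + \<i> * complex_of_real (sin (s * x)) \<partial>\<nu>)"
    unfolding char_def by (simp only: exp_Euler cos_of_real sin_of_real)
  also have "\<dots> = complex_of_real C + \<i> * complex_of_real S"
    using ic isn by (simp add: C_def S_def)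
  finally have "(cmod (char \<nu> s))\<^sup>2 = C\<^sup>2 + S\<^sup>2" by (simp add: cmod_power2)
  moreover have "(\<integral>z. cos (s * (fst z - snd z)) \<partial>(\<nu> \<Otimes>\<^sub>M \<nu>)) = (\<integral>x. (\<integral>y. cos (s * (x - y)) \<partial>\<nu>) \<partial>\<nu>)"
  proof -
    have "integrable (\<nu> \<Otimes>\<^sub>M \<nu>) (\<lambda>z. cos (s * (fst z - snd z)))"
      by (rule P.integrable_const_bound[of _ 1]) auto
    from P.integral_fst'[OF this] show ?thesis by simp
  qed
  moreover have "(\<integral>y. cos (s * (x - y)) \<partial>\<nu>) = cos (s * x) * C + sin (s * x) * S" for x
    using ic isn by (simp add: right_diff_distrib cos_diff C_def S_def)
  moreover have "(\<integral>x. cos (s * x) * C + sin (s * x) * S \<partial>\<nu>) = C\<^sup>2 + S\<^sup>2"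
    using ic isn by (simp add: C_def S_def power2_eq_square)
  ultimately show ?thesis by simp
qed

text \<open>\<open>char_square\<close> makes |char|^2 an average I of cosines over the symmetrized
  law, and I \<le> exp (I - 1). The exponential form allows the bounds of all coordinates to be
  added before Jensen's inequality is applied.\<close>

lemma cmod_char_le_exp:
  "cmod (char \<nu> s) \<le> exp (- (\<integral>z. (1 - cos (s * (fst z - snd z))) / 2 \<partial>(\<nu> \<Otimes>\<^sub>M \<nu>)))"
proof (rule power2_le_imp_le)
  have i: "integrable (\<nu> \<Otimes>\<^sub>M \<nu>) (\<lambda>z. cos (s * (fst z - snd z)))"
    by (rule P.integrable_const_bound[of _ 1]) auto
  define I where "I = (\<integral>z. cos (s * (fst z - snd z)) \<partial>(\<nu> \<Otimes>\<^sub>M \<nu>))"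
  have e: "(\<integral>z. (1 - cos (s * (fst z - snd z))) / 2 \<partial>(\<nu> \<Otimes>\<^sub>M \<nu>)) = (1 - I) / 2"
    using i P.prob_space by (simp add: I_def)
  have "(cmod (char \<nu> s))\<^sup>2 = 1 + (- (1 - I))" by (simp add: char_square I_def)
  also have "\<dots> \<le> exp (- (1 - I))" by (rule exp_ge_add_one_self)
  also have "\<dots> = (exp (- ((1 - I) / 2)))\<^sup>2" by (simp add: power2_eq_square flip: exp_add)
  finally show "(cmod (char \<nu> s))\<^sup>2 \<le> (exp (- (\<integral>z. (1 - cos (s * (fst z - snd z))) / 2 \<partial>(\<nu> \<Otimes>\<^sub>M \<nu>))))\<^sup>2"
    unfolding e .
qed simp

lemma integrable_fst_pow: "k \<le> 4 \<Longrightarrow> integrable (\<nu> \<Otimes>\<^sub>M \<nu>) (\<lambda>z. fst z ^ k)"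
  and integral_fst_pow: "k \<le> 4 \<Longrightarrow> (\<integral>z. fst z ^ k \<partial>(\<nu> \<Otimes>\<^sub>M \<nu>)) = (\<integral>x. x ^ k \<partial>\<nu>)"
  and integrable_snd_pow: "k \<le> 4 \<Longrightarrow> integrable (\<nu> \<Otimes>\<^sub>M \<nu>) (\<lambda>z. snd z ^ k)"
  and integral_snd_pow: "k \<le> 4 \<Longrightarrow> (\<integral>z. snd z ^ k \<partial>(\<nu> \<Otimes>\<^sub>M \<nu>)) = (\<integral>x. x ^ k \<partial>\<nu>)"
proof -
  have f: "distr (\<nu> \<Otimes>\<^sub>M \<nu>) \<nu> fst = \<nu>" by (rule distr_pair_fst)
  have s: "distr (\<nu> \<Otimes>\<^sub>M \<nu>) \<nu> snd = \<nu>"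
    by (intro measure_eqI) (auto simp: emeasure_distr measurable_snd' emeasure_pair_measure_Times emeasure_space_1[unfolded space_eq_univ]
        vimage_snd space_pair_measure)
  assume k: "k \<le> 4"
  have [simp]: "(\<lambda>x. x ^ k) \<in> borel_measurable \<nu>" by simp
  show "integrable (\<nu> \<Otimes>\<^sub>M \<nu>) (\<lambda>z. fst z ^ k)"
    using integrable_pow[OF k] integrable_distr_eq[OF measurable_fst, of "\<lambda>x. x ^ k" \<nu> \<nu>] by (simp add: f)
  show "(\<integral>z. fst z ^ k \<partial>(\<nu> \<Otimes>\<^sub>M \<nu>)) = (\<integral>x. x ^ k \<partial>\<nu>)"
    using integral_distr[OF measurable_fst, of "\<lambda>x. x ^ k" \<nu> \<nu>] by (simp add: f)
  show "integrable (\<nu> \<Otimes>\<^sub>M \<nu>) (\<lambda>z. snd z ^ k)"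
    using integrable_pow[OF k] integrable_distr_eq[OF measurable_snd, of "\<lambda>x. x ^ k" \<nu> \<nu>] by (simp add: s)
  show "(\<integral>z. snd z ^ k \<partial>(\<nu> \<Otimes>\<^sub>M \<nu>)) = (\<integral>x. x ^ k \<partial>\<nu>)"
    using integral_distr[OF measurable_snd, of "\<lambda>x. x ^ k" \<nu> \<nu>] by (simp add: s)
qed

text \<open>A Paley-Zygmund argument: the difference has second moment at least 2 and fourth moment
  at most 16 B, so it cannot stay below 1 almost always. The weight l in AM-GM is chosen such that
  the fourth moment contributes at most 1 / 2.\<close>

lemma symmetrized_spread: "1 / (16 * B) \<le> measure (\<nu> \<Otimes>\<^sub>M \<nu>) {z. 1 \<le> \<bar>fst z - snd z\<bar>}"
proof -
  let ?P = "\<nu> \<Otimes>\<^sub>M \<nu>" and ?S = "{z :: real \<times> real. 1 \<le> \<bar>fst z - snd z\<bar>}"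
  define l where "l = 1 / (16 * B)"
  have l: "l > 0" using B_ge_1 by (simp add: l_def)
  have S: "?S \<in> sets ?P"
  proof -
    have "{z \<in> space ?P. 1 \<le> \<bar>fst z - snd z\<bar>} \<in> sets ?P" by measurable
    then show ?thesis by (simp add: space_pair_measure)
  qed
  have xy: "integrable ?P (\<lambda>z. fst z * snd z)" and xy0: "(\<integral>z. fst z * snd z \<partial>?P) = 0"
  proof -
    show "integrable ?P (\<lambda>z. fst z * snd z)"
    proof (rule Bochner_Integration.integrable_bound[of _ "\<lambda>z. fst z ^ 2 + snd z ^ 2"])
      show "AE x in ?P. norm (fst x * snd x) \<le> norm ((fst x)\<^sup>2 + (snd x)\<^sup>2)"
      proof (intro AE_I2)
        fix x :: "real \<times> real"
        have "2 * (\<bar>fst x\<bar> * \<bar>snd x\<bar>) \<le> (fst x)\<^sup>2 + (snd x)\<^sup>2"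
          using zero_le_power2[of "\<bar>fst x\<bar> - \<bar>snd x\<bar>"] by (simp add: power2_diff)
        then have "\<bar>fst x\<bar> * \<bar>snd x\<bar> \<le> (fst x)\<^sup>2 + (snd x)\<^sup>2"
          using mult_nonneg_nonneg[of "\<bar>fst x\<bar>" "\<bar>snd x\<bar>"] by linarith
        then show "norm (fst x * snd x) \<le> norm ((fst x)\<^sup>2 + (snd x)\<^sup>2)" by (simp add: abs_mult)
      qed
    qed (auto intro!: integrable_fst_pow integrable_snd_pow)
    from P.integral_fst'[OF this] show "(\<integral>z. fst z * snd z \<partial>?P) = 0" by (simp add: mean)
  qed
  have i2: "integrable ?P (\<lambda>z. (fst z - snd z)\<^sup>2)"
    and e2: "2 \<le> (\<integral>z. (fst z - snd z)\<^sup>2 \<partial>?P)"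
  proof -
    have eq: "(\<lambda>z :: real \<times> real. (fst z - snd z)\<^sup>2) = (\<lambda>z. (fst z)\<^sup>2 + (snd z)\<^sup>2 - 2 * (fst z * snd z))"
      by (simp add: power2_diff mult.assoc)
    show "integrable ?P (\<lambda>z. (fst z - snd z)\<^sup>2)" unfolding eq
      by (intro Bochner_Integration.integrable_add Bochner_Integration.integrable_diff integrable_mult_right xy integrable_fst_pow integrable_snd_pow) auto
    show "2 \<le> (\<integral>z. (fst z - snd z)\<^sup>2 \<partial>?P)" unfolding eq
      using var_ge integrable_fst_pow[of 2] integrable_snd_pow[of 2] xy
      by (simp add: integral_fst_pow integral_snd_pow xy0)
  qed
  define G where "G z = 8 * (fst z ^ 4 + snd z ^ 4)" for z :: "real \<times> real"
  have iG: "integrable ?P G" and eG: "(\<integral>z. G z \<partial>?P) \<le> 16 * B"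
    using integrable_fst_pow[of 4] integrable_snd_pow[of 4] fourth
    by (auto simp: G_def[abs_def] integral_fst_pow integral_snd_pow)
  have G: "(fst z - snd z) ^ 4 \<le> G z" for z
  proof -
    have "(fst z - snd z)\<^sup>2 \<le> 2 * ((fst z)\<^sup>2 + (snd z)\<^sup>2)"
      using zero_le_power2[of "fst z + snd z"] by (simp add: power2_diff power2_sum)
    then have "((fst z - snd z)\<^sup>2)\<^sup>2 \<le> (2 * ((fst z)\<^sup>2 + (snd z)\<^sup>2))\<^sup>2" by (intro power_mono) auto
    also have "\<dots> \<le> 4 * (2 * ((fst z) ^ 4 + (snd z) ^ 4))"
      using zero_le_power2[of "(fst z)\<^sup>2 - (snd z)\<^sup>2"]
      by (simp add: power_mult_distrib power2_sum power2_diff flip: power_mult)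
    finally show ?thesis by (simp add: G_def flip: power_mult)
  qed
  have pw: "(fst z - snd z)\<^sup>2 \<le> 1 + l / 2 * G z + 1 / (2 * l) * indicator ?S z" for z
  proof (cases "z \<in> ?S")
    case True
    have amgm: "2 * q\<^sup>2 \<le> l * q ^ 4 + 1 / l" for q :: real
    proof -
      have "0 \<le> (sqrt l * q\<^sup>2 - 1 / sqrt l)\<^sup>2" by simp
      also have "\<dots> = l * q ^ 4 - 2 * q\<^sup>2 + 1 / l"
        using l by (simp add: power2_diff power_mult_distrib power_divide flip: power_mult)
      finally show ?thesis by simp
    qed
    from amgm[of "fst z - snd z"] have "(fst z - snd z)\<^sup>2 \<le> l / 2 * (fst z - snd z) ^ 4 + 1 / (2 * l)" by simp
    also have "l / 2 * (fst z - snd z) ^ 4 \<le> l / 2 * G z" using G l by (intro mult_left_mono) auto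
    finally show ?thesis using True by simp
  next
    case False
    then have "(fst z - snd z)\<^sup>2 \<le> 1" by (simp add: abs_square_le_1)
    moreover have "0 \<le> l / 2 * G z" using l by (simp add: G_def)
    ultimately show ?thesis using False by simp
  qed
  have iS: "integrable ?P (indicator ?S :: _ \<Rightarrow> real)"
    by (rule integrable_real_indicator[OF S]) (simp add: P.emeasure_eq_measure)
  have "2 \<le> (\<integral>z. (fst z - snd z)\<^sup>2 \<partial>?P)" by (rule e2)
  also have "\<dots> \<le> (\<integral>z. 1 + l / 2 * G z + 1 / (2 * l) * indicator ?S z \<partial>?P)"
    by (rule integral_mono[OF i2 _ pw]) (use iG iS in simp)
  also have "\<dots> = 1 + l / 2 * (\<integral>z. G z \<partial>?P) + 1 / (2 * l) * measure ?P ?S"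
    using iG iS S P.prob_space by simp
  also have "\<dots> \<le> 1 + l / 2 * (16 * B) + 1 / (2 * l) * measure ?P ?S"
    using eG l by (intro add_mono mult_left_mono) auto
  finally have "1 / 2 \<le> 1 / (2 * l) * measure ?P ?S" using B_ge_1 by (simp add: l_def)
  then show ?thesis using l by (simp add: l_def field_simps)
qed

end

text \<open>Jensen's inequality for the conditional expectation given \<open>S\<close>.\<close>

lemma (in prob_space) exp_integral_le:
  assumes S: "S \<in> events" and p: "prob S > 0" and h: "integrable M h" "\<And>x. 0 \<le> h x"
  shows "exp (- (\<integral>x. h x \<partial>M)) \<le> (\<integral>x. indicator S x * exp (- prob S * h x) \<partial>M) / prob S"
proof -
  define m where "m = (\<integral>x. indicator S x * h x \<partial>M)"
  have i: "integrable M (\<lambda>x. indicator S x * h x)" using integrable_mult_indicator[OF S h(1)] by simp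
  have iS: "integrable M (indicator S :: _ \<Rightarrow> real)" using S by (simp add: integrable_real_indicator emeasure_eq_measure)
  have "m \<le> (\<integral>x. h x \<partial>M)" unfolding m_def
    by (rule integral_mono[OF i h(1)]) (auto simp: indicator_def h)
  then have "exp (- (\<integral>x. h x \<partial>M)) \<le> exp (- m)" by simp
  moreover have "prob S * exp (- m) \<le> (\<integral>x. indicator S x * exp (- prob S * h x) \<partial>M)"
  proof -
    \<comment> \<open>The tangent of exp lies below its graph, hence exp (- m) (1 + m - p h) \<le>
      exp (- p h) for p = \<open>prob S\<close>. Over S the left side integrates to p exp (- m),
      because m is the integral of h over S.\<close>
    have "prob S * exp (- m) = (\<integral>x. exp (- m) * (1 + m) * indicator S x - exp (- m) * prob S * (indicator S x * h x) \<partial>M)"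
      using i iS S by (simp add: m_def[symmetric]) (simp add: algebra_simps)
    also have "\<dots> \<le> (\<integral>x. indicator S x * exp (- prob S * h x) \<partial>M)"
    proof (rule integral_mono)
      show "integrable M (\<lambda>x. indicator S x * exp (- prob S * h x))"
        using S h by (intro integrable_const_bound[of _ 1]) (auto simp: indicator_def)
      show "exp (- m) * (1 + m) * indicator S x - exp (- m) * prob S * (indicator S x * h x) \<le> indicator S x * exp (- prob S * h x)" for x
      proof -
        have "exp (- m) * (1 + (m - prob S * h x)) \<le> exp (- m) * exp (m - prob S * h x)"
          by (intro mult_left_mono exp_ge_add_one_self) auto
        also have "\<dots> = exp (- prob S * h x)" by (simp flip: exp_add)
        finally show ?thesis by (auto simp: indicator_def algebra_simps)
      qed
    qed (use i iS in auto)
    finally show ?thesis .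
  qed
  ultimately have "prob S * exp (- (\<integral>x. h x \<partial>M)) \<le> (\<integral>x. indicator S x * exp (- prob S * h x) \<partial>M)"
    using p by (meson mult_left_mono order_trans less_imp_le)
  then show ?thesis using p by (subst pos_le_divide_eq) (simp_all add: mult.commute)
qed

text \<open>Because all coordinates have the law \<nu>, the product of characteristic functions is
  bounded by the exponential of minus one integral over a single symmetrized pair z, for all
  coordinates at once. Jensen's inequality, restricted to differences of size at least 1, an event
  of probability p \<ge> b, moves the exponential inside. For each such z the Gaussian integral is
  an instance of \<open>lcd_recurrence\<close> with |q| \<ge> 1 / (2 pi t), and the factor 1 / p
  from Jensen cancels against the probability of the event.\<close>

lemma (in moment_measure) small_ball_gaussian:
  assumes lcd: "lcd_ge \<gamma> \<alpha> D n a" and g0: "0 < \<gamma>" and al: "0 \<le> \<alpha>" and D: "0 < D" and t: "0 < t"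
    and b_def: "b = 1 / (16 * B)"
  shows "(\<integral>\<^sup>+g. ennreal (std_normal_density g * (\<Prod>k<n. cmod (char \<nu> (a k / t * g)))) \<partial>lborel)
    \<le> ennreal (4 * ((8 * t + 1 / D) / (\<gamma> * sqrt b) + exp (- b * \<alpha>\<^sup>2)))"
proof -
  let ?P = "\<nu> \<Otimes>\<^sub>M \<nu>"
  define S where "S = {z :: real \<times> real. 1 \<le> \<bar>fst z - snd z\<bar>}"
  define p where "p = measure ?P S"
  define V where "V = 4 * ((8 * t + 1 / D) / (\<gamma> * sqrt b) + exp (- b * \<alpha>\<^sup>2))"
  have b: "0 < b" using B_ge_1 by (simp add: b_def)
  have p: "b \<le> p" using symmetrized_spread by (simp add: b_def p_def S_def)
  then have p': "0 < p" using b by simp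
  note p = p p'
  have S[measurable]: "S \<in> sets ?P"
  proof -
    have "{z \<in> space ?P. 1 \<le> \<bar>fst z - snd z\<bar>} \<in> sets ?P" by measurable
    then show ?thesis by (simp add: space_pair_measure S_def)
  qed
  define F where "F q g = exp (- 4 * b * (lattice_dist n (\<lambda>k. g * (q / (2 * pi * t) * a k)))\<^sup>2)" for q g
  have F_meas[measurable]: "(\<lambda>z. F (u z) (v z)) \<in> borel_measurable N"
    if [measurable]: "u \<in> borel_measurable N" "v \<in> borel_measurable N" for N :: "'c measure" and u v
  proof -
    have [measurable]: "(\<lambda>w. lattice_dist n (\<lambda>k. w * a k)) \<in> borel_measurable borel"
      by (rule borel_measurable_continuous_onI[OF continuous_lattice_dist])
    have "(\<lambda>z. lattice_dist n (\<lambda>k. (v z * (u z / (2 * pi * t))) * a k)) \<in> borel_measurable N"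
      by (rule measurable_compose[of "\<lambda>z. v z * (u z / (2 * pi * t))" N borel "\<lambda>w. lattice_dist n (\<lambda>k. w * a k)"]) measurable
    then have [measurable]: "(\<lambda>z. lattice_dist n (\<lambda>k. v z * (u z / (2 * pi * t) * a k))) \<in> borel_measurable N"
      by (simp add: mult.assoc)
    show ?thesis unfolding F_def by measurable
  qed
  have F01: "0 \<le> F q g" "F q g \<le> 1" for q g using b by (auto simp: F_def)
  have pw: "(\<Prod>k<n. cmod (char \<nu> (a k / t * g))) \<le> (\<integral>z. indicator S z * F (fst z - snd z) g \<partial>?P) / p" for g
  proof -
    define h where "h z = (\<Sum>k<n. (1 - cos (a k / t * g * (fst z - snd z))) / 2)" for z :: "real \<times> real"
    have ik: "integrable ?P (\<lambda>z. (1 - cos (a k / t * g * (fst z - snd z))) / 2)" for k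
    proof -
      have "integrable ?P (\<lambda>z. cos (a k / t * g * (fst z - snd z)))"
        by (rule P.integrable_const_bound[of _ 1]) auto
      then show ?thesis by simp
    qed
    have ih: "integrable ?P h" unfolding h_def by (intro Bochner_Integration.integrable_sum ik)
    have h0: "0 \<le> h z" for z unfolding h_def by (intro sum_nonneg) simp
    have "(\<Prod>k<n. cmod (char \<nu> (a k / t * g)))
        \<le> (\<Prod>k<n. exp (- (\<integral>z. (1 - cos (a k / t * g * (fst z - snd z))) / 2 \<partial>?P)))"
      by (intro prod_mono conjI cmod_char_le_exp norm_ge_zero)
    also have "\<dots> = exp (- (\<integral>z. h z \<partial>?P))"
      unfolding h_def by (subst Bochner_Integration.integral_sum[OF ik]) (simp add: exp_sum sum_negf[symmetric])
    also have "\<dots> \<le> (\<integral>z. indicator S z * exp (- p * h z) \<partial>?P) / p"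
      unfolding p_def by (rule P.exp_integral_le[OF S _ ih h0]) (use p in \<open>simp add: p_def\<close>)
    also have "(\<integral>z. indicator S z * exp (- p * h z) \<partial>?P) \<le> (\<integral>z. indicator S z * F (fst z - snd z) g \<partial>?P)"
    proof (rule integral_mono)
      show "integrable ?P (\<lambda>z. indicator S z * exp (- p * h z))"
        using p h0 by (intro P.integrable_const_bound[of _ 1]) (use ih in \<open>auto simp: indicator_def\<close>)
      show "integrable ?P (\<lambda>z. indicator S z * F (fst z - snd z) g)"
        using F01 by (intro P.integrable_const_bound[of _ 1]) (auto simp: indicator_def)
      fix z :: "real \<times> real"
      define u where "u k = g * ((fst z - snd z) / (2 * pi * t) * a k)" for k
      have "2 * pi * u k = a k / t * g * (fst z - snd z)" for k using t by (simp add: u_def field_simps)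
      then have "h z = (\<Sum>k<n. (1 - cos (2 * pi * u k)) / 2)" by (simp add: h_def)
      moreover have "(\<Sum>k<n. 4 * (u k - of_int (round (u k)))\<^sup>2) \<le> (\<Sum>k<n. (1 - cos (2 * pi * u k)) / 2)"
      proof (rule sum_mono)
        fix k show "4 * (u k - of_int (round (u k)))\<^sup>2 \<le> (1 - cos (2 * pi * u k)) / 2"
          using one_minus_cos_ge[of "u k"] by (subst le_divide_eq_numeral1) simp
      qed
      moreover have "(\<Sum>k<n. 4 * (u k - of_int (round (u k)))\<^sup>2) = 4 * (lattice_dist n u)\<^sup>2"
        by (simp add: lattice_dist_def L2_set_def sum_nonneg flip: sum_distrib_left)
      ultimately have "4 * (lattice_dist n u)\<^sup>2 \<le> h z" by simp
      then have "b * (4 * (lattice_dist n u)\<^sup>2) \<le> p * h z" using p b h0 by (intro mult_mono) auto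
      then show "indicator S z * exp (- p * h z) \<le> indicator S z * F (fst z - snd z) g"
        unfolding F_def u_def[symmetric] by (intro mult_left_mono) (auto simp: mult_ac)
    qed
    finally show ?thesis using p by (simp add: divide_right_mono)
  qed
  interpret PL: pair_sigma_finite ?P lborel ..
  have "(\<integral>\<^sup>+g. ennreal (std_normal_density g * (\<Prod>k<n. cmod (char \<nu> (a k / t * g)))) \<partial>lborel)
    \<le> (\<integral>\<^sup>+g. (\<integral>\<^sup>+z. ennreal (1 / p) * (indicator S z * ennreal (std_normal_density g * F (fst z - snd z) g)) \<partial>?P) \<partial>lborel)"
  proof (intro nn_integral_mono)
    fix g
    have "ennreal (std_normal_density g * (\<Prod>k<n. cmod (char \<nu> (a k / t * g))))
      \<le> ennreal (std_normal_density g * ((\<integral>z. indicator S z * F (fst z - snd z) g \<partial>?P) / p))"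
      by (intro ennreal_leI mult_left_mono pw) auto
    also have "\<dots> = ennreal (\<integral>z. std_normal_density g / p * (indicator S z * F (fst z - snd z) g) \<partial>?P)"
      by simp
    also have "\<dots> = (\<integral>\<^sup>+z. ennreal (std_normal_density g / p * (indicator S z * F (fst z - snd z) g)) \<partial>?P)"
      using p F01 by (intro nn_integral_eq_integral[symmetric] integrable_mult_right P.integrable_const_bound[of _ 1])
         (auto simp: indicator_def)
    also have "\<dots> = (\<integral>\<^sup>+z. ennreal (1 / p) * (indicator S z * ennreal (std_normal_density g * F (fst z - snd z) g)) \<partial>?P)"
      using p F01 by (intro nn_integral_cong) (auto simp: indicator_def simp flip: ennreal_mult)
    finally show "ennreal (std_normal_density g * (\<Prod>k<n. cmod (char \<nu> (a k / t * g)))) \<le> \<dots>" .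
  qed
  also have "\<dots> = (\<integral>\<^sup>+z. (\<integral>\<^sup>+g. ennreal (1 / p) * (indicator S z * ennreal (std_normal_density g * F (fst z - snd z) g)) \<partial>lborel) \<partial>?P)"
    by (rule PL.Fubini') measurable
  also have "\<dots> \<le> (\<integral>\<^sup>+z. ennreal (V / p) * indicator S z \<partial>?P)"
  proof (intro nn_integral_mono)
    fix z :: "real \<times> real"
    show "(\<integral>\<^sup>+g. ennreal (1 / p) * (indicator S z * ennreal (std_normal_density g * F (fst z - snd z) g)) \<partial>lborel) \<le> ennreal (V / p) * indicator S z"
    proof (cases "z \<in> S")
      case True
      define q where "q = (fst z - snd z) / (2 * pi * t)"
      have q1: "1 \<le> \<bar>fst z - snd z\<bar>" using True by (simp add: S_def)
      then have q0: "q \<noteq> 0" using t by (auto simp: q_def)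
      have "(\<integral>\<^sup>+g. ennreal (std_normal_density g * F (fst z - snd z) g) \<partial>lborel)
          \<le> ennreal (4 * ((1 / \<bar>q\<bar> + 1 / D) / (\<gamma> * sqrt b) + exp (- b * \<alpha>\<^sup>2)))"
        unfolding F_def q_def[symmetric] by (rule lcd_recurrence[OF lcd g0 al D b q0])
      also have "\<dots> \<le> ennreal V"
      proof -
        have "1 / \<bar>q\<bar> = 2 * pi * t / \<bar>fst z - snd z\<bar>" using t by (simp add: q_def)
        also have "\<dots> \<le> 2 * pi * t / 1" using q1 t by (intro divide_left_mono) auto
        also have "\<dots> \<le> 8 * t" using pi_less_4 t by simp
        finally have "(1 / \<bar>q\<bar> + 1 / D) / (\<gamma> * sqrt b) \<le> (8 * t + 1 / D) / (\<gamma> * sqrt b)"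
          using g0 b by (intro divide_right_mono) auto
        then show ?thesis unfolding V_def by (intro ennreal_leI mult_left_mono add_right_mono) auto
      qed
      finally have "ennreal (1 / p) * (\<integral>\<^sup>+g. ennreal (std_normal_density g * F (fst z - snd z) g) \<partial>lborel) \<le> ennreal (1 / p) * ennreal V"
        by (rule mult_left_mono) simp
      also have "\<dots> = ennreal (V / p)" using p t D g0 b by (subst ennreal_mult[symmetric]) (auto simp: V_def)
      finally show ?thesis using True by (simp add: nn_integral_cmult)
    qed simp
  qed
  also have "\<dots> = ennreal (V / p) * ennreal p"
    by (subst nn_integral_cmult_indicator[OF S]) (simp add: P.emeasure_eq_measure p_def)
  also have "\<dots> = ennreal V" using p t D g0 b by (subst ennreal_mult[symmetric]) (auto simp: V_def)
  finally show ?thesis by (simp add: V_def)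
qed

lemma (in moment_measure) char_small_argument:
  assumes "\<bar>x\<bar> \<le> 1" "\<bar>g\<bar> \<le> 1 / B"
  shows "cmod (char \<nu> (x * g)) \<le> exp (- (x\<^sup>2 * g\<^sup>2) / 3)"
proof -
  have "(x * g)\<^sup>2 = \<bar>x\<bar>\<^sup>2 * \<bar>g\<bar>\<^sup>2" by (simp add: power_mult_distrib)
  also have "\<dots> \<le> 1\<^sup>2 * (1 / B)\<^sup>2" using assms B_ge_1 by (intro mult_mono power_mono) auto
  finally have "(x * g)\<^sup>2 * B \<le> (1 / B)\<^sup>2 * B" using B_ge_1 by (intro mult_right_mono) auto
  also have "\<dots> \<le> 1" using B_ge_1 by (simp add: power2_eq_square)
  finally show ?thesis using char_near_0[of "x * g"] by (simp add: power_mult_distrib)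
qed

section \<open>Exponential moments of independent sums and regrouping of independent
  families\<close>

context prob_space
begin

lemma char_distr_scale:
  assumes [measurable]: "random_variable borel Y"
  shows "char (distr M borel (\<lambda>\<omega>. c * Y \<omega>)) g = char (distr M borel Y) (c * g)"
  unfolding char_def by (simp add: integral_distr mult_ac)

lemma exp_moment_le:
  fixes Y :: "nat \<Rightarrow> 'a \<Rightarrow> real"
  assumes ind: "indep_vars (\<lambda>_. borel) Y {..<n}"
  shows "(\<integral>\<^sup>+\<omega>. ennreal (exp (- (\<Sum>j<n. x j * Y j \<omega>)\<^sup>2 / 2)) \<partial>M)
    \<le> (\<integral>\<^sup>+g. ennreal (std_normal_density g * (\<Prod>j<n. cmod (char (distr M borel (Y j)) (x j * g)))) \<partial>lborel)"
proof -
  have Y[measurable]: "j < n \<Longrightarrow> random_variable borel (Y j)" for j using ind by (auto simp: indep_vars_def)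
  have ind': "indep_vars (\<lambda>_. borel) (\<lambda>j \<omega>. x j * Y j \<omega>) {..<n}"
    by (rule indep_vars_compose2[OF ind]) simp
  define \<mu> where "\<mu> = distr M borel (\<lambda>\<omega>. \<Sum>j<n. x j * Y j \<omega>)"
  have Z[measurable]: "(\<lambda>\<omega>. \<Sum>j<n. x j * Y j \<omega>) \<in> borel_measurable M" by measurable
  have "real_distribution \<mu>" unfolding \<mu>_def by (rule real_distribution_distr[OF Z])
  from gaussian_char[OF this]
  have "(\<integral>\<^sup>+\<omega>. ennreal (exp (- (\<Sum>j<n. x j * Y j \<omega>)\<^sup>2 / 2)) \<partial>M) \<le> (\<integral>\<^sup>+g. ennreal (std_normal_density g * cmod (char \<mu> g)) \<partial>lborel)"
    unfolding \<mu>_def by (subst (asm) nn_integral_distr) auto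
  also have "\<dots> = (\<integral>\<^sup>+g. ennreal (std_normal_density g * (\<Prod>j<n. cmod (char (distr M borel (Y j)) (x j * g)))) \<partial>lborel)"
  proof (intro nn_integral_cong arg_cong[where f = ennreal] arg_cong2[where f = "(*)"] refl)
    fix g
    have "char \<mu> g = (\<Prod>j<n. char (distr M borel (\<lambda>\<omega>. x j * Y j \<omega>)) g)"
      unfolding \<mu>_def by (rule char_distr_sum[OF ind'])
    also have "\<dots> = (\<Prod>j<n. char (distr M borel (Y j)) (x j * g))"
      by (intro prod.cong refl char_distr_scale Y) simp
    finally show "cmod (char \<mu> g) = (\<Prod>j<n. cmod (char (distr M borel (Y j)) (x j * g)))" by (simp add: prod_norm)
  qed
  finally show ?thesis .
qed

text \<open>Exponential Markov inequality: on the event the exponent (s |I| - sum of squares) / 2 is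
  nonnegative, and the expectation of its exponential factors over i.\<close>

lemma tensorization:
  fixes Z :: "'i \<Rightarrow> 'a \<Rightarrow> real" and s q :: real
  assumes I: "finite I" and ind: "indep_vars (\<lambda>_. borel) Z I"
    and q: "\<And>i. i \<in> I \<Longrightarrow> (\<integral>\<^sup>+\<omega>. ennreal (exp (- (Z i \<omega>)\<^sup>2 / 2)) \<partial>M) \<le> ennreal q" "0 \<le> q"
  shows "prob {\<omega> \<in> space M. (\<Sum>i\<in>I. (Z i \<omega>)\<^sup>2) \<le> s * card I} \<le> (exp (s / 2) * q) ^ card I"
proof -
  have Z[measurable]: "i \<in> I \<Longrightarrow> random_variable borel (Z i)" for i using ind by (auto simp: indep_vars_def)
  let ?E = "{\<omega> \<in> space M. (\<Sum>i\<in>I. (Z i \<omega>)\<^sup>2) \<le> s * card I}"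
  have E: "?E \<in> events" by measurable
  have "emeasure M ?E = (\<integral>\<^sup>+\<omega>. indicator ?E \<omega> \<partial>M)" using E by simp
  also have "\<dots> \<le> (\<integral>\<^sup>+\<omega>. ennreal (exp (s / 2) ^ card I) * (\<Prod>i\<in>I. ennreal (exp (- (Z i \<omega>)\<^sup>2 / 2))) \<partial>M)"
  proof (intro nn_integral_mono)
    fix \<omega>
    have "1 \<le> exp (s / 2) ^ card I * (\<Prod>i\<in>I. exp (- (Z i \<omega>)\<^sup>2 / 2))" if "\<omega> \<in> ?E"
    proof -
      have "exp (s / 2) ^ card I * (\<Prod>i\<in>I. exp (- (Z i \<omega>)\<^sup>2 / 2)) = exp ((s * card I - (\<Sum>i\<in>I. (Z i \<omega>)\<^sup>2)) / 2)"
        using I by (simp flip: exp_sum exp_of_nat_mult exp_add add: sum_negf sum_divide_distrib[symmetric] field_simps)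
      then show ?thesis using that by simp
    qed
    then show "(indicator ?E \<omega> :: ennreal) \<le> ennreal (exp (s / 2) ^ card I) * (\<Prod>i\<in>I. ennreal (exp (- (Z i \<omega>)\<^sup>2 / 2)))"
      by (auto simp: indicator_def prod_ennreal prod_nonneg simp flip: ennreal_mult ennreal_1 intro!: ennreal_leI)
  qed
  also have "\<dots> = ennreal (exp (s / 2) ^ card I) * (\<integral>\<^sup>+\<omega>. (\<Prod>i\<in>I. ennreal (exp (- (Z i \<omega>)\<^sup>2 / 2))) \<partial>M)"
    by (rule nn_integral_cmult) measurable
  also have "(\<integral>\<^sup>+\<omega>. (\<Prod>i\<in>I. ennreal (exp (- (Z i \<omega>)\<^sup>2 / 2))) \<partial>M) = (\<Prod>i\<in>I. \<integral>\<^sup>+\<omega>. ennreal (exp (- (Z i \<omega>)\<^sup>2 / 2)) \<partial>M)"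
    by (rule indep_vars_nn_integral[OF I]) (auto intro!: indep_vars_compose2[OF ind])
  also have "\<dots> \<le> (\<Prod>i\<in>I. ennreal q)" by (rule prod_mono_ennreal) (rule q)
  also have "ennreal (exp (s / 2) ^ card I) * (\<Prod>i\<in>I. ennreal q) = ennreal ((exp (s / 2) * q) ^ card I)"
    using q(2) by (simp add: ennreal_mult ennreal_power power_mult_distrib)
  finally show ?thesis using q(2) by (simp add: emeasure_eq_measure mult_left_mono)
qed

lemma indep_vars_reindex_inj:
  assumes ind: "indep_vars (\<lambda>_. N) X I" and g: "inj_on g L" "g ` L \<subseteq> I"
  shows "indep_vars (\<lambda>_. N) (\<lambda>j. X (g j)) L"
proof -
  have "indep_vars (\<lambda>j. PiM {g j} (\<lambda>_. N)) (\<lambda>j \<omega>. restrict (\<lambda>i. X i \<omega>) {g j}) L"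
    by (rule indep_vars_restrict[OF ind]) (use g in \<open>auto simp: disjoint_family_on_def inj_on_def\<close>)
  from indep_vars_compose2[OF this, of "\<lambda>j f. f (g j)" "\<lambda>_. N"]
  show ?thesis by simp
qed

lemma indep_vars_row_sums:
  fixes Y :: "'i \<Rightarrow> 'j \<Rightarrow> 'a \<Rightarrow> real"
  assumes ind: "indep_vars (\<lambda>_. borel) (\<lambda>p. Y (fst p) (snd p)) (I \<times> J)"
  shows "indep_vars (\<lambda>_. borel) (\<lambda>i \<omega>. \<Sum>j\<in>J. x j * Y i j \<omega>) I"
proof -
  have "indep_vars (\<lambda>i. PiM ({i} \<times> J) (\<lambda>_. borel)) (\<lambda>i \<omega>. restrict (\<lambda>p. Y (fst p) (snd p) \<omega>) ({i} \<times> J)) I"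
    by (rule indep_vars_restrict[OF ind]) (auto simp: disjoint_family_on_def)
  from indep_vars_compose2[OF this, of "\<lambda>i f. \<Sum>j\<in>J. x j * f (i, j)" "\<lambda>_. borel"]
  show ?thesis by simp
qed

lemma indep_vars_row:
  assumes ind: "indep_vars (\<lambda>_. N) (\<lambda>p. Y (fst p) (snd p)) (I \<times> J)" and i: "i \<in> I"
  shows "indep_vars (\<lambda>_. N) (Y i) J"
  using indep_vars_reindex_inj[OF ind, of "Pair i" J] i by (auto simp: inj_on_def)

lemma indep_vars_transpose:
  assumes ind: "indep_vars (\<lambda>_. N) (\<lambda>p. Y (fst p) (snd p)) (I \<times> J)"
  shows "indep_vars (\<lambda>_. N) (\<lambda>p. Y (snd p) (fst p)) (J \<times> I)"
  using indep_vars_reindex_inj[OF ind, of prod.swap "J \<times> I"] by (simp add: product_swap)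

end

section \<open>Compressible vectors\<close>

text \<open>An operator norm bound in homogeneous form: it involves no supremum, and it passes to
  fewer rows and to the transpose.\<close>

definition op_le :: "'i set \<Rightarrow> nat \<Rightarrow> real \<Rightarrow> ('i \<Rightarrow> nat \<Rightarrow> real) \<Rightarrow> bool" where
  "op_le I n \<kappa> y \<longleftrightarrow> (\<forall>x. L2_set (\<lambda>i. \<Sum>j<n. x j * y i j) I \<le> \<kappa> * L2_set x {..<n})"

text \<open>\<open>spread\<close> is the notion of incompressibility used here.\<close>

definition spread :: "real \<Rightarrow> real \<Rightarrow> nat \<Rightarrow> (nat \<Rightarrow> real) \<Rightarrow> bool" where
  "spread \<rho> \<delta> n x \<longleftrightarrow> \<delta> * n \<le> real (card {k. k < n \<and> \<rho> / sqrt n \<le> \<bar>x k\<bar>})"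

text \<open>\<open>p0\<close> is the gap of \<open>gaussian_gap\<close> and \<open>b\<close> the
  probability of \<open>symmetrized_spread\<close>. \<rho> keeps the error of the compressible net
  below the small ball radius: (6 \<rho> K)^2 = 4 p0^2 / 9. \<delta> makes this net small: its
  entropy is n p0 / 8, against a probability exp (- n p0 / 4). \<open>lam\<close> and \<gamma> are
  what \<open>lcd_spread\<close> gives for spread vectors. \<mu> makes the union bound of a level
  decay like 3^(-n). \<eta> is such that the term exp (- b \<mu>^2 n) of the small ball bound equals
  exp (- \<eta> n), which is at most 1 / D on all levels D \<le> exp (\<eta> n).\<close>

locale rv_constants =
  fixes B K p0 b \<rho> \<delta> lam \<gamma> \<mu> \<eta> :: real
  assumes B: "1 \<le> B" and K: "1 \<le> K"
    and p0: "p0 = 1 / (400 * B ^ 3)" and b: "b = 1 / (16 * B)"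
    and rho: "\<rho> = p0 / (9 * K)" and delta: "\<delta> = p0\<^sup>2 * \<rho> / 768"
    and lam: "lam = \<delta> / 4" and gam: "\<gamma> = \<rho> * \<delta> / 2"
    and mu: "\<mu> = lam * \<gamma> * b / (9600 * K)" and eta: "\<eta> = b * \<mu>\<^sup>2"
begin

lemma p0_bounds: "0 < p0" "p0 \<le> 1 / 400"
  using B unfolding p0 by (auto simp: field_simps)

lemma b_bounds: "0 < b" "b \<le> 1 / 16" "b \<le> sqrt b"
proof -
  show 1: "0 < b" "b \<le> 1 / 16" using B unfolding b by (auto simp: field_simps)
  have "b\<^sup>2 \<le> b" using 1 by (simp add: power2_eq_square mult_left_le)
  then show "b \<le> sqrt b" by (rule real_le_rsqrt)
qed

lemma rho_bounds: "0 < \<rho>" "\<rho> \<le> p0"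
  using p0_bounds K unfolding rho by (auto simp: field_simps mult_left_le)

lemma delta_bounds: "0 < \<delta>" "\<delta> \<le> \<rho>"
proof -
  show "0 < \<delta>" using p0_bounds rho_bounds by (simp add: delta)
  have "p0\<^sup>2 \<le> 1" using p0_bounds by (intro power_le_one) auto
  then have "p0\<^sup>2 * \<rho> \<le> 1 * \<rho>" using rho_bounds by (intro mult_right_mono) auto
  then show "\<delta> \<le> \<rho>" using rho_bounds by (simp add: delta)
qed

lemma lam_bounds: "0 < lam" "lam \<le> 1 / 4"
  using delta_bounds rho_bounds p0_bounds by (auto simp: lam)

lemma gam_bounds: "0 < \<gamma>" "\<gamma> \<le> 1"
proof -
  show "0 < \<gamma>" using delta_bounds rho_bounds by (simp add: gam)
  have "\<rho> * \<delta> \<le> 1 * 1" using delta_bounds rho_bounds p0_bounds by (intro mult_mono) auto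
  then show "\<gamma> \<le> 1" by (simp add: gam)
qed

lemma mu_bounds: "0 < \<mu>" "\<mu> \<le> lam"
proof -
  show "0 < \<mu>" using lam_bounds gam_bounds b_bounds K by (simp add: mu)
  have "lam * \<gamma> * b \<le> lam * 1 * 1" using lam_bounds gam_bounds b_bounds by (intro mult_mono) auto
  also have "\<dots> = lam * 1" by simp
  also have "\<dots> \<le> lam * (9600 * K)" using lam_bounds K by (intro mult_left_mono) auto
  finally show "\<mu> \<le> lam" using K by (simp add: mu field_simps)
qed

lemma eta_bounds: "0 < \<eta>" "\<eta> \<le> 1 / 4" "\<eta> \<le> p0 / 8"
proof -
  show "0 < \<eta>" using b_bounds mu_bounds by (simp add: eta)
  have m: "\<mu> \<le> p0" "\<mu> \<le> 1" "\<mu> \<ge> 0"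
    using mu_bounds lam_bounds delta_bounds rho_bounds p0_bounds by (auto simp: lam)
  have "b * (\<mu> * \<mu>) \<le> 1/16 * (p0 * 1)" using b_bounds m by (intro mult_mono) auto
  then show "\<eta> \<le> p0 / 8" by (simp add: eta power2_eq_square)
      (use p0_bounds in linarith)
  then show "\<eta> \<le> 1 / 4" using p0_bounds by linarith
qed

end

lemma sum_abs_le_L2_set:
  assumes "finite A" "T \<subseteq> A"
  shows "(\<Sum>k\<in>T. \<bar>x k\<bar>) \<le> sqrt (card T) * L2_set x A"
proof -
  have fT: "finite T" using assms finite_subset by blast
  have "(\<Sum>k\<in>T. \<bar>x k\<bar>) = (\<Sum>k\<in>T. \<bar>1\<bar> * \<bar>x k\<bar>)" by simp
  also have "\<dots> \<le> L2_set (\<lambda>_. 1) T * L2_set x T" by (rule L2_set_mult_ineq)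
  also have "L2_set (\<lambda>_. 1) T = sqrt (card T)" by (simp add: L2_set_def)
  also have "L2_set x T \<le> L2_set x A"
    unfolding L2_set_def using assms by (intro real_sqrt_le_mono sum_mono2) auto
  finally show ?thesis by (simp add: mult_left_mono)
qed

text \<open>Truncation towards 0 is used instead of rounding to the nearest integer: it does not
  increase absolute values, so the l1 norm of the lattice point is controlled by that of the
  vector.\<close>

lemma truncation_exists: "\<exists>m::int. \<bar>real_of_int m\<bar> \<le> \<bar>u\<bar> \<and> \<bar>u - real_of_int m\<bar> \<le> 1"
proof (cases "u \<ge> 0")
  case True
  then have "0 \<le> real_of_int \<lfloor>u\<rfloor>" by simp
  then show ?thesis using True floor_correct[of u] by (intro exI[of _ "\<lfloor>u\<rfloor>"]) linarith
next
  case False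
  then have "real_of_int \<lceil>u\<rceil> \<le> 0" by simp
  then show ?thesis using False ceiling_correct[of u] by (intro exI[of _ "\<lceil>u\<rceil>"]) linarith
qed

text \<open>Coordinates below \<rho> / \<surd>n are replaced by 0, at a total cost of \<rho>; the at
  most \<delta> n others are truncated to multiples of h, at a cost of h \<surd>(\<delta> n) =
  \<rho>. Cauchy-Schwarz on these few coordinates bounds their l1 norm by \<surd>(\<delta> n), which
  after division by h is \<delta> n / \<rho>.\<close>

lemma not_spread_lattice_approx:
  fixes x :: "nat \<Rightarrow> real"
  assumes x: "L2_set x {..<n} = 1" and ns: "\<not> spread \<rho> \<delta> n x" and pos: "0 < \<rho>" "0 < \<delta>" "1 \<le> n"
    and h: "h = \<rho> / sqrt (\<delta> * n)"
  shows "\<exists>p \<in> lattice_l1 n (\<delta> * n / \<rho>). L2_set (\<lambda>k. x k - h * p k) {..<n} \<le> 2 * \<rho>"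
proof -
  define T where "T = {k. k < n \<and> \<rho> / sqrt n \<le> \<bar>x k\<bar>}"
  have T: "T \<subseteq> {..<n}" "finite T" by (auto simp: T_def)
  have cT: "real (card T) \<le> \<delta> * n" using ns by (simp add: spread_def T_def)
  have h0: "0 < h" using pos by (simp add: h)
  obtain tr :: "real \<Rightarrow> int" where tr: "\<And>u. \<bar>real_of_int (tr u)\<bar> \<le> \<bar>u\<bar>" "\<And>u. \<bar>u - real_of_int (tr u)\<bar> \<le> 1"
    using truncation_exists by metis
  define p where "p k = (if k < n then if k \<in> T then tr (x k / h) else 0 else undefined)" for k
  have "(\<Sum>k<n. \<bar>real_of_int (p k)\<bar>) = (\<Sum>k\<in>T. \<bar>real_of_int (tr (x k / h))\<bar>)"
    using T by (intro sum.mono_neutral_cong_right) (auto simp: p_def)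
  also have "\<dots> \<le> (\<Sum>k\<in>T. \<bar>x k\<bar> / h)"
  proof (rule sum_mono)
    fix k show "\<bar>real_of_int (tr (x k / h))\<bar> \<le> \<bar>x k\<bar> / h" using tr(1)[of "x k / h"] h0 by simp
  qed
  also have "\<dots> = (\<Sum>k\<in>T. \<bar>x k\<bar>) / h" by (simp add: sum_divide_distrib)
  also have "\<dots> \<le> (sqrt (card T) * L2_set x {..<n}) / h"
    using h0 by (intro divide_right_mono sum_abs_le_L2_set T) auto
  also have "\<dots> \<le> sqrt (\<delta> * n) / h" using cT h0 x by (intro divide_right_mono) auto
  also have "\<dots> = \<delta> * n / \<rho>" using pos by (simp add: h)
  finally have pl: "p \<in> lattice_l1 n (\<delta> * n / \<rho>)" by (auto simp: lattice_l1_def PiE_iff p_def extensional_def)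
  have "L2_set (\<lambda>k. x k - h * p k) {..<n}
      = L2_set (\<lambda>k. (if k \<in> T then 0 else x k) + (if k \<in> T then x k - h * p k else 0)) {..<n}"
    by (intro L2_set_cong) (auto simp: p_def)
  also have "\<dots> \<le> L2_set (\<lambda>k. if k \<in> T then 0 else x k) {..<n} + L2_set (\<lambda>k. if k \<in> T then x k - h * p k else 0) {..<n}"
    by (rule L2_set_triangle_ineq)
  also have "L2_set (\<lambda>k. if k \<in> T then 0 else x k) {..<n} \<le> \<rho>"
  proof -
    have "(\<Sum>k<n. (if k \<in> T then 0 else x k)\<^sup>2) \<le> (\<Sum>k<n. (\<rho> / sqrt n)\<^sup>2)"
    proof (rule sum_mono)
      fix k assume "k \<in> {..<n}"
      then have "\<bar>x k\<bar> \<le> \<rho> / sqrt n" if "k \<notin> T" using that by (auto simp: T_def)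
      then show "(if k \<in> T then 0 else x k)\<^sup>2 \<le> (\<rho> / sqrt n)\<^sup>2"
        using power_mono[of "\<bar>x k\<bar>" "\<rho> / sqrt n" 2] by auto
    qed
    also have "\<dots> = \<rho>\<^sup>2" using pos by (simp add: power_divide)
    finally show ?thesis using pos by (simp add: L2_set_def real_le_lsqrt)
  qed
  also have "L2_set (\<lambda>k. if k \<in> T then x k - h * p k else 0) {..<n} \<le> \<rho>"
  proof -
    have "(\<Sum>k<n. (if k \<in> T then x k - h * p k else 0)\<^sup>2) = (\<Sum>k\<in>T. (x k - h * p k)\<^sup>2)"
      using T by (intro sum.mono_neutral_cong_right) auto
    also have "\<dots> \<le> (\<Sum>k\<in>T. h\<^sup>2)"
    proof (rule sum_mono)
      fix k assume k: "k \<in> T"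
      have "\<bar>x k - h * p k\<bar> = h * \<bar>x k / h - real_of_int (tr (x k / h))\<bar>"
        using k T h0 by (auto simp: p_def abs_mult_pos' right_diff_distrib)
      also have "\<dots> \<le> h * 1" using h0 by (intro mult_left_mono tr) auto
      finally show "(x k - h * p k)\<^sup>2 \<le> h\<^sup>2" using power_mono[of "\<bar>x k - h * p k\<bar>" h 2] by simp
    qed
    also have "\<dots> \<le> (\<delta> * n) * h\<^sup>2" using cT by (simp add: mult_right_mono)
    also have "\<dots> = \<rho>\<^sup>2" using pos by (simp add: h power_divide)
    finally show ?thesis using pos by (simp add: L2_set_def real_le_lsqrt)
  qed
  finally show ?thesis using pl by auto
qed

lemma L2_set_row_sums_triangle:
  "L2_set (\<lambda>i. \<Sum>j<n. (x j - x' j) * y i j) I \<ge> L2_set (\<lambda>i. \<Sum>j<n. x j * y i j) I - L2_set (\<lambda>i. \<Sum>j<n. x' j * y i j) I"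
proof -
  have "L2_set (\<lambda>i. \<Sum>j<n. x j * y i j) I = L2_set (\<lambda>i. (\<Sum>j<n. (x j - x' j) * y i j) + (\<Sum>j<n. x' j * y i j)) I"
    by (intro L2_set_cong refl) (simp add: left_diff_distrib sum_subtractf)
  also have "\<dots> \<le> L2_set (\<lambda>i. \<Sum>j<n. (x j - x' j) * y i j) I + L2_set (\<lambda>i. \<Sum>j<n. x' j * y i j) I"
    by (rule L2_set_triangle_ineq)
  finally show ?thesis by simp
qed

lemma L2_set_scaled_row_sums:
  "L2_set (\<lambda>i. \<Sum>j<n. (c * x j) * y i j) I = \<bar>c\<bar> * L2_set (\<lambda>i. \<Sum>j<n. x j * y i j) I"
  by (simp add: mult.assoc sum_distrib_left[symmetric] L2_set_scale)

lemma L2_set_le_iff: "0 \<le> c \<Longrightarrow> L2_set f A \<le> c \<longleftrightarrow> (\<Sum>i\<in>A. (f i)\<^sup>2) \<le> c\<^sup>2"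
  by (metis L2_set_def abs_of_nonneg real_sqrt_abs real_sqrt_le_iff)

text \<open>The first index numbers the independent sums, the second the coordinates of the test
  vector. The locale is used for the columns of the matrix, for the transposed indexing, for all
  columns but one and for a single column.\<close>

locale random_entries = prob_space M for M :: "'w measure" +
  fixes I :: "nat set" and n :: nat and Y :: "nat \<Rightarrow> nat \<Rightarrow> 'w \<Rightarrow> real" and B :: real
  assumes finI: "finite I"
    and ind: "indep_vars (\<lambda>_. borel) (\<lambda>p. Y (fst p) (snd p)) (I \<times> {..<n})"
    and mc: "\<And>i j. i \<in> I \<Longrightarrow> j < n \<Longrightarrow> moment_class B (distr M borel (Y i j))"
begin

lemma Y_measurable[measurable]: "i \<in> I \<Longrightarrow> j < n \<Longrightarrow> Y i j \<in> borel_measurable M"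
  using ind unfolding indep_vars_def by fastforce

lemma moment: "i \<in> I \<Longrightarrow> j < n \<Longrightarrow> moment_measure (distr M borel (Y i j)) B"
  using mc[of i j] by (simp add: moment_measure_def moment_measure_axioms_def moment_class_def)

lemma row_sum_measurable[measurable]: "i \<in> I \<Longrightarrow> (\<lambda>\<omega>. \<Sum>j<n. x j * Y i j \<omega>) \<in> borel_measurable M"
  by (intro borel_measurable_sum borel_measurable_times borel_measurable_const Y_measurable) auto

text \<open>Since the squares of the \<open>x j\<close> add up to 1, the product of the factors exp
  (- (x j)^2 g^2 / 3) is exp (- g^2 / 3) whatever x is, so \<open>gaussian_gap\<close> gives 1 - p0
  per sum. The loss exp (p0 / 2) from the threshold p0 leaves exp (- p0 / 2).\<close>

lemma unit_vector_small_ball: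
  assumes x: "L2_set x {..<n} = 1" and B: "1 \<le> B" and p0: "p0 = 1 / (400 * B ^ 3)"
  shows "prob {\<omega> \<in> space M. (\<Sum>i\<in>I. (\<Sum>j<n. x j * Y i j \<omega>)\<^sup>2) \<le> p0 * card I} \<le> exp (- p0 / 2 * card I)"
proof -
  have "1 \<le> B ^ 3" using B by simp
  then have "1 \<le> 400 * B ^ 3" by simp
  then have p01: "0 < p0" "p0 \<le> 1" unfolding p0 by (simp_all only: zero_less_divide_1_iff divide_le_eq_1_pos)
  have x2: "(\<Sum>j<n. (x j)\<^sup>2) = 1" using x by (simp add: L2_set_def)
  have x1: "\<bar>x j\<bar> \<le> 1" if "j < n" for j using member_le_L2_set[of "{..<n}" j "\<lambda>j. \<bar>x j\<bar>"] that x by (simp add: L2_set_def)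
  have "prob {\<omega> \<in> space M. (\<Sum>i\<in>I. (\<Sum>j<n. x j * Y i j \<omega>)\<^sup>2) \<le> p0 * card I} \<le> (exp (p0 / 2) * (1 - p0)) ^ card I"
  proof (rule tensorization[OF finI, where Z = "\<lambda>i \<omega>. \<Sum>j<n. x j * Y i j \<omega>" and s = p0 and q = "1 - p0"])
    show "indep_vars (\<lambda>_. borel) (\<lambda>i \<omega>. \<Sum>j<n. x j * Y i j \<omega>) I" by (rule indep_vars_row_sums[OF ind])
    show "0 \<le> 1 - p0" using p01 by simp
    fix i assume i: "i \<in> I"
    have "(\<integral>\<^sup>+\<omega>. ennreal (exp (- (\<Sum>j<n. x j * Y i j \<omega>)\<^sup>2 / 2)) \<partial>M)
      \<le> (\<integral>\<^sup>+g. ennreal (std_normal_density g * (\<Prod>j<n. cmod (char (distr M borel (Y i j)) (x j * g)))) \<partial>lborel)"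
      by (rule exp_moment_le[OF indep_vars_row[OF ind i]])
    also have "\<dots> \<le> ennreal (1 - 1 / (400 * B ^ 3))"
    proof (rule gaussian_gap[OF B])
      have cm: "(\<lambda>g. cmod (char (distr M borel (Y i j)) (x j * g))) \<in> borel_measurable borel"
        and c1: "cmod (char (distr M borel (Y i j)) (x j * g)) \<le> 1" if "j < n" for j g
      proof -
        interpret m: moment_measure "distr M borel (Y i j)" B by (rule moment[OF i that])
        show "(\<lambda>g. cmod (char (distr M borel (Y i j)) (x j * g))) \<in> borel_measurable borel" by measurable
        show "cmod (char (distr M borel (Y i j)) (x j * g)) \<le> 1" by (rule m.cmod_char_le_1)
      qed
      show "(\<lambda>g. \<Prod>j<n. cmod (char (distr M borel (Y i j)) (x j * g))) \<in> borel_measurable borel"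
        by (rule borel_measurable_prod) (auto intro: cm)
      show "0 \<le> (\<Prod>j<n. cmod (char (distr M borel (Y i j)) (x j * g)))" for g by (intro prod_nonneg) auto
      show "(\<Prod>j<n. cmod (char (distr M borel (Y i j)) (x j * g))) \<le> 1" for g
        by (rule prod_le_1) (auto intro: c1)
      fix g assume g: "\<bar>g\<bar> \<le> 1 / B"
      have "(\<Prod>j<n. cmod (char (distr M borel (Y i j)) (x j * g))) \<le> (\<Prod>j<n. exp (- ((x j)\<^sup>2 * g\<^sup>2) / 3))"
      proof (intro prod_mono conjI norm_ge_zero)
        fix j assume j: "j \<in> {..<n}"
        then have "moment_measure (distr M borel (Y i j)) B" by (intro moment[OF i]) auto
        then interpret m: moment_measure "distr M borel (Y i j)" B .
        show "cmod (char (distr M borel (Y i j)) (x j * g)) \<le> exp (- ((x j)\<^sup>2 * g\<^sup>2) / 3)"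
          using j by (intro m.char_small_argument x1 g) auto
      qed
      also have "\<dots> = exp (\<Sum>j<n. - ((x j)\<^sup>2 * g\<^sup>2) / 3)" by (simp add: exp_sum)
      also have "(\<Sum>j<n. - ((x j)\<^sup>2 * g\<^sup>2) / 3) = (\<Sum>j<n. (x j)\<^sup>2) * (- g\<^sup>2 / 3)"
        unfolding sum_distrib_right by (intro sum.cong) auto
      finally show "(\<Prod>j<n. cmod (char (distr M borel (Y i j)) (x j * g))) \<le> exp (- g\<^sup>2 / 3)" by (simp add: x2)
    qed
    finally show "(\<integral>\<^sup>+\<omega>. ennreal (exp (- (\<Sum>j<n. x j * Y i j \<omega>)\<^sup>2 / 2)) \<partial>M) \<le> ennreal (1 - p0)" by (simp add: p0)
  qed
  also have "\<dots> \<le> exp (- p0 / 2) ^ card I"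
  proof (rule power_mono)
    have "exp (p0 / 2) * (1 + - p0) \<le> exp (p0 / 2) * exp (- p0)" by (intro mult_left_mono exp_ge_add_one_self) auto
    then show "exp (p0 / 2) * (1 - p0) \<le> exp (- p0 / 2)" by (simp flip: exp_add)
  qed (use p01 in auto)
  finally show ?thesis by (simp flip: exp_of_nat_mult add: mult.commute)
qed

text \<open>The norm bound carries the small ball estimate from the points of a net to all vectors
  that are not spread. The hypothesis n \<le> 2 |I| covers both the square matrix and, for n \<ge>
  2, the family with one sum missing.\<close>

lemma compressible:
  assumes c: "rv_constants B K p0 b \<rho> \<delta> lam \<gamma> \<mu> \<eta>" and n: "1 \<le> n" and m: "n \<le> 2 * card I"
  shows "\<exists>E\<in>events. prob E \<le> exp (- p0 / 8 * n) \<and>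
    (\<forall>\<omega>\<in>space M - E. \<forall>x. op_le I n (K * sqrt n) (\<lambda>i j. Y i j \<omega>) \<and> L2_set x {..<n} = 1 \<and>
       L2_set (\<lambda>i. \<Sum>j<n. x j * Y i j \<omega>) I \<le> \<rho> * K * sqrt n \<longrightarrow> spread \<rho> \<delta> n x)"
proof -
  interpret rv_constants B K p0 b \<rho> \<delta> lam \<gamma> \<mu> \<eta> by fact
  define h where "h = \<rho> / sqrt (\<delta> * n)"
  define v where "v p = (\<lambda>k. h * real_of_int (p k))" for p :: "nat \<Rightarrow> int"
  define w where "w p = (\<lambda>k. (1 / L2_set (v p) {..<n}) * v p k)" for p
  \<comment> \<open>An approximant is within 2 \<rho> of a unit vector, so its norm is at least 1 /
    2; this permits normalization at the cost of a factor 2.\<close>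
  define P where "P = {p \<in> lattice_l1 n (\<delta> * n / \<rho>). 1 / 2 \<le> L2_set (v p) {..<n}}"
  define F where "F p = {\<omega> \<in> space M. (\<Sum>i\<in>I. (\<Sum>j<n. w p j * Y i j \<omega>)\<^sup>2) \<le> p0 * card I}" for p
  have fP: "finite P" unfolding P_def by (simp add: finite_lattice_l1)
  have F[measurable]: "F p \<in> events" for p unfolding F_def by measurable
  have w: "L2_set (w p) {..<n} = 1" if "p \<in> P" for p
    using that unfolding w_def L2_set_scale by (auto simp: P_def)
  let ?E = "\<Union>p\<in>P. F p"
  have "prob ?E \<le> (\<Sum>p\<in>P. prob (F p))" by (rule finite_measure_subadditive_finite[OF fP]) auto
  also have "\<dots> \<le> (\<Sum>p\<in>P. exp (- p0 / 2 * card I))"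
    unfolding F_def by (intro sum_mono unit_vector_small_ball w B p0)
  \<comment> \<open>The net is counted with x = p0 / 48: by the choice of \<delta> both terms of the
    exponent are n p0 / 16, together half of the gain n p0 / 4.\<close>
  also have "\<dots> \<le> exp (3 * (p0 / 48) * n + (\<delta> * n / \<rho>) / (p0 / 48)) * exp (- p0 / 4 * n)"
  proof -
    have "real (card P) \<le> real (card (lattice_l1 n (\<delta> * n / \<rho>)))"
      by (intro of_nat_mono card_mono finite_lattice_l1) (auto simp: P_def)
    also have "\<dots> \<le> exp (3 * (p0 / 48) * n + (\<delta> * n / \<rho>) / (p0 / 48))"
      using p0_bounds delta_bounds rho_bounds by (intro card_lattice_l1_small) auto
    finally have "real (card P) \<le> exp (3 * (p0 / 48) * n + (\<delta> * n / \<rho>) / (p0 / 48))" .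
    moreover have "p0 * real n \<le> p0 * (2 * card I)" using m p0_bounds by (intro mult_left_mono) linarith+
    then have "exp (- p0 / 2 * card I) \<le> exp (- p0 / 4 * n)" by simp
    ultimately show ?thesis by (simp add: mult_mono)
  qed
  also have "\<dots> = exp (- p0 / 8 * n)"
    using p0_bounds rho_bounds by (simp add: delta power2_eq_square flip: exp_add)
  finally have pE: "prob ?E \<le> exp (- p0 / 8 * n)" .
  moreover have "spread \<rho> \<delta> n x"
    if \<omega>: "\<omega> \<in> space M - ?E" and op: "op_le I n (K * sqrt n) (\<lambda>i j. Y i j \<omega>)" and x: "L2_set x {..<n} = 1"
      and small: "L2_set (\<lambda>i. \<Sum>j<n. x j * Y i j \<omega>) I \<le> \<rho> * K * sqrt n" for \<omega> x
  proof (rule ccontr)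
    assume ns: "\<not> spread \<rho> \<delta> n x"
    obtain p where p: "p \<in> lattice_l1 n (\<delta> * n / \<rho>)" "L2_set (\<lambda>k. x k - v p k) {..<n} \<le> 2 * \<rho>"
      using not_spread_lattice_approx[OF x ns rho_bounds(1) delta_bounds(1) n h_def] by (auto simp: v_def)
    have "1 \<le> L2_set (\<lambda>k. x k - v p k) {..<n} + L2_set (v p) {..<n}"
      using L2_set_triangle_ineq[of "\<lambda>k. x k - v p k" "v p" "{..<n}"] x by simp
    then have half: "1 / 2 \<le> L2_set (v p) {..<n}" using p(2) rho_bounds p0_bounds by linarith
    then have pP: "p \<in> P" using p by (simp add: P_def)
    define R where "R z = L2_set (\<lambda>i. \<Sum>j<n. z j * Y i j \<omega>) I" for z
    have "R (v p) - R x \<le> R (\<lambda>k. v p k - x k)" unfolding R_def by (rule L2_set_row_sums_triangle)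
    also have "\<dots> \<le> K * sqrt n * L2_set (\<lambda>k. v p k - x k) {..<n}" unfolding R_def by (rule op[unfolded op_le_def, rule_format])
    also have "\<dots> \<le> K * sqrt n * (2 * \<rho>)"
    proof -
      have "L2_set (\<lambda>k. v p k - x k) {..<n} = L2_set (\<lambda>k. x k - v p k) {..<n}" by (simp add: L2_set_def power2_commute)
      then show ?thesis using p(2) K by (intro mult_left_mono) auto
    qed
    finally have 1: "R (v p) \<le> 3 * \<rho> * K * sqrt n" using small unfolding R_def by (simp add: algebra_simps)
    have "R (w p) = 1 / L2_set (v p) {..<n} * R (v p)"
      unfolding R_def w_def by (subst L2_set_scaled_row_sums) simp
    also have "\<dots> \<le> 2 * (3 * \<rho> * K * sqrt n)"
      using half 1 by (intro mult_mono) (auto simp: R_def field_simps)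
    finally have "R (w p) \<le> 6 * \<rho> * K * sqrt n" by simp
    then have "(\<Sum>i\<in>I. (\<Sum>j<n. w p j * Y i j \<omega>)\<^sup>2) \<le> (6 * \<rho> * K * sqrt n)\<^sup>2"
      using rho_bounds K unfolding R_def by (subst (asm) L2_set_le_iff) auto
    also have "\<dots> = 36 / 81 * p0 * p0 * n" using K by (simp add: rho power2_eq_square)
    also have "\<dots> \<le> 36 / 81 * p0 * 1 * (2 * card I)"
      using p0_bounds m by (intro mult_mono) (auto simp: field_simps)
    also have "\<dots> \<le> p0 * card I" using p0_bounds by simp
    finally have "\<omega> \<in> F p" using \<omega> by (simp add: F_def)
    then show False using \<omega> pP by auto
  qed
  ultimately show ?thesis by (intro bexI[of _ ?E]) (auto intro!: sets.finite_UN fP)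
qed

end

section \<open>Structure of normal vectors\<close>

lemma lcd_ge_mono: "lcd_ge \<gamma> \<alpha> D n a \<Longrightarrow> D' \<le> D \<Longrightarrow> lcd_ge \<gamma> \<alpha> D' n a"
  by (auto simp: lcd_ge_def)

text \<open>For small \<theta> the multiples \<theta> x k stay within 1 / 2 of 0, so each coordinate
  contributes its full size to the lattice distance. This needs an upper bound on the coordinates:
  at most \<delta> n / 4 of them exceed 2 / \<surd>(\<delta> n) because x has norm 1, and of the
  \<delta> n coordinates of size at least \<rho> / \<surd>n enough remain.\<close>

lemma lcd_spread:
  assumes x: "L2_set x {..<n} = 1" and sp: "spread \<rho> \<delta> n x" and d: "0 < \<delta>" "\<delta> \<le> 1" and r: "0 < \<rho>" and n: "1 \<le> n"
  shows "lcd_ge (\<rho> * \<delta> / 2) \<alpha> (\<delta> / 4 * sqrt n) n x"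
proof -
  define T where "T = {k. k < n \<and> \<rho> / sqrt n \<le> \<bar>x k\<bar>}"
  define H where "H = {k. k < n \<and> 2 / sqrt (\<delta> * n) < \<bar>x k\<bar>}"
  have fin: "finite T" "finite H" "T \<subseteq> {..<n}" "H \<subseteq> {..<n}" by (auto simp: T_def H_def)
  have x2: "(\<Sum>k<n. (x k)\<^sup>2) = 1" using x by (simp add: L2_set_def)
  have "real (card H) * (4 / (\<delta> * n)) = (\<Sum>k\<in>H. (2 / sqrt (\<delta> * n))\<^sup>2)" using d n by (simp add: power_divide)
  also have "\<dots> \<le> (\<Sum>k\<in>H. (x k)\<^sup>2)"
  proof (rule sum_mono)
    fix k assume "k \<in> H"
    then show "(2 / sqrt (\<delta> * n))\<^sup>2 \<le> (x k)\<^sup>2"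
      using power_mono[of "2 / sqrt (\<delta> * n)" "\<bar>x k\<bar>" 2] d by (simp add: H_def)
  qed
  also have "\<dots> \<le> (\<Sum>k<n. (x k)\<^sup>2)" using fin by (intro sum_mono2) auto
  finally have cH: "real (card H) \<le> \<delta> * n / 4" using d n by (simp add: x2 field_simps)
  have cT: "\<delta> * n \<le> real (card T)" using sp by (simp add: spread_def T_def)
  have "card T - card H \<le> card (T - H)" using fin by (intro diff_card_le_card_Diff) auto
  then have cU: "\<delta> * n / 4 \<le> real (card (T - H))" using cT cH mult_nonneg_nonneg[of \<delta> "real n"] d by linarith
  have "\<rho> * \<delta> / 2 * \<theta> \<le> lattice_dist n (\<lambda>k. \<theta> * x k)" if th: "0 \<le> \<theta>" "\<theta> \<le> \<delta> / 4 * sqrt n" for \<theta>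
  proof -
    have "(\<rho> * \<delta> / 2 * \<theta>)\<^sup>2 = \<delta>\<^sup>2 * (\<rho>\<^sup>2 * \<theta>\<^sup>2 / 4)" by (simp add: power_mult_distrib power_divide)
    also have "\<dots> \<le> \<delta> * (\<rho>\<^sup>2 * \<theta>\<^sup>2 / 4)" using d by (intro mult_right_mono) (auto simp: power2_eq_square mult_left_le)
    also have "\<dots> = \<delta> * n / 4 * (\<theta> * (\<rho> / sqrt n))\<^sup>2" using n by (simp add: power_mult_distrib power_divide)
    also have "\<dots> \<le> real (card (T - H)) * (\<theta> * (\<rho> / sqrt n))\<^sup>2" using cU by (intro mult_right_mono) auto
    also have "\<dots> = (\<Sum>k\<in>T - H. (\<theta> * (\<rho> / sqrt n))\<^sup>2)" by simp
    also have "\<dots> \<le> (\<Sum>k\<in>T - H. (\<theta> * x k - of_int (round (\<theta> * x k)))\<^sup>2)"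
    proof (rule sum_mono)
      fix k assume k: "k \<in> T - H"
      have "\<theta> * \<bar>x k\<bar> \<le> (\<delta> / 4 * sqrt n) * (2 / sqrt (\<delta> * n))"
        using k th d by (intro mult_mono) (auto simp: T_def H_def)
      also have "\<dots> = sqrt \<delta> / 2" using d n by (simp add: real_sqrt_mult field_simps)
      also have "\<dots> \<le> 1 / 2" using d by simp
      finally have le: "\<bar>\<theta> * x k\<bar> \<le> 1 / 2" using th by (simp add: abs_mult)
      have "\<theta> * (\<rho> / sqrt n) \<le> \<theta> * \<bar>x k\<bar>" using k th by (intro mult_left_mono) (auto simp: T_def)
      also have "\<dots> \<le> \<bar>\<theta> * x k - of_int (round (\<theta> * x k))\<bar>"
      \<comment> \<open>A multiple equal to 1 / 2 is rounded to 1, but there the distances to 0 and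
        to 1 agree.\<close>
      proof (cases "round (\<theta> * x k) = 0")
        case True
        then show ?thesis using th by (simp add: abs_mult)
      next
        case False
        then have "1 \<le> \<bar>round (\<theta> * x k)\<bar>" by linarith
        then have "1 \<le> \<bar>real_of_int (round (\<theta> * x k))\<bar>" by (metis of_int_1_le_iff of_int_abs)
        then show ?thesis using le th by (simp add: abs_mult)
      qed
      finally show "(\<theta> * (\<rho> / sqrt n))\<^sup>2 \<le> (\<theta> * x k - of_int (round (\<theta> * x k)))\<^sup>2"
        using power_mono[of "\<theta> * (\<rho> / sqrt n)" "\<bar>\<theta> * x k - of_int (round (\<theta> * x k))\<bar>" 2] th r by simp
    qed
    also have "\<dots> \<le> (\<Sum>k<n. (\<theta> * x k - of_int (round (\<theta> * x k)))\<^sup>2)" using fin by (intro sum_mono2) auto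
    finally show ?thesis unfolding lattice_dist_def L2_set_def by (rule real_le_rsqrt)
  qed
  then show ?thesis unfolding lcd_ge_def by (auto simp: min.coboundedI1)
qed

context random_entries
begin

lemma lcd_row_bound:
  assumes iid: "\<And>i j. i \<in> I \<Longrightarrow> j < n \<Longrightarrow> distr M borel (Y i j) = \<nu> i"
    and lcd: "lcd_ge \<gamma> \<alpha> D n a" "0 < \<gamma>" "0 \<le> \<alpha>" "0 < D" "0 < t" and b: "b = 1 / (16 * B)" and i: "i \<in> I" and n: "1 \<le> n"
  shows "(\<integral>\<^sup>+\<omega>. ennreal (exp (- (\<Sum>j<n. (a j / t) * Y i j \<omega>)\<^sup>2 / 2)) \<partial>M)
     \<le> ennreal (4 * ((8 * t + 1 / D) / (\<gamma> * sqrt b) + exp (- b * \<alpha>\<^sup>2)))"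
proof -
  have "moment_measure (\<nu> i) B" using moment[of i 0] iid[of i 0] i n by auto
  then interpret m: moment_measure "\<nu> i" B .
  have "(\<integral>\<^sup>+\<omega>. ennreal (exp (- (\<Sum>j<n. (a j / t) * Y i j \<omega>)\<^sup>2 / 2)) \<partial>M)
      \<le> (\<integral>\<^sup>+g. ennreal (std_normal_density g * (\<Prod>j<n. cmod (char (distr M borel (Y i j)) (a j / t * g)))) \<partial>lborel)"
    by (rule exp_moment_le[OF indep_vars_row[OF ind i]])
  also have "\<dots> = (\<integral>\<^sup>+g. ennreal (std_normal_density g * (\<Prod>j<n. cmod (char (\<nu> i) (a j / t * g)))) \<partial>lborel)"
    using i by (simp add: iid)
  also have "\<dots> \<le> ennreal (4 * ((8 * t + 1 / D) / (\<gamma> * sqrt b) + exp (- b * \<alpha>\<^sup>2)))"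
    by (rule m.small_ball_gaussian[OF lcd b])
  finally show ?thesis .
qed

text \<open>
  The net consists of vectors \<open>cc p\<close> chosen from the level set itself, one for each integer point \<open>p\<close>, so that
  the small ball bound at scale \<open>1 / D\<close> applies to the points of the net.
\<close>

lemma lcd_level:
  assumes c: "rv_constants B K p0 b \<rho> \<delta> lam \<gamma> \<mu> \<eta>" and n: "2 \<le> n" "1 / \<mu>\<^sup>2 \<le> n" and m: "card I = n - 1"
    and iid: "\<And>i j. i \<in> I \<Longrightarrow> j < n \<Longrightarrow> distr M borel (Y i j) = \<nu> i"
    and D: "lam * sqrt n \<le> D" "D \<le> exp (\<eta> * n)"
  shows "\<exists>E\<in>events. prob E \<le> 24 / lam * D * exp (- real n) \<and>
    (\<forall>\<omega>\<in>space M - E. \<forall>a. op_le I n (K * sqrt n) (\<lambda>i j. Y i j \<omega>) \<and> L2_set a {..<n} = 1 \<and>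
       (\<forall>i\<in>I. (\<Sum>j<n. a j * Y i j \<omega>) = 0) \<and> lcd_ge \<gamma> (\<mu> * sqrt n) D n a \<longrightarrow> lcd_ge \<gamma> (\<mu> * sqrt n) (2 * D) n a)"
proof -
  interpret rv_constants B K p0 b \<rho> \<delta> lam \<gamma> \<mu> \<eta> by fact
  define \<alpha> where "\<alpha> = \<mu> * sqrt n"
  have pos: "0 < lam" "0 < \<mu>" "0 < \<gamma>" "0 < b" "0 < K" "0 < sqrt n" "0 < \<alpha>"
    using lam_bounds mu_bounds gam_bounds b_bounds K n by (auto simp: \<alpha>_def)
  have D0: "0 < D" using D(1) pos by (meson mult_pos_pos less_le_trans)
  have al: "\<alpha> \<le> D" 
  proof -
    have "\<mu> * sqrt n \<le> lam * sqrt n" by (rule mult_right_mono[OF mu_bounds(2)]) simp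
    then show ?thesis using D(1) unfolding \<alpha>_def by linarith
  qed
  have al1: "1 \<le> \<alpha>"
  proof -
    have "sqrt (1 / \<mu>\<^sup>2) \<le> sqrt n" using n by simp
    then have "1 / \<mu> \<le> sqrt n" using pos by (simp add: real_sqrt_divide)
    then show ?thesis using pos by (simp add: \<alpha>_def field_simps)
  qed
  \<comment> \<open>A net point lies within 4 \<alpha> / D of a vector annihilated by all sums, so
    by the norm bound its own sums have Euclidean norm at most K \<surd>n (4 \<alpha> / D) = T. The
    scale t distributes T over the n - 1 sums.\<close>
  define T where "T = 4 * K * \<mu> * n / D"
  define t where "t = T / sqrt (real n - 1)"
  have T0: "0 < T" and t0: "0 < t" using pos D0 n by (auto simp: T_def t_def)
  \<comment> \<open>A multiple \<theta> a with \<theta> \<le> 2 D has norm at most 2 D, its nearest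
    lattice point norm at most 2 D + \<alpha> \<le> 3 D, and hence l1 norm at most 3 D
    \<surd>n.\<close>
  define P where "P = lattice_l1 n (3 * D * sqrt n)"
  define Q where "Q p a \<longleftrightarrow> L2_set a {..<n} = 1 \<and> lcd_ge \<gamma> \<alpha> D n a \<and>
     (\<exists>\<theta>. D < \<theta> \<and> \<theta> \<le> 2 * D \<and> L2_set (\<lambda>k. \<theta> * a k - real_of_int (p k)) {..<n} \<le> \<alpha>)" for p :: "nat \<Rightarrow> int" and a
  define P' where "P' = {p\<in>P. \<exists>a. Q p a}"
  define cc where "cc p = (SOME a. Q p a)" for p
  have cc: "Q p (cc p)" if "p \<in> P'" for p
  proof -
    have "\<exists>a. Q p a" using that by (simp add: P'_def)
    then show ?thesis unfolding cc_def by (rule someI_ex)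
  qed
  have fP: "finite P" unfolding P_def by (rule finite_lattice_l1)
  then have fP': "finite P'" by (simp add: P'_def)
  define F where "F p = {\<omega> \<in> space M. (\<Sum>i\<in>I. (\<Sum>j<n. (cc p j / t) * Y i j \<omega>)\<^sup>2) \<le> 1 * real (card I)}" for p
  have F[measurable]: "F p \<in> events" for p unfolding F_def by measurable
  define q where "q = 4 * ((8 * t + 1 / D) / (\<gamma> * sqrt b) + exp (- b * \<alpha>\<^sup>2))"
  have q0: "0 \<le> q" using t0 D0 pos by (simp add: q_def)
  have pF: "prob (F p) \<le> (exp (1 / 2) * q) ^ (n - 1)" if p: "p \<in> P'" for p
  proof -
    have "prob (F p) \<le> (exp (1 / 2) * q) ^ card I"
      unfolding F_def
    proof (rule tensorization[OF finI indep_vars_row_sums[OF ind], where q = q and s = 1])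
      fix i assume i: "i \<in> I"
      show "(\<integral>\<^sup>+\<omega>. ennreal (exp (- (\<Sum>j<n. (cc p j / t) * Y i j \<omega>)\<^sup>2 / 2)) \<partial>M) \<le> ennreal q"
        unfolding q_def using cc[OF p] pos D0 t0 b n i
        by (intro lcd_row_bound[OF iid]) (auto simp: Q_def)
    qed (rule q0)
    then show ?thesis by (simp add: m)
  qed
  define X where "X = K * \<alpha> / (D * \<gamma> * sqrt b)"
  have X0: "0 < X" using pos D0 by (simp add: X_def)
  \<comment> \<open>Every term of q is compared with K \<alpha> / D: the scale t by its definition,
    1 / D because K \<alpha> \<ge> 1, which is what n \<ge> 1 / \<mu>^2 is for, and exp (- b
    \<alpha>^2) because D \<le> exp (\<eta> n).\<close>
  have qX: "exp (1 / 2) * q \<le> 400 * X"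
  proof -
    have "sqrt b \<le> 1" using b_bounds by simp
    then have gs: "\<gamma> * sqrt b \<le> 1" using gam_bounds pos by (intro mult_le_one) auto
    have K1: "1 \<le> K * \<alpha>" using mult_mono[OF K al1] pos by simp
    have t6: "t \<le> 6 * (K * \<alpha> / D)"
    proof -
      have "sqrt n * 4 \<le> 6 * sqrt (real n - 1)"
      proof (rule power2_le_imp_le)
        show "(sqrt n * 4)\<^sup>2 \<le> (6 * sqrt (real n - 1))\<^sup>2" using n by (simp add: power_mult_distrib)
      qed (use n in simp)
      then have "sqrt n / sqrt (real n - 1) * 4 \<le> 6" using n by (simp add: field_simps)
      moreover have "t = sqrt n / sqrt (real n - 1) * 4 * (K * \<alpha> / D)"
      proof -
        have "T = 4 * K * \<alpha> * sqrt n / D" by (simp add: T_def \<alpha>_def mult.assoc)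
        then show ?thesis by (simp add: t_def mult_ac)
      qed
      ultimately show ?thesis using pos D0 by (simp only:) (intro mult_right_mono, auto)
    qed
    have d1: "1 / D \<le> K * \<alpha> / D" using K1 D0 by (simp add: divide_right_mono)
    have "8 * t + 1 / D \<le> 49 * (K * \<alpha> / D)" using t6 d1 by linarith
    then have 1: "(8 * t + 1 / D) / (\<gamma> * sqrt b) \<le> 49 * (K * \<alpha> / D) / (\<gamma> * sqrt b)"
      using pos by (intro divide_right_mono) auto
    have "b * \<alpha>\<^sup>2 = \<eta> * n" by (simp add: \<alpha>_def eta power_mult_distrib)
    then have "exp (- b * \<alpha>\<^sup>2) = 1 / exp (\<eta> * n)" by (simp add: exp_minus inverse_eq_divide)
    also have "\<dots> \<le> 1 / D" using D D0 by (intro divide_left_mono) auto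
    also have "\<dots> \<le> K * \<alpha> / D / 1" using d1 by simp
    also have "\<dots> \<le> K * \<alpha> / D / (\<gamma> * sqrt b)" using gs pos D0 by (intro divide_left_mono) auto
    finally have 2: "exp (- b * \<alpha>\<^sup>2) \<le> K * \<alpha> / D / (\<gamma> * sqrt b)" .
    have "q \<le> 4 * (49 * (K * \<alpha> / D) / (\<gamma> * sqrt b) + K * \<alpha> / D / (\<gamma> * sqrt b))"
      unfolding q_def by (intro mult_left_mono add_mono 1 2) auto
    also have "\<dots> = 200 * X" by (simp add: X_def field_simps)
    finally have "q \<le> 200 * X" .
    moreover have "exp (1 / 2) \<le> (2::real)"
    proof -
      have "exp (1 / 2 :: real) \<le> 1 + 1/2 + (1/2)\<^sup>2" by (rule exp_bound) auto
      then show ?thesis by (simp add: power2_eq_square)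
    qed
    ultimately have "exp (1 / 2) * q \<le> 2 * (200 * X)" using q0 by (intro mult_mono) auto
    then show ?thesis by simp
  qed
  have e3: "exp 1 \<le> (3::real)" using exp_le by simp
  define R where "R = 3 * D / sqrt n"
  have R0: "0 < R" using D0 pos by (simp add: R_def)
  have "real (card P) \<le> (exp 1 * (2 * R + 1)) ^ n"
  proof -
    have "3 * D * sqrt n = R * n" using pos by (simp add: R_def field_simps)
    then show ?thesis unfolding P_def using card_lattice_l1_large[OF R0, of n] by simp
  qed
  also have "\<dots> \<le> (8 * D / (lam * sqrt n)) ^ n"
  proof (rule power_mono)
    have "3 * lam \<le> R" using D(1) pos by (simp add: R_def field_simps)
    then have "1 \<le> R / (3 * lam)" using pos by simp
    moreover have "2 * R \<le> R / (2 * lam)" using lam_bounds R0 by (simp add: field_simps)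
    ultimately have "2 * R + 1 \<le> R / (2 * lam) + R / (3 * lam)" by linarith
    also have "\<dots> = 5 / 6 * R / lam" using pos by (simp add: field_simps)
    finally have "exp 1 * (2 * R + 1) \<le> 3 * (5 / 6 * R / lam)" using e3 R0 by (intro mult_mono) auto
    also have "\<dots> = 15 / 2 * D / (lam * sqrt n)" by (simp add: R_def)
    also have "\<dots> \<le> 8 * D / (lam * sqrt n)" using D0 pos by (intro divide_right_mono) auto
    finally show "exp 1 * (2 * R + 1) \<le> 8 * D / (lam * sqrt n)" .
  qed (use R0 in simp)
  finally have cP: "real (card P) \<le> (8 * D / (lam * sqrt n)) ^ n" .
  have pn: "x ^ n = x * x ^ (n - 1)" for x :: real using n by (cases n) auto
  let ?E = "\<Union>p\<in>P'. F p"
  have "prob ?E \<le> (\<Sum>p\<in>P'. prob (F p))" by (rule finite_measure_subadditive_finite[OF fP']) auto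
  also have "\<dots> \<le> (\<Sum>p\<in>P'. (exp (1 / 2) * q) ^ (n - 1))" by (intro sum_mono pF)
  also have "\<dots> \<le> real (card P) * (400 * X) ^ (n - 1)"
  proof -
    have "card P' \<le> card P" using fP by (intro card_mono) (auto simp: P'_def)
    have "(\<Sum>p\<in>P'. (exp (1 / 2) * q) ^ (n - 1)) = real (card P') * (exp (1 / 2) * q) ^ (n - 1)" by simp
    also have "\<dots> \<le> real (card P) * (400 * X) ^ (n - 1)"
    proof (rule mult_mono)
      show "(exp (1 / 2) * q) ^ (n - 1) \<le> (400 * X) ^ (n - 1)" by (rule power_mono[OF qX]) (use q0 in simp)
    qed (use q0 \<open>card P' \<le> card P\<close> in auto)
    finally show ?thesis .
  qed
  also have "\<dots> \<le> (8 * D / (lam * sqrt n)) ^ n * (400 * X) ^ (n - 1)"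
    using cP X0 by (intro mult_right_mono) auto
  \<comment> \<open>The net has n coordinates but there are only n - 1 sums, so one factor of the
    count stays unpaired; it is the D in the final bound. In the paired factors D cancels, and \<mu>
    was chosen to make them at most 1 / 3.\<close>
  also have "\<dots> = 8 * D / (lam * sqrt n) * (8 * D / (lam * sqrt n) * (400 * X)) ^ (n - 1)"
    by (simp only: pn[of "8 * D / (lam * sqrt n)"] power_mult_distrib mult.assoc)
  also have "\<dots> \<le> 8 * D / (lam * sqrt n) * (1 / 3) ^ (n - 1)"
  proof (intro mult_left_mono power_mono)
    have "8 * D / (lam * sqrt n) * (400 * X) = 3200 * K * \<mu> / (lam * \<gamma> * sqrt b)"
      using pos D0 by (simp add: X_def \<alpha>_def field_simps)
    also have "\<dots> = 1 / 3 * (b / sqrt b)" using pos by (simp add: mu)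
    also have "\<dots> \<le> 1 / 3 * 1" using b_bounds pos by (intro mult_left_mono) auto
    finally show "8 * D / (lam * sqrt n) * (400 * X) \<le> 1 / 3" by simp
  qed (use X0 D0 pos in auto)
  also have "\<dots> = 24 * D / (lam * sqrt n) * (1 / 3) ^ n" by (simp add: pn[of "1 / 3"])
  also have "\<dots> \<le> 24 / lam * D * exp (- real n)"
  proof (intro mult_mono)
    have "24 * D / (lam * sqrt n) \<le> 24 * D / (lam * 1)" using pos D0 n by (intro divide_left_mono mult_left_mono) auto
    then show "24 * D / (lam * sqrt n) \<le> 24 / lam * D" by simp
    have "1 / 3 \<le> exp (- 1 :: real)" using e3 by (simp add: exp_minus field_simps)
    then have "(1 / 3) ^ n \<le> exp (- 1 :: real) ^ n" by (intro power_mono) auto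
    then show "(1 / 3) ^ n \<le> exp (- real n)" by (simp flip: exp_of_nat_mult)
  qed (use D0 pos in auto)
  finally have pE: "prob ?E \<le> 24 / lam * D * exp (- real n)" .
  moreover have "lcd_ge \<gamma> \<alpha> (2 * D) n a"
    if \<omega>: "\<omega> \<in> space M - ?E" and op: "op_le I n (K * sqrt n) (\<lambda>i j. Y i j \<omega>)" and a: "L2_set a {..<n} = 1"
      and zero: "\<forall>i\<in>I. (\<Sum>j<n. a j * Y i j \<omega>) = 0" and lcd: "lcd_ge \<gamma> \<alpha> D n a" for \<omega> a
  proof (rule ccontr)
    assume "\<not> lcd_ge \<gamma> \<alpha> (2 * D) n a"
    then obtain \<theta> where th: "0 \<le> \<theta>" "\<theta> \<le> 2 * D" "lattice_dist n (\<lambda>k. \<theta> * a k) < min (\<gamma> * \<theta>) \<alpha>"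
      unfolding lcd_ge_def by (auto simp: not_le)
    then have th2: "D < \<theta>" using lcd unfolding lcd_ge_def by (meson not_le)
    define p where "p k = (if k < n then round (\<theta> * a k) else undefined)" for k
    have ld: "L2_set (\<lambda>k. \<theta> * a k - real_of_int (p k)) {..<n} \<le> \<alpha>"
      using th(3) by (simp add: lattice_dist_def p_def cong: L2_set_cong_simp)
    have nth: "L2_set (\<lambda>k. \<theta> * a k) {..<n} = \<theta>" using a th by (simp add: L2_set_scale)
    have "L2_set (\<lambda>k. real_of_int (p k)) {..<n} \<le> \<theta> + \<alpha>"
    proof -
      have "L2_set (\<lambda>k. real_of_int (p k)) {..<n} = L2_set (\<lambda>k. \<theta> * a k + (- 1) * (\<theta> * a k - real_of_int (p k))) {..<n}"
        by (intro L2_set_cong) auto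
      also have "\<dots> \<le> L2_set (\<lambda>k. \<theta> * a k) {..<n} + L2_set (\<lambda>k. (- 1) * (\<theta> * a k - real_of_int (p k))) {..<n}"
        by (rule L2_set_triangle_ineq)
      also have "L2_set (\<lambda>k. (- 1) * (\<theta> * a k - real_of_int (p k))) {..<n} \<le> \<alpha>"
        unfolding L2_set_scale using ld by simp
      finally show ?thesis using nth by simp
    qed
    then have "sqrt n * L2_set (\<lambda>k. real_of_int (p k)) {..<n} \<le> sqrt n * (3 * D)"
      using th al by (intro mult_left_mono) auto
    moreover have "(\<Sum>k<n. \<bar>real_of_int (p k)\<bar>) \<le> sqrt n * L2_set (\<lambda>k. real_of_int (p k)) {..<n}"
      using sum_abs_le_L2_set[of "{..<n}" "{..<n}" "\<lambda>k. real_of_int (p k)"] by simp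
    ultimately have "(\<Sum>k<n. \<bar>real_of_int (p k)\<bar>) \<le> 3 * D * sqrt n" by (simp only: mult_ac)
    then have pP: "p \<in> P'"
      using a lcd th th2 ld by (auto simp: P'_def P_def lattice_l1_def PiE_iff extensional_def p_def[abs_def] Q_def)
    then obtain \<theta>' where c': "L2_set (cc p) {..<n} = 1" "D < \<theta>'" "\<theta>' \<le> 2 * D"
        "L2_set (\<lambda>k. \<theta>' * cc p k - real_of_int (p k)) {..<n} \<le> \<alpha>"
      using cc[OF pP] by (auto simp: Q_def)
    have nth': "L2_set (\<lambda>k. \<theta>' * cc p k) {..<n} = \<theta>'" using c' D0 by (simp add: L2_set_scale)
    have tri: "L2_set (\<lambda>k. f k - g k) {..<n} \<le> L2_set (\<lambda>k. f k - h k) {..<n} + L2_set (\<lambda>k. g k - h k) {..<n}" for f g h :: "nat \<Rightarrow> real"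
    proof -
      have "L2_set (\<lambda>k. f k - g k) {..<n} = L2_set (\<lambda>k. (f k - h k) + (- 1) * (g k - h k)) {..<n}"
        by (intro L2_set_cong) auto
      also have "\<dots> \<le> L2_set (\<lambda>k. f k - h k) {..<n} + L2_set (\<lambda>k. (- 1) * (g k - h k)) {..<n}"
        by (rule L2_set_triangle_ineq)
      finally show ?thesis unfolding L2_set_scale by simp
    qed
    \<comment> \<open>Both vectors are unit, so multiples that are 2 \<alpha> apart have multipliers
      at most 2 \<alpha> apart; dividing by \<theta>' > D then gives the distance 4 \<alpha> /
      D.\<close>
    have d2: "L2_set (\<lambda>k. \<theta>' * cc p k - \<theta> * a k) {..<n} \<le> 2 * \<alpha>"
      using tri[of "\<lambda>k. \<theta>' * cc p k" "\<lambda>k. \<theta> * a k" "\<lambda>k. real_of_int (p k)"] ld c'(4) by linarith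
    have "\<bar>\<theta>' - \<theta>\<bar> \<le> 2 * \<alpha>"
    proof -
      have "\<theta>' \<le> 2 * \<alpha> + \<theta>"
        using tri[of "\<lambda>k. \<theta>' * cc p k" "\<lambda>k. 0" "\<lambda>k. \<theta> * a k"] nth nth' d2
          L2_set_scale[of "-1" "\<lambda>k. \<theta> * a k" "{..<n}"] by simp
      moreover have "\<theta> \<le> \<theta>' + 2 * \<alpha>"
        using tri[of "\<lambda>k. \<theta> * a k" "\<lambda>k. 0" "\<lambda>k. \<theta>' * cc p k"] nth nth' d2
          L2_set_scale[of "-1" "\<lambda>k. \<theta>' * cc p k" "{..<n}"]
          L2_set_scale[of "-1" "\<lambda>k. \<theta>' * cc p k - \<theta> * a k" "{..<n}"] by simp
      ultimately show ?thesis by linarith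
    qed
    moreover have "\<theta>' * L2_set (\<lambda>k. cc p k - a k) {..<n} \<le> 2 * \<alpha> + \<bar>\<theta>' - \<theta>\<bar>"
    proof -
      have "\<theta>' * L2_set (\<lambda>k. cc p k - a k) {..<n} = L2_set (\<lambda>k. \<theta>' * (cc p k - a k)) {..<n}"
        using c' D0 by (simp add: L2_set_scale)
      also have "\<dots> = L2_set (\<lambda>k. (\<theta>' * cc p k - \<theta> * a k) + (\<theta> - \<theta>') * a k) {..<n}"
        by (intro L2_set_cong) (auto simp: algebra_simps)
      also have "\<dots> \<le> L2_set (\<lambda>k. \<theta>' * cc p k - \<theta> * a k) {..<n} + L2_set (\<lambda>k. (\<theta> - \<theta>') * a k) {..<n}"
        by (rule L2_set_triangle_ineq)
      finally show ?thesis using d2 a by (simp add: L2_set_scale abs_minus_commute)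
    qed
    ultimately have "\<theta>' * L2_set (\<lambda>k. cc p k - a k) {..<n} \<le> 4 * \<alpha>" by linarith
    moreover have "D * L2_set (\<lambda>k. cc p k - a k) {..<n} \<le> \<theta>' * L2_set (\<lambda>k. cc p k - a k) {..<n}"
      using c' by (intro mult_right_mono) auto
    ultimately have d4: "L2_set (\<lambda>k. cc p k - a k) {..<n} \<le> 4 * \<alpha> / D" using D0 by (simp add: field_simps)
    have "L2_set (\<lambda>i. \<Sum>j<n. a j * Y i j \<omega>) I = 0" using zero by (simp add: L2_set_def)
    then have "L2_set (\<lambda>i. \<Sum>j<n. cc p j * Y i j \<omega>) I \<le> L2_set (\<lambda>i. \<Sum>j<n. (cc p j - a j) * Y i j \<omega>) I"
      using L2_set_row_sums_triangle[where x = "cc p" and x' = a and y = "\<lambda>i j. Y i j \<omega>" and I = I and n = n] by simp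
    also have "\<dots> \<le> K * sqrt n * L2_set (\<lambda>k. cc p k - a k) {..<n}"
      by (rule op[unfolded op_le_def, rule_format])
    also have "\<dots> \<le> K * sqrt n * (4 * \<alpha> / D)" using d4 pos by (intro mult_left_mono) auto
    also have "\<dots> = T" by (simp add: T_def \<alpha>_def)
    finally have le: "L2_set (\<lambda>i. \<Sum>j<n. cc p j * Y i j \<omega>) I \<le> T" .
    have "L2_set (\<lambda>i. \<Sum>j<n. (1 / t * cc p j) * Y i j \<omega>) I \<le> 1 / t * T"
      unfolding L2_set_scaled_row_sums using le t0 by (simp add: divide_right_mono)
    also have "1 / t * T = sqrt (real n - 1)" using T0 n by (simp add: t_def)
    finally have "(\<Sum>i\<in>I. (\<Sum>j<n. (1 / t * cc p j) * Y i j \<omega>)\<^sup>2) \<le> (sqrt (real n - 1))\<^sup>2"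
      using n by (subst (asm) L2_set_le_iff) auto
    then have "\<omega> \<in> F p" using \<omega> m n by (simp add: F_def of_nat_diff)
    then show False using \<omega> pP by auto
  qed
  ultimately show ?thesis unfolding \<alpha>_def[symmetric]
    by (intro bexI[of _ ?E]) (auto intro!: sets.finite_UN fP')
qed

end

context random_entries
begin

text \<open>\<open>compressible\<close> and \<open>lcd_spread\<close> start the denominators at
  \<open>lam\<close> \<surd>n, and each level doubles them until exp (\<eta> n) is passed. There are
  at most n levels, each failing with probability at most (24 / lam) exp (n / 4) exp (- n), and
  these add up to at most exp (- n / 2).\<close>

lemma normal_lcd:
  assumes c: "rv_constants B K p0 b \<rho> \<delta> lam \<gamma> \<mu> \<eta>" and n: "768 / lam \<le> n" "1 / \<mu>\<^sup>2 \<le> n" and m: "card I = n - 1"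
    and iid: "\<And>i j. i \<in> I \<Longrightarrow> j < n \<Longrightarrow> distr M borel (Y i j) = \<nu> i"
  shows "\<exists>E\<in>events. prob E \<le> exp (- p0 / 8 * n) + exp (- real n / 2) \<and>
    (\<forall>\<omega>\<in>space M - E. \<forall>a. op_le I n (K * sqrt n) (\<lambda>i j. Y i j \<omega>) \<and> L2_set a {..<n} = 1 \<and>
       (\<forall>i\<in>I. (\<Sum>j<n. a j * Y i j \<omega>) = 0) \<longrightarrow> lcd_ge \<gamma> (\<mu> * sqrt n) (exp (\<eta> * n)) n a)"
proof -
  interpret rv_constants B K p0 b \<rho> \<delta> lam \<gamma> \<mu> \<eta> by fact
  have "768 * 4 \<le> 768 / lam" using lam_bounds by (simp add: field_simps)
  then have n': "3072 \<le> real n" using n by linarith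
  then have n2: "2 \<le> n" by linarith
  then have n1: "1 \<le> n" and m2: "n \<le> 2 * card I" using m by auto
  define s where "s = lam * sqrt n"
  have s1: "1 \<le> s"
  proof -
    have "sqrt (1 / \<mu>\<^sup>2) \<le> sqrt n" using n by simp
    then have "1 / \<mu> \<le> sqrt n" using mu_bounds by (simp add: real_sqrt_divide)
    then have "1 \<le> \<mu> * sqrt n" using mu_bounds by (simp add: field_simps)
    also have "\<dots> \<le> s" unfolding s_def by (rule mult_right_mono[OF mu_bounds(2)]) simp
    finally show ?thesis .
  qed
  define X where "X = exp (\<eta> * n)"
  have Xle: "X \<le> exp (real n / 4)" using eta_bounds mult_right_mono[OF eta_bounds(2), of "real n"] by (simp add: X_def)
  \<comment> \<open>The levels still below the target. The least index outside L is already beyond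
    it, and L has at most n elements since exp (1 / 4) < 2 and s \<ge> 1.\<close>
  define L where "L = {i. 2 ^ i * s \<le> X}"
  have L: "L \<subseteq> {..<n}"
  proof
    fix i assume "i \<in> L"
    then have "2 ^ i * s \<le> X" by (simp add: L_def)
    moreover have "2 ^ i * 1 \<le> 2 ^ i * s" using s1 by (intro mult_left_mono) auto
    ultimately have "2 ^ i * 1 \<le> X" by linarith
    also have "\<dots> \<le> exp (1 / 4) ^ n" using Xle by (simp flip: exp_of_nat_mult)
    also have "\<dots> < 2 ^ n"
    proof (rule power_strict_mono)
      have "exp (1 / 4 :: real) \<le> 1 + 1/4 + (1/4)\<^sup>2" by (rule exp_bound) auto
      then show "exp (1 / 4 :: real) < 2" by (simp add: power2_eq_square)
    qed (use n2 in auto)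
    finally have "(2::real) ^ i < 2 ^ n" by simp
    then show "i \<in> {..<n}" by simp
  qed
  then have fL: "finite L" by (rule finite_subset) simp
  obtain E0 where E0: "E0 \<in> events" "prob E0 \<le> exp (- p0 / 8 * n)"
    "\<And>\<omega> x. \<omega> \<in> space M - E0 \<Longrightarrow> op_le I n (K * sqrt n) (\<lambda>i j. Y i j \<omega>) \<Longrightarrow> L2_set x {..<n} = 1 \<Longrightarrow>
       L2_set (\<lambda>i. \<Sum>j<n. x j * Y i j \<omega>) I \<le> \<rho> * K * sqrt n \<Longrightarrow> spread \<rho> \<delta> n x"
    using compressible[OF c n1 m2] by blast
  define step where "step D E \<longleftrightarrow> (\<forall>\<omega>\<in>space M - E. \<forall>a. op_le I n (K * sqrt n) (\<lambda>i j. Y i j \<omega>) \<and> L2_set a {..<n} = 1 \<and>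
       (\<forall>i\<in>I. (\<Sum>j<n. a j * Y i j \<omega>) = 0) \<and> lcd_ge \<gamma> (\<mu> * sqrt n) D n a \<longrightarrow> lcd_ge \<gamma> (\<mu> * sqrt n) (2 * D) n a)" for D E
  have "\<exists>E. \<forall>i\<in>L. E i \<in> events \<and> prob (E i) \<le> 24 / lam * (2 ^ i * s) * exp (- real n) \<and> step (2 ^ i * s) (E i)"
  proof (rule bchoice, rule ballI)
    fix i assume i: "i \<in> L"
    have "1 * s \<le> 2 ^ i * s" using s1 by (intro mult_right_mono) auto
    then have D: "lam * sqrt n \<le> 2 ^ i * s" "2 ^ i * s \<le> exp (\<eta> * n)" using i by (auto simp: s_def L_def X_def)
    show "\<exists>E. E \<in> events \<and> prob E \<le> 24 / lam * (2 ^ i * s) * exp (- real n) \<and> step (2 ^ i * s) E"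
      using lcd_level[OF c n2 n(2) m iid D] unfolding step_def Bex_def by simp
  qed
  then obtain E where E: "\<And>i. i \<in> L \<Longrightarrow> E i \<in> events" "\<And>i. i \<in> L \<Longrightarrow> prob (E i) \<le> 24 / lam * (2 ^ i * s) * exp (- real n)"
    and E_step: "\<And>i. i \<in> L \<Longrightarrow> step (2 ^ i * s) (E i)" by auto
  have E3: "lcd_ge \<gamma> (\<mu> * sqrt n) (2 * (2 ^ i * s)) n a"
    if "i \<in> L" "\<omega> \<in> space M - E i" "op_le I n (K * sqrt n) (\<lambda>i j. Y i j \<omega>)" "L2_set a {..<n} = 1"
       "\<forall>i\<in>I. (\<Sum>j<n. a j * Y i j \<omega>) = 0" "lcd_ge \<gamma> (\<mu> * sqrt n) (2 ^ i * s) n a" for i \<omega> a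
    using E_step[OF that(1)] that(2-6) unfolding step_def by simp
  let ?F = "E0 \<union> (\<Union>i\<in>L. E i)"
  have FE: "(\<Union>i\<in>L. E i) \<in> events" using E fL by (intro sets.finite_UN) auto
  have "prob (\<Union>i\<in>L. E i) \<le> (\<Sum>i\<in>L. prob (E i))" by (rule finite_measure_subadditive_finite[OF fL]) (use E in auto)
  also have "\<dots> \<le> (\<Sum>i\<in>L. 24 / lam * exp (real n / 4) * exp (- real n))"
  proof (rule sum_mono)
    fix i assume i: "i \<in> L"
    have "2 ^ i * s \<le> exp (real n / 4)" using i Xle by (simp add: L_def)
    then have "24 / lam * (2 ^ i * s) * exp (- real n) \<le> 24 / lam * exp (real n / 4) * exp (- real n)"
      using lam_bounds by (intro mult_right_mono mult_left_mono) auto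
    then show "prob (E i) \<le> 24 / lam * exp (real n / 4) * exp (- real n)" using E(2)[OF i] by linarith
  qed
  also have "\<dots> = real (card L) * (24 / lam * exp (real n / 4) * exp (- real n))" by simp
  also have "\<dots> \<le> real n * (24 / lam * exp (real n / 4) * exp (- real n))"
    using card_mono[OF _ L] lam_bounds by (intro mult_right_mono) auto
  also have "\<dots> = (24 * real n / lam) * (exp (real n / 4) * exp (- real n))"
    by (simp add: mult_ac)
  also have "exp (real n / 4) * exp (- real n) = exp (real n / 4 - real n)"
    by (simp flip: exp_add)
  also have "24 * real n / lam * exp (real n / 4 - real n) \<le> exp (real n / 4) * exp (real n / 4 - real n)"
  proof (rule mult_right_mono)
    \<comment> \<open>n^2 / 32 is half the square of n / 4, the quadratic Taylor term of exp (n /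
      4); together with the coefficient 24 this explains the requirement n \<ge> 768 / lam.\<close>
    have "24 * real n / lam = real n / 32 * (768 / lam)" by simp
    also have "\<dots> \<le> real n / 32 * real n" using n by (intro mult_left_mono) auto
    also have "\<dots> = (real n / 4)\<^sup>2 / 2" by (simp add: power2_eq_square)
    also have "\<dots> \<le> exp (real n / 4)" using exp_lower_Taylor_quadratic[of "real n / 4"] by simp
    finally show "24 * real n / lam \<le> exp (real n / 4)" .
  qed simp
  also have "\<dots> = exp (- real n / 2)" by (simp flip: exp_add)
  finally have "prob (\<Union>i\<in>L. E i) \<le> exp (- real n / 2)" .
  then have "prob ?F \<le> exp (- p0 / 8 * n) + exp (- real n / 2)"
    using measure_Un_le[OF E0(1) FE] E0(2) by linarith
  moreover have "lcd_ge \<gamma> (\<mu> * sqrt n) X n a"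
    if \<omega>: "\<omega> \<in> space M - ?F" and op: "op_le I n (K * sqrt n) (\<lambda>i j. Y i j \<omega>)" and a: "L2_set a {..<n} = 1"
      and zero: "\<forall>i\<in>I. (\<Sum>j<n. a j * Y i j \<omega>) = 0" for \<omega> a
  proof -
    have sp: "spread \<rho> \<delta> n a"
      by (rule E0(3)[OF _ op a]) (use \<omega> zero rho_bounds K in \<open>auto simp: L2_set_def\<close>)
    have base: "lcd_ge \<gamma> (\<mu> * sqrt n) s n a"
      unfolding gam s_def lam
      by (rule lcd_spread[OF a sp]) (use delta_bounds rho_bounds p0_bounds n2 in auto)
    have chain: "lcd_ge \<gamma> (\<mu> * sqrt n) (2 ^ i * s) n a" if "\<And>i'. i' < i \<Longrightarrow> i' \<in> L" for i
      using that
    proof (induction i)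
      case 0 then show ?case using base by simp
    next
      case (Suc i)
      have "lcd_ge \<gamma> (\<mu> * sqrt n) (2 * (2 ^ i * s)) n a"
        by (rule E3[of i]) (use Suc \<omega> op a zero in auto)
      then show ?case by (simp add: mult.assoc)
    qed
    have "\<exists>i. i \<notin> L" by (rule ex_new_if_finite[OF infinite_UNIV_nat fL])
    then obtain i where i: "i \<notin> L" "\<And>i'. i' < i \<Longrightarrow> i' \<in> L" using exists_least_iff[of "\<lambda>i. i \<notin> L"] by auto
    have "lcd_ge \<gamma> (\<mu> * sqrt n) (2 ^ i * s) n a" by (rule chain) (rule i)
    then show ?thesis by (rule lcd_ge_mono) (use i in \<open>simp add: L_def\<close>)
  qed
  ultimately show ?thesis unfolding X_def[symmetric] using E0 FE
    by (intro bexI[of _ ?F]) auto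
qed

end

section \<open>Normal vectors, countable approximation and conditioning\<close>

lemma unit_vector_orthogonal:
  fixes v :: "nat \<Rightarrow> nat \<Rightarrow> real"
  assumes k: "k < n"
  shows "\<exists>a. L2_set a {..<n} = 1 \<and> (\<forall>j\<in>{..<n} - {k}. (\<Sum>i<n. a i * v j i) = 0)"
proof -
  \<comment> \<open>The n - 1 given vectors become the rows other than k; the zero row k forces a
    nontrivial kernel.\<close>
  define A where "A = mat\<^sub>r n n (\<lambda>r. if r = k then 0\<^sub>v n else vec n (v r))"
  have A: "A \<in> carrier_mat n n" by (simp add: A_def)
  have "Determinant.det A = 0" unfolding A_def by (rule det_row_0[OF k]) simp
  then obtain u where u: "u \<in> carrier_vec n" "u \<noteq> 0\<^sub>v n" "A *\<^sub>v u = 0\<^sub>v n"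
    using det_0_iff_vec_prod_zero_field[OF A] by auto
  define c where "c = L2_set (\<lambda>i. u $ i) {..<n}"
  have c: "c \<noteq> 0"
  proof
    assume "c = 0"
    then have "\<forall>i\<in>{..<n}. u $ i = 0" by (simp add: c_def L2_set_eq_0_iff)
    then have "u = 0\<^sub>v n" using u(1) by (intro eq_vecI) auto
    then show False using u by simp
  qed
  have c0: "c > 0" 
  proof -
    have "0 \<le> c" unfolding c_def by (rule L2_set_nonneg)
    then show ?thesis using c by linarith
  qed
  have z: "(\<Sum>i<n. u $ i * v j i) = 0" if j: "j \<in> {..<n} - {k}" for j
  proof -
    have "(A *\<^sub>v u) $ j = (\<Sum>i<n. v j i * u $ i)"
      using j u(1) A by (simp add: A_def scalar_prod_def lessThan_atLeast0)
    then show ?thesis using u(3) j by (simp add: mult.commute)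
  qed
  show ?thesis
  proof (intro exI[of _ "\<lambda>i. (1 / c) * u $ i"] conjI ballI)
    show "L2_set (\<lambda>i. (1 / c) * u $ i) {..<n} = 1"
      unfolding L2_set_scale c_def[symmetric] using c0 by simp
    fix j assume j: "j \<in> {..<n} - {k}"
    have "(\<Sum>i<n. (1 / c) * u $ i * v j i) = (1 / c) * (\<Sum>i<n. u $ i * v j i)"
      by (simp add: sum_distrib_left mult.assoc)
    then show "(\<Sum>i<n. (1 / c) * u $ i * v j i) = 0" by (simp add: z[OF j])
  qed
qed

lemma L2_set_sum_le:
  assumes "finite J"
  shows "L2_set (\<lambda>i. \<Sum>j\<in>J. c j * y j i) I \<le> (\<Sum>j\<in>J. \<bar>c j\<bar> * L2_set (y j) I)"
  using assms
proof (induction J rule: finite_induct)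
  case (insert j J)
  have "L2_set (\<lambda>i. c j * y j i + (\<Sum>j\<in>J. c j * y j i)) I
      \<le> L2_set (\<lambda>i. c j * y j i) I + L2_set (\<lambda>i. \<Sum>j\<in>J. c j * y j i) I"
    by (rule L2_set_triangle_ineq)
  then show ?case using insert by (simp add: L2_set_scale)
qed (simp add: L2_set_def)

text \<open>It turns existential statements over real vectors into countable unions, which keeps the
  distance events and the norm event measurable. The strict inequality leaves room for the
  approximation.\<close>

lemma rational_approximation:
  fixes G :: "(nat \<Rightarrow> real) \<Rightarrow> real"
  assumes J: "finite J" and lip: "\<And>q. G q \<le> G x + C * (\<Sum>j\<in>J. \<bar>x j - q j\<bar>)" and lt: "G x < c"
  shows "\<exists>q\<in>J \<rightarrow>\<^sub>E \<rat>. G q < c"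
proof -
  define C' where "C' = \<bar>C\<bar> + 1"
  define e where "e = (c - G x) / (C' * (real (card J) + 1))"
  have C': "0 < C'" "C \<le> C'" by (auto simp: C'_def)
  have e: "0 < e" using lt C' by (simp add: e_def)
  have "\<exists>r\<in>\<rat>. \<bar>x j - r\<bar> < e" for j
  proof -
    obtain r where "r \<in> \<rat>" "x j < r" "r < x j + e" using Rats_dense_in_real[of "x j" "x j + e"] e by auto
    moreover from this have "\<bar>x j - r\<bar> < e" by linarith
    ultimately show ?thesis by blast
  qed
  then obtain r where r: "\<And>j. r j \<in> \<rat>" "\<And>j. \<bar>x j - r j\<bar> < e" by metis
  define q where "q j = (if j \<in> J then r j else undefined)" for j
  have "(\<Sum>j\<in>J. \<bar>x j - q j\<bar>) \<le> (\<Sum>j\<in>J. e)"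
    by (intro sum_mono) (use r(2) in \<open>auto simp: q_def less_imp_le\<close>)
  then have "(\<Sum>j\<in>J. \<bar>x j - q j\<bar>) \<le> real (card J) * e" by simp
  then have "C' * (\<Sum>j\<in>J. \<bar>x j - q j\<bar>) \<le> C' * (real (card J) * e)" using C' by (intro mult_left_mono) auto
  also have "\<dots> < C' * (real (card J) + 1) * e" using C' e by (simp add: algebra_simps)
  also have "\<dots> = c - G x" using C' by (simp add: e_def)
  finally have "C' * (\<Sum>j\<in>J. \<bar>x j - q j\<bar>) < c - G x" .
  moreover have "C * (\<Sum>j\<in>J. \<bar>x j - q j\<bar>) \<le> C' * (\<Sum>j\<in>J. \<bar>x j - q j\<bar>)"
    using C' by (intro mult_right_mono sum_nonneg) auto
  ultimately have "G q < c" using lip[of q] by linarith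
  moreover have "q \<in> J \<rightarrow>\<^sub>E \<rat>" using r by (auto simp: q_def PiE_iff extensional_def)
  ultimately show ?thesis by blast
qed

lemma countable_rational_vectors: "finite J \<Longrightarrow> countable (J \<rightarrow>\<^sub>E (\<rat> :: real set))"
  by (intro countable_PiE countable_rat)

text \<open>By independence the law of X is the same given any value v of R, so on G the conditional
  probability is at most \<beta> by definition, and Fubini integrates this over v. G is measurable
  because the section measures are measurable in v, however its points are recognised later.\<close>

lemma (in prob_space) indep_section_bound:
  assumes ind: "indep_var S X T R" and E: "E \<in> sets (S \<Otimes>\<^sub>M T)"
    and G: "G = {v \<in> space T. emeasure (distr M S X) ((\<lambda>u. (u, v)) -` E) \<le> ennreal \<beta>}" and \<beta>: "0 \<le> \<beta>"
  shows "{\<omega>\<in>space M. (X \<omega>, R \<omega>) \<in> E \<and> R \<omega> \<in> G} \<in> events"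
    and "prob {\<omega>\<in>space M. (X \<omega>, R \<omega>) \<in> E \<and> R \<omega> \<in> G} \<le> \<beta>"
proof -
  have X[measurable]: "random_variable S X" and R[measurable]: "random_variable T R"
    and prod: "distr M S X \<Otimes>\<^sub>M distr M T R = distr M (S \<Otimes>\<^sub>M T) (\<lambda>\<omega>. (X \<omega>, R \<omega>))"
    using ind unfolding indep_var_distribution_eq by auto
  interpret DX: prob_space "distr M S X" by (rule prob_space_distr) simp
  interpret DR: prob_space "distr M T R" by (rule prob_space_distr) simp
  interpret PP: pair_sigma_finite "distr M S X" "distr M T R" ..
  have E': "E \<in> sets (distr M S X \<Otimes>\<^sub>M distr M T R)"
    using E by (simp cong: sets_pair_measure_cong)
  have "(\<lambda>v. emeasure (distr M S X) ((\<lambda>u. (u, v)) -` E)) \<in> borel_measurable (distr M T R)"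
    by (rule PP.measurable_emeasure_Pair2[OF E'])
  then have m: "(\<lambda>v. emeasure (distr M S X) ((\<lambda>u. (u, v)) -` E)) \<in> borel_measurable T" by simp
  have Gm[measurable]: "G \<in> sets T" unfolding G using m by measurable
  define E2 where "E2 = {z \<in> space (S \<Otimes>\<^sub>M T). z \<in> E \<and> snd z \<in> G}"
  have E2[measurable]: "E2 \<in> sets (S \<Otimes>\<^sub>M T)" unfolding E2_def using E by measurable
  then have E2': "E2 \<in> sets (distr M S X \<Otimes>\<^sub>M distr M T R)" by (simp cong: sets_pair_measure_cong)
  have eq: "{\<omega>\<in>space M. (X \<omega>, R \<omega>) \<in> E \<and> R \<omega> \<in> G} = (\<lambda>\<omega>. (X \<omega>, R \<omega>)) -` E2 \<inter> space M"
    using measurable_space[OF X] measurable_space[OF R] by (auto simp: E2_def space_pair_measure)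
  show "{\<omega>\<in>space M. (X \<omega>, R \<omega>) \<in> E \<and> R \<omega> \<in> G} \<in> events"
    unfolding eq by measurable
  have "emeasure M {\<omega>\<in>space M. (X \<omega>, R \<omega>) \<in> E \<and> R \<omega> \<in> G} = emeasure (distr M S X \<Otimes>\<^sub>M distr M T R) E2"
    unfolding prod eq by (subst emeasure_distr) auto
  also have "\<dots> = (\<integral>\<^sup>+v. emeasure (distr M S X) ((\<lambda>u. (u, v)) -` E2) \<partial>distr M T R)"
    by (rule PP.emeasure_pair_measure_alt2[OF E2'])
  also have "\<dots> \<le> (\<integral>\<^sup>+v. ennreal \<beta> \<partial>distr M T R)"
  proof (rule nn_integral_mono)
    fix v assume v: "v \<in> space (distr M T R)"
    show "emeasure (distr M S X) ((\<lambda>u. (u, v)) -` E2) \<le> ennreal \<beta>"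
    proof (cases "v \<in> G")
      case True
      have "emeasure (distr M S X) ((\<lambda>u. (u, v)) -` E2) \<le> emeasure (distr M S X) ((\<lambda>u. (u, v)) -` E)"
        using sets_Pair2[OF E'] by (intro emeasure_mono) (auto simp: E2_def)
      also have "\<dots> \<le> ennreal \<beta>" using True by (simp add: G)
      finally show ?thesis .
    next
      case False
      then have "(\<lambda>u. (u, v)) -` E2 = {}" by (auto simp: E2_def)
      then show ?thesis by simp
    qed
  qed
  also have "\<dots> = ennreal \<beta>" using DR.emeasure_space_1 by simp
  finally show "prob {\<omega>\<in>space M. (X \<omega>, R \<omega>) \<in> E \<and> R \<omega> \<in> G} \<le> \<beta>"
    using \<beta> by (simp add: emeasure_eq_measure)
qed

section \<open>Distance of a column to the span of the others\<close>

text \<open>Duality: with z the transposed image of x, |z|^2 = <x, Y z> \<le> |x| \<kappa>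
  |z|.\<close>

lemma op_le_transpose:
  assumes op: "op_le {..<n} n \<kappa> y" and k: "0 \<le> \<kappa>"
  shows "op_le {..<n} n \<kappa> (\<lambda>i j. y j i)"
  unfolding op_le_def
proof
  fix x
  define z where "z i = (\<Sum>j<n. x j * y j i)" for i
  have "(L2_set z {..<n})\<^sup>2 = (\<Sum>i<n. z i * (\<Sum>j<n. x j * y j i))"
    by (simp add: L2_set_def sum_nonneg z_def power2_eq_square)
  also have "\<dots> = (\<Sum>j<n. x j * (\<Sum>i<n. z i * y j i))"
    unfolding sum_distrib_left by (subst sum.swap) (simp add: mult_ac)
  also have "\<dots> \<le> (\<Sum>j<n. \<bar>x j\<bar> * \<bar>\<Sum>i<n. z i * y j i\<bar>)"
    by (intro sum_mono) (simp flip: abs_mult)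
  also have "\<dots> \<le> L2_set x {..<n} * L2_set (\<lambda>j. \<Sum>i<n. z i * y j i) {..<n}" by (rule L2_set_mult_ineq)
  also have "\<dots> \<le> L2_set x {..<n} * (\<kappa> * L2_set z {..<n})"
    using op unfolding op_le_def by (intro mult_left_mono) auto
  finally have "L2_set z {..<n} * L2_set z {..<n} \<le> (\<kappa> * L2_set x {..<n}) * L2_set z {..<n}"
    by (simp add: power2_eq_square mult_ac)
  then have "L2_set z {..<n} \<le> \<kappa> * L2_set x {..<n}"
    using k by (cases "L2_set z {..<n} = 0") (auto simp: less_le)
  then show "L2_set (\<lambda>i. \<Sum>j<n. x j * y j i) {..<n} \<le> \<kappa> * L2_set x {..<n}" by (simp add: z_def[abs_def])
qed

lemma op_le_subset:
  assumes "op_le I n \<kappa> y" "J \<subseteq> I" "finite I"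
  shows "op_le J n \<kappa> y"
  unfolding op_le_def
proof
  fix x
  have "L2_set (\<lambda>i. \<Sum>j<n. x j * y i j) J \<le> L2_set (\<lambda>i. \<Sum>j<n. x j * y i j) I"
    unfolding L2_set_def using assms by (intro real_sqrt_le_mono sum_mono2) auto
  also have "\<dots> \<le> \<kappa> * L2_set x {..<n}" using assms(1) by (simp add: op_le_def)
  finally show "L2_set (\<lambda>i. \<Sum>j<n. x j * y i j) J \<le> \<kappa> * L2_set x {..<n}" .
qed

lemma distance_rational:
  fixes y :: "nat \<Rightarrow> nat \<Rightarrow> real"
  assumes J: "finite J" and lt: "L2_set (\<lambda>i. u i - (\<Sum>j\<in>J. x j * y j i)) N < e"
  shows "\<exists>q\<in>J \<rightarrow>\<^sub>E \<rat>. L2_set (\<lambda>i. u i - (\<Sum>j\<in>J. q j * y j i)) N < e"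
proof (rule rational_approximation[where G = "\<lambda>x. L2_set (\<lambda>i. u i - (\<Sum>j\<in>J. x j * y j i)) N" and x = x
      and C = "\<Sum>j\<in>J. L2_set (y j) N"])
  show "finite J" by (rule J)
  show "L2_set (\<lambda>i. u i - (\<Sum>j\<in>J. x j * y j i)) N < e" by (rule lt)
  fix q :: "nat \<Rightarrow> real"
  have "L2_set (\<lambda>i. u i - (\<Sum>j\<in>J. q j * y j i)) N
      = L2_set (\<lambda>i. (u i - (\<Sum>j\<in>J. x j * y j i)) + (\<Sum>j\<in>J. (x j - q j) * y j i)) N"
    by (simp add: left_diff_distrib sum_subtractf)
  also have "\<dots> \<le> L2_set (\<lambda>i. u i - (\<Sum>j\<in>J. x j * y j i)) N + L2_set (\<lambda>i. \<Sum>j\<in>J. (x j - q j) * y j i) N"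
    by (rule L2_set_triangle_ineq)
  also have "L2_set (\<lambda>i. \<Sum>j\<in>J. (x j - q j) * y j i) N \<le> (\<Sum>j\<in>J. \<bar>x j - q j\<bar> * L2_set (y j) N)"
    by (rule L2_set_sum_le[OF J])
  also have "\<dots> \<le> (\<Sum>j\<in>J. \<bar>x j - q j\<bar> * (\<Sum>j\<in>J. L2_set (y j) N))"
    using J by (intro sum_mono mult_left_mono member_le_sum) auto
  also have "\<dots> = (\<Sum>j\<in>J. L2_set (y j) N) * (\<Sum>j\<in>J. \<bar>x j - q j\<bar>)"
    by (simp add: sum_distrib_right[symmetric] mult.commute)
  finally show "L2_set (\<lambda>i. u i - (\<Sum>j\<in>J. q j * y j i)) N
     \<le> L2_set (\<lambda>i. u i - (\<Sum>j\<in>J. x j * y j i)) N + (\<Sum>j\<in>J. L2_set (y j) N) * (\<Sum>j\<in>J. \<bar>x j - q j\<bar>)" by simp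
qed

lemma (in random_entries) random_entries_subset:
  assumes "J \<subseteq> I"
  shows "random_entries M J n Y B"
proof
  show "finite J" using assms finI finite_subset by blast
  show "indep_vars (\<lambda>_. borel) (\<lambda>p. Y (fst p) (snd p)) (J \<times> {..<n})"
    by (rule indep_vars_subset[OF ind]) (use assms in auto)
  show "moment_class B (distr M borel (Y i j))" if "i \<in> J" "j < n" for i j using mc that assms by auto
qed

text \<open>A single sum is the one-element case of \<open>tensorization\<close> with s = 1. The
  denominator exp (\<eta> n) and the cut-off \<mu> \<surd>n produce the same error exp (- \<eta>
  n).\<close>

lemma (in random_entries) normal_small_ball:
  assumes c: "rv_constants B K p0 b \<rho> \<delta> lam \<gamma> \<mu> \<eta>" and n: "1 \<le> n" and k: "k \<in> I"
    and iid: "\<And>j. j < n \<Longrightarrow> distr M borel (Y k j) = \<nu>"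
    and lcd: "lcd_ge \<gamma> (\<mu> * sqrt n) (exp (\<eta> * n)) n a" and e: "0 < e"
  shows "prob {\<omega>\<in>space M. \<bar>\<Sum>i<n. a i * Y k i \<omega>\<bar> < e} \<le> (64 * e + 16 * exp (- \<eta> * n)) / (\<gamma> * b)"
proof -
  interpret rv_constants B K p0 b \<rho> \<delta> lam \<gamma> \<mu> \<eta> by fact
  interpret S: random_entries M "{k}" n Y B by (rule random_entries_subset) (use k in simp)
  define q where "q = 4 * ((8 * e + 1 / exp (\<eta> * n)) / (\<gamma> * sqrt b) + exp (- b * (\<mu> * sqrt n)\<^sup>2))"
  have pos: "0 < \<gamma>" "0 < b" "0 < \<mu>" using gam_bounds b_bounds mu_bounds by auto
  have q0: "0 \<le> q" using e pos by (simp add: q_def)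
  have "{\<omega>\<in>space M. \<bar>\<Sum>i<n. a i * Y k i \<omega>\<bar> < e} \<subseteq> {\<omega> \<in> space M. (\<Sum>i\<in>{k}. (\<Sum>j<n. (a j / e) * Y i j \<omega>)\<^sup>2) \<le> 1 * real (card {k})}"
  proof safe
    fix \<omega> assume "\<bar>\<Sum>i<n. a i * Y k i \<omega>\<bar> < e"
    moreover have "(\<Sum>j<n. (a j / e) * Y k j \<omega>) = (\<Sum>i<n. a i * Y k i \<omega>) / e"
      by (simp add: sum_divide_distrib)
    ultimately have "\<bar>\<Sum>j<n. (a j / e) * Y k j \<omega>\<bar> \<le> 1" using e by simp
    then show "(\<Sum>i\<in>{k}. (\<Sum>j<n. (a j / e) * Y i j \<omega>)\<^sup>2) \<le> 1 * real (card {k})"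
      by (simp add: abs_square_le_1)
  qed
  moreover have "{\<omega> \<in> space M. (\<Sum>i\<in>{k}. (\<Sum>j<n. (a j / e) * Y i j \<omega>)\<^sup>2) \<le> 1 * real (card {k})} \<in> events"
    using k by measurable
  ultimately have "prob {\<omega>\<in>space M. \<bar>\<Sum>i<n. a i * Y k i \<omega>\<bar> < e}
    \<le> prob {\<omega> \<in> space M. (\<Sum>i\<in>{k}. (\<Sum>j<n. (a j / e) * Y i j \<omega>)\<^sup>2) \<le> 1 * real (card {k})}"
    by (rule finite_measure_mono)
  also have "\<dots> \<le> (exp (1 / 2) * q) ^ card {k}"
  proof (rule tensorization[OF _ indep_vars_row_sums[OF S.ind], where q = q and s = 1])
    fix i assume "i \<in> {k}"
    then show "(\<integral>\<^sup>+\<omega>. ennreal (exp (- (\<Sum>j<n. (a j / e) * Y i j \<omega>)\<^sup>2 / 2)) \<partial>M) \<le> ennreal q"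
      unfolding q_def using pos b e n lcd by (intro S.lcd_row_bound[where \<nu> = "\<lambda>_. \<nu>"]) (auto simp: iid)
  qed (use q0 in auto)
  also have "\<dots> = exp (1 / 2) * q" by simp
  also have "\<dots> \<le> 2 * q"
  proof (rule mult_right_mono[OF _ q0])
    have "exp (1 / 2 :: real) \<le> 1 + 1/2 + (1/2)\<^sup>2" by (rule exp_bound) auto
    then show "exp (1 / 2 :: real) \<le> 2" by (simp add: power2_eq_square)
  qed
  also have "\<dots> \<le> (64 * e + 16 * exp (- \<eta> * n)) / (\<gamma> * b)"
  proof -
    define x where "x = exp (- \<eta> * n)"
    have x: "1 / exp (\<eta> * n) = x" "exp (- b * (\<mu> * sqrt n)\<^sup>2) = x" "0 \<le> x"
      by (simp_all add: x_def exp_minus inverse_eq_divide eta power_mult_distrib mult.assoc)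
    have "\<gamma> * b \<le> \<gamma> * sqrt b" using pos b_bounds by (intro mult_left_mono) auto
    then have 1: "(8 * e + x) / (\<gamma> * sqrt b) \<le> (8 * e + x) / (\<gamma> * b)"
      using e x pos by (intro divide_left_mono) auto
    have "\<gamma> * b \<le> 1" using gam_bounds b_bounds by (intro mult_le_one) auto
    then have "x / 1 \<le> x / (\<gamma> * b)" using x pos by (intro divide_left_mono) auto
    then have 2: "x \<le> x / (\<gamma> * b)" by simp
    have aux: "2 * (4 * (U + x)) \<le> 8 * V + 8 * W" if "U \<le> V" "x \<le> W" for U V W :: real
    proof -
      have "8 * U \<le> 8 * V" "8 * x \<le> 8 * W" using that by simp_all
      then show ?thesis by simp
    qed
    have "2 * q \<le> 8 * ((8 * e + x) / (\<gamma> * b)) + 8 * (x / (\<gamma> * b))" unfolding q_def x(1,2) by (rule aux[OF 1 2])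
    also have "\<dots> = (64 * e + 16 * x) / (\<gamma> * b)" using pos by (simp add: field_simps)
    finally show ?thesis by (simp add: x_def)
  qed
  finally show ?thesis .
qed

text \<open>
  Conditioning on the other columns needs no measurable choice of a normal vector: the distance event is described
  by rational combinations, and \<open>G\<close> collects the values of the other columns for which its conditional probability
  is small.
\<close>

lemma (in random_entries) column_distance:
  assumes c: "rv_constants B K p0 b \<rho> \<delta> lam \<gamma> \<mu> \<eta>" and n: "768 / lam \<le> n" "1 / \<mu>\<^sup>2 \<le> n" and I: "I = {..<n}"
    and iid: "\<And>i j. i \<in> I \<Longrightarrow> j < n \<Longrightarrow> distr M borel (Y i j) = \<nu> i"
    and k: "k < n" and e: "0 < e"
  shows "\<exists>E\<in>events. prob E \<le> (64 * e + 16 * exp (- \<eta> * n)) / (\<gamma> * b) + (exp (- p0 / 8 * n) + exp (- real n / 2)) \<and>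
    (\<forall>\<omega>\<in>space M - E. op_le {..<n} n (K * sqrt n) (\<lambda>i j. Y i j \<omega>) \<longrightarrow>
       (\<forall>x. e \<le> L2_set (\<lambda>i. Y k i \<omega> - (\<Sum>j\<in>{..<n} - {k}. x j * Y j i \<omega>)) {..<n}))"
proof -
  interpret rv_constants B K p0 b \<rho> \<delta> lam \<gamma> \<mu> \<eta> by fact
  define J where "J = {..<n} - {k}"
  have J: "finite J" "J \<subseteq> I" "card J = n - 1" using k by (auto simp: J_def I)
  interpret J: random_entries M J n Y B by (rule random_entries_subset[OF J(2)])
  have pos: "0 < \<gamma>" "0 < b" using gam_bounds b_bounds by auto
  obtain Bad where Bad: "Bad \<in> events" "prob Bad \<le> exp (- p0 / 8 * n) + exp (- real n / 2)"
    "\<And>\<omega> a. \<omega> \<in> space M - Bad \<Longrightarrow> op_le J n (K * sqrt n) (\<lambda>i j. Y i j \<omega>) \<Longrightarrow> L2_set a {..<n} = 1 \<Longrightarrow>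
       (\<forall>i\<in>J. (\<Sum>j<n. a j * Y i j \<omega>) = 0) \<Longrightarrow> lcd_ge \<gamma> (\<mu> * sqrt n) (exp (\<eta> * n)) n a"
  proof -
    have iidJ: "\<And>i j. i \<in> J \<Longrightarrow> j < n \<Longrightarrow> distr M borel (Y i j) = \<nu> i" using iid J(2) by auto
    show thesis using J.normal_lcd[OF c n J(3) iidJ] that by auto
  qed
  define S where "S = PiM ({k} \<times> {..<n}) (\<lambda>_. borel :: real measure)"
  define T where "T = PiM (J \<times> {..<n}) (\<lambda>_. borel :: real measure)"
  define X where "X \<omega> = restrict (\<lambda>p. Y (fst p) (snd p) \<omega>) ({k} \<times> {..<n})" for \<omega>
  define R where "R \<omega> = restrict (\<lambda>p. Y (fst p) (snd p) \<omega>) (J \<times> {..<n})" for \<omega>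
  have ind2: "indep_var S X T R"
    unfolding S_def T_def X_def[abs_def] R_def[abs_def]
    by (rule indep_var_restrict[OF ind]) (use k in \<open>auto simp: J_def I\<close>)
  have X[measurable]: "random_variable S X" and R[measurable]: "random_variable T R"
    using ind2 unfolding indep_var_distribution_eq by auto
  define Q where "Q = (J \<rightarrow>\<^sub>E (\<rat> :: real set))"
  have Q: "countable Q" unfolding Q_def by (rule countable_rational_vectors[OF J(1)])
  define dd where "dd q z = L2_set (\<lambda>i. fst z (k, i) - (\<Sum>j\<in>J. q j * snd z (j, i))) {..<n}"
    for q :: "nat \<Rightarrow> real" and z :: "(nat \<times> nat \<Rightarrow> real) \<times> (nat \<times> nat \<Rightarrow> real)"
  define E where "E = (\<Union>q\<in>Q. {z \<in> space (S \<Otimes>\<^sub>M T). dd q z < e})"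
  have dm[measurable]: "dd q \<in> borel_measurable (S \<Otimes>\<^sub>M T)" for q
  proof -
    have 1: "(\<lambda>z. fst z (k, i)) \<in> borel_measurable (S \<Otimes>\<^sub>M T)" if "i < n" for i
      unfolding S_def using that
      by (intro measurable_compose[OF measurable_fst measurable_component_singleton]) auto
    have 2: "(\<lambda>z. snd z (j, i)) \<in> borel_measurable (S \<Otimes>\<^sub>M T)" if "i < n" "j \<in> J" for i j
      unfolding T_def using that
      by (intro measurable_compose[OF measurable_snd measurable_component_singleton]) auto
    show ?thesis unfolding dd_def[abs_def] L2_set_def
      by (intro measurable_compose[OF _ borel_measurable_sqrt] borel_measurable_sum borel_measurable_power borel_measurable_diff
            borel_measurable_times borel_measurable_const 1 2) auto
  qed
  have E: "E \<in> sets (S \<Otimes>\<^sub>M T)" unfolding E_def by (intro sets.countable_UN'' Q) measurable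
  define \<beta> where "\<beta> = (64 * e + 16 * exp (- \<eta> * n)) / (\<gamma> * b)"
  have b0: "0 \<le> \<beta>" using e pos by (simp add: \<beta>_def)
  define G where "G = {v \<in> space T. emeasure (distr M S X) ((\<lambda>u. (u, v)) -` E) \<le> ennreal \<beta>}"
  define H where "H = {\<omega>\<in>space M. (X \<omega>, R \<omega>) \<in> E \<and> R \<omega> \<in> G}"
  have H: "H \<in> events" "prob H \<le> \<beta>"
    using indep_section_bound[OF ind2 E G_def b0] by (auto simp: H_def)
  \<comment> \<open>Pairing with a annihilates the other columns, so the section of E at
    \<open>R \<omega>\<close> lies in the slab of all u with |<a, u>| < e, whose probability is
    bounded for each fixed a. The vector a may depend on \<omega> in any way, since only the
    membership \<open>R \<omega> \<in> G\<close> is kept.\<close>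
  have inG: "R \<omega> \<in> G"
    if \<omega>: "\<omega> \<in> space M" and a: "L2_set a {..<n} = 1" and orth: "\<forall>j\<in>J. (\<Sum>i<n. a i * Y j i \<omega>) = 0"
      and lcd: "lcd_ge \<gamma> (\<mu> * sqrt n) (exp (\<eta> * n)) n a" for \<omega> a
  proof -
    have "(\<lambda>u. (u, R \<omega>)) -` E \<subseteq> {u \<in> space S. \<bar>\<Sum>i<n. a i * u (k, i)\<bar> < e}"
    proof
      fix u assume "u \<in> (\<lambda>u. (u, R \<omega>)) -` E"
      then obtain q where q: "dd q (u, R \<omega>) < e" and u: "u \<in> space S" by (auto simp: E_def space_pair_measure)
      have "(\<Sum>i<n. a i * (u (k, i) - (\<Sum>j\<in>J. q j * R \<omega> (j, i))))
          = (\<Sum>i<n. a i * u (k, i)) - (\<Sum>i<n. \<Sum>j\<in>J. q j * (a i * R \<omega> (j, i)))"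
        by (simp add: right_diff_distrib sum_subtractf sum_distrib_left mult_ac)
      also have "(\<Sum>i<n. \<Sum>j\<in>J. q j * (a i * R \<omega> (j, i))) = (\<Sum>j\<in>J. q j * (\<Sum>i<n. a i * Y j i \<omega>))"
        unfolding sum_distrib_left by (subst sum.swap) (auto simp: R_def intro!: sum.cong)
      also have "\<dots> = 0" using orth by simp
      finally have "\<bar>\<Sum>i<n. a i * u (k, i)\<bar> = \<bar>\<Sum>i<n. a i * (u (k, i) - (\<Sum>j\<in>J. q j * R \<omega> (j, i)))\<bar>" by simp
      also have "\<dots> \<le> (\<Sum>i<n. \<bar>a i\<bar> * \<bar>u (k, i) - (\<Sum>j\<in>J. q j * R \<omega> (j, i))\<bar>)"
        by (rule order_trans[OF sum_abs]) (simp add: abs_mult)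
      also have "\<dots> \<le> L2_set a {..<n} * dd q (u, R \<omega>)" unfolding dd_def fst_conv snd_conv by (rule L2_set_mult_ineq)
      also have "\<dots> < e" using q a by simp
      finally show "u \<in> {u \<in> space S. \<bar>\<Sum>i<n. a i * u (k, i)\<bar> < e}" using u by simp
    qed
    moreover have m: "{u \<in> space S. \<bar>\<Sum>i<n. a i * u (k, i)\<bar> < e} \<in> sets S"
    proof -
      have "(\<lambda>u. u (k, i)) \<in> borel_measurable S" if "i < n" for i
        unfolding S_def using that by (intro measurable_component_singleton) auto
      then have [measurable]: "(\<lambda>u. \<Sum>i<n. a i * u (k, i)) \<in> borel_measurable S"
        by (intro borel_measurable_sum borel_measurable_times borel_measurable_const) auto
      show ?thesis by measurable
    qed
    ultimately have "emeasure (distr M S X) ((\<lambda>u. (u, R \<omega>)) -` E) \<le> emeasure (distr M S X) {u \<in> space S. \<bar>\<Sum>i<n. a i * u (k, i)\<bar> < e}"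
      by (intro emeasure_mono) auto
    also have "\<dots> = emeasure M (X -` {u \<in> space S. \<bar>\<Sum>i<n. a i * u (k, i)\<bar> < e} \<inter> space M)"
      by (rule emeasure_distr[OF X m])
    also have "X -` {u \<in> space S. \<bar>\<Sum>i<n. a i * u (k, i)\<bar> < e} \<inter> space M = {\<omega>\<in>space M. \<bar>\<Sum>i<n. a i * Y k i \<omega>\<bar> < e}"
      using measurable_space[OF X] by (auto simp: X_def)
    also have "emeasure M \<dots> \<le> ennreal \<beta>"
      unfolding emeasure_eq_measure \<beta>_def using k
      by (intro ennreal_leI normal_small_ball[OF c _ _ _ lcd e, where \<nu> = "\<nu> k"] iid) (auto simp: I)
    finally show ?thesis using measurable_space[OF R \<omega>] by (simp add: G_def)
  qed
  have "e \<le> L2_set (\<lambda>i. Y k i \<omega> - (\<Sum>j\<in>J. x j * Y j i \<omega>)) {..<n}"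
    if \<omega>: "\<omega> \<in> space M - (H \<union> Bad)" and op: "op_le {..<n} n (K * sqrt n) (\<lambda>i j. Y i j \<omega>)" for \<omega> x
  proof (rule ccontr)
    assume "\<not> e \<le> L2_set (\<lambda>i. Y k i \<omega> - (\<Sum>j\<in>J. x j * Y j i \<omega>)) {..<n}"
    then obtain q where q: "q \<in> Q" "L2_set (\<lambda>i. Y k i \<omega> - (\<Sum>j\<in>J. q j * Y j i \<omega>)) {..<n} < e"
      using distance_rational[OF J(1), of "\<lambda>i. Y k i \<omega>" x "\<lambda>j i. Y j i \<omega>" "{..<n}" e] by (auto simp: Q_def not_le)
    have "dd q (X \<omega>, R \<omega>) = L2_set (\<lambda>i. Y k i \<omega> - (\<Sum>j\<in>J. q j * Y j i \<omega>)) {..<n}"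
      unfolding dd_def by (intro L2_set_cong refl) (auto simp: X_def R_def intro!: sum.cong)
    then have "dd q (X \<omega>, R \<omega>) < e" using q(2) by simp
    then have inE: "(X \<omega>, R \<omega>) \<in> E"
      using q(1) \<omega> measurable_space[OF X] measurable_space[OF R] by (auto simp: E_def space_pair_measure)
    obtain a where a: "L2_set a {..<n} = 1" "\<forall>j\<in>J. (\<Sum>i<n. a i * Y j i \<omega>) = 0"
      using unit_vector_orthogonal[OF k, of "\<lambda>j i. Y j i \<omega>"] by (auto simp: J_def)
    have "lcd_ge \<gamma> (\<mu> * sqrt n) (exp (\<eta> * n)) n a"
      by (rule Bad(3)[OF _ _ a]) (use \<omega> op_le_subset[OF op] in \<open>auto simp: J_def\<close>)
    then have "R \<omega> \<in> G" using inG a \<omega> by auto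
    then show False using inE \<omega> by (auto simp: H_def)
  qed
  moreover have "prob (H \<union> Bad) \<le> \<beta> + (exp (- p0 / 8 * n) + exp (- real n / 2))"
    using measure_Un_le[OF H(1) Bad(1)] H(2) Bad(2) by linarith
  ultimately show ?thesis unfolding \<beta>_def J_def[symmetric] using H Bad
    by (intro bexI[of _ "H \<union> Bad"]) auto
qed

text \<open>A spread x has at least \<delta> n coordinates of size \<rho> / \<surd>n or more, and
  for each such k dividing the combination of columns by \<open>x k\<close> puts column k within e /
  \<rho> of the span of the others. So a bad outcome outside \<open>E0\<close> lies in at least
  \<delta> n of the events \<open>D k\<close>, and Markov's inequality for their number costs the
  factor 1 / \<delta>. The distance 2 e / \<rho> in place of e / \<rho> makes the contradiction
  strict, and e \<le> \<rho> K n puts x in the range of \<open>compressible\<close>.\<close>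

lemma (in random_entries) invertibility:
  assumes c: "rv_constants B K p0 b \<rho> \<delta> lam \<gamma> \<mu> \<eta>" and n: "768 / lam \<le> n" "1 / \<mu>\<^sup>2 \<le> n" and I: "I = {..<n}"
    and iid: "\<And>i j. i \<in> I \<Longrightarrow> j < n \<Longrightarrow> distr M borel (Y i j) = \<nu> i"
    and e: "0 < e" "e \<le> \<rho> * K * n"
  shows "\<exists>E\<in>events. prob E \<le> exp (- p0 / 8 * n) +
      ((64 * (2 * e / \<rho>) + 16 * exp (- \<eta> * n)) / (\<gamma> * b) + (exp (- p0 / 8 * n) + exp (- real n / 2))) / \<delta> \<and>
    (\<forall>\<omega>\<in>space M - E. op_le {..<n} n (K * sqrt n) (\<lambda>i j. Y i j \<omega>) \<longrightarrow>
       (\<forall>x. L2_set x {..<n} = 1 \<longrightarrow> e / sqrt n < L2_set (\<lambda>i. \<Sum>j<n. x j * Y j i \<omega>) {..<n}))"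
proof -
  interpret rv_constants B K p0 b \<rho> \<delta> lam \<gamma> \<mu> \<eta> by fact
  have pos: "0 < \<rho>" "0 < \<delta>" "0 < \<gamma>" "0 < b" using rho_bounds delta_bounds gam_bounds b_bounds by auto
  have "768 * 4 \<le> 768 / lam" using lam_bounds by (simp add: field_simps)
  then have n1: "1 \<le> n" using n by linarith
  \<comment> \<open>The compressible estimate concerns the image of x under the matrix, whose
    coordinates are numbered by rows, so it is applied to the transposed indexing.\<close>
  interpret T: random_entries M "{..<n}" n "\<lambda>i j. Y j i" B
  proof
    show "indep_vars (\<lambda>_. borel) (\<lambda>p. Y (snd p) (fst p)) ({..<n} \<times> {..<n})"
      using indep_vars_transpose[OF ind] by (simp add: I)
    show "moment_class B (distr M borel (Y j i))" if "i \<in> {..<n}" "j < n" for i j using mc that I by auto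
  qed simp
  obtain E0 where E0: "E0 \<in> events" "prob E0 \<le> exp (- p0 / 8 * n)"
    "\<And>\<omega> x. \<omega> \<in> space M - E0 \<Longrightarrow> op_le {..<n} n (K * sqrt n) (\<lambda>i j. Y j i \<omega>) \<Longrightarrow> L2_set x {..<n} = 1 \<Longrightarrow>
       L2_set (\<lambda>i. \<Sum>j<n. x j * Y j i \<omega>) {..<n} \<le> \<rho> * K * sqrt n \<Longrightarrow> spread \<rho> \<delta> n x"
    using T.compressible[OF c n1] by auto
  define \<beta> where "\<beta> = (64 * (2 * e / \<rho>) + 16 * exp (- \<eta> * n)) / (\<gamma> * b) + (exp (- p0 / 8 * n) + exp (- real n / 2))"
  define far where "far k D \<longleftrightarrow> (\<forall>\<omega>\<in>space M - D. op_le {..<n} n (K * sqrt n) (\<lambda>i j. Y i j \<omega>) \<longrightarrow>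
       (\<forall>x. 2 * e / \<rho> \<le> L2_set (\<lambda>i. Y k i \<omega> - (\<Sum>j\<in>{..<n} - {k}. x j * Y j i \<omega>)) {..<n}))" for k D
  have "\<exists>D. \<forall>k\<in>{..<n}. D k \<in> events \<and> prob (D k) \<le> \<beta> \<and> far k (D k)"
  proof (rule bchoice, rule ballI)
    fix k assume "k \<in> {..<n}"
    then have k: "k < n" by simp
    have e2: "0 < 2 * e / \<rho>" using e pos by simp
    show "\<exists>D. D \<in> events \<and> prob D \<le> \<beta> \<and> far k D"
      using column_distance[OF c n I iid k e2] unfolding \<beta>_def far_def Bex_def by simp
  qed
  then obtain D where D: "\<And>k. k < n \<Longrightarrow> D k \<in> events" "\<And>k. k < n \<Longrightarrow> prob (D k) \<le> \<beta>"
    and D_far: "\<And>k. k < n \<Longrightarrow> far k (D k)"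
    by auto
  have D3: "2 * e / \<rho> \<le> L2_set (\<lambda>i. Y k i \<omega> - (\<Sum>j\<in>{..<n} - {k}. x j * Y j i \<omega>)) {..<n}"
    if "k < n" "\<omega> \<in> space M - D k" "op_le {..<n} n (K * sqrt n) (\<lambda>i j. Y i j \<omega>)" for k \<omega> x
    using D_far[OF that(1)] that(2,3) unfolding far_def by simp
  define S where "S \<omega> = (\<Sum>k<n. indicator (D k) \<omega> :: real)" for \<omega>
  define H where "H = {\<omega>\<in>space M. \<delta> * n \<le> S \<omega>}"
  have iD: "integrable M (indicator (D k) :: _ \<Rightarrow> real)" if "k < n" for k
    using D(1)[OF that] by (simp add: integrable_real_indicator emeasure_eq_measure)
  have iS: "integrable M S" unfolding S_def[abs_def] by (intro Bochner_Integration.integrable_sum iD) simp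
  have Hm: "H \<in> events" unfolding H_def using iS by measurable
  have "prob H \<le> (\<integral>\<omega>. S \<omega> \<partial>M) / (\<delta> * n)"
    unfolding H_def using pos n1 by (intro integral_Markov_inequality_measure[where A = "{}"] iS) (auto simp: S_def sum_nonneg)
  also have "(\<integral>\<omega>. S \<omega> \<partial>M) = (\<Sum>k<n. prob (D k))"
    unfolding S_def by (subst Bochner_Integration.integral_sum) (auto simp: iD D(1))
  also have "(\<Sum>k<n. prob (D k)) \<le> (\<Sum>k<n. \<beta>)" by (intro sum_mono D(2)) simp
  also have "(\<Sum>k<n. \<beta>) / (\<delta> * n) = \<beta> / \<delta>" using n1 by simp
  finally have pH: "prob H \<le> \<beta> / \<delta>" using pos n1 by (simp add: divide_right_mono)
  have "e / sqrt n < L2_set (\<lambda>i. \<Sum>j<n. x j * Y j i \<omega>) {..<n}"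
    if \<omega>: "\<omega> \<in> space M - (E0 \<union> H)" and op: "op_le {..<n} n (K * sqrt n) (\<lambda>i j. Y i j \<omega>)" and x: "L2_set x {..<n} = 1" for \<omega> x
  proof (rule ccontr)
    assume "\<not> ?thesis"
    then have small: "L2_set (\<lambda>i. \<Sum>j<n. x j * Y j i \<omega>) {..<n} \<le> e / sqrt n" by simp
    also have "\<dots> \<le> (\<rho> * K * n) / sqrt n" using e by (intro divide_right_mono) auto
    also have "\<dots> = \<rho> * K * (real n / sqrt n)" by simp
    also have "real n / sqrt n = sqrt n" by (simp add: real_div_sqrt)
    finally have small': "L2_set (\<lambda>i. \<Sum>j<n. x j * Y j i \<omega>) {..<n} \<le> \<rho> * K * sqrt n" .
    have opT: "op_le {..<n} n (K * sqrt n) (\<lambda>i j. Y j i \<omega>)" using op_le_transpose[OF op] K by simp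
    have sp: "spread \<rho> \<delta> n x" using E0(3)[OF _ opT x small'] \<omega> by simp
    define U where "U = {k. k < n \<and> \<rho> / sqrt n \<le> \<bar>x k\<bar>}"
    have "\<omega> \<in> D k" if k: "k \<in> U" for k
    proof (rule ccontr)
      assume nD: "\<omega> \<notin> D k"
      have kn: "k < n" and xk: "\<rho> / sqrt n \<le> \<bar>x k\<bar>" using k by (auto simp: U_def)
      have xk0: "0 < \<bar>x k\<bar>" 
      proof -
        have "0 < \<rho> / sqrt n" using pos n1 by simp
        then show ?thesis using xk by linarith
      qed
      have "2 * e / \<rho> \<le> L2_set (\<lambda>i. Y k i \<omega> - (\<Sum>j\<in>{..<n} - {k}. (- x j / x k) * Y j i \<omega>)) {..<n}"
        by (rule D3[OF kn _ op]) (use nD \<omega> in auto)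
      also have "\<dots> = L2_set (\<lambda>i. (1 / x k) * (\<Sum>j<n. x j * Y j i \<omega>)) {..<n}"
      proof (intro L2_set_cong refl)
        fix i
        have "(\<Sum>j<n. x j * Y j i \<omega>) = x k * Y k i \<omega> + (\<Sum>j\<in>{..<n} - {k}. x j * Y j i \<omega>)"
          using kn by (subst sum.remove[of _ k]) auto
        then show "Y k i \<omega> - (\<Sum>j\<in>{..<n} - {k}. (- x j / x k) * Y j i \<omega>) = (1 / x k) * (\<Sum>j<n. x j * Y j i \<omega>)"
          using xk0 by (simp add: sum_negf sum_divide_distrib[symmetric] field_simps)
      qed
      also have "\<dots> = L2_set (\<lambda>i. \<Sum>j<n. x j * Y j i \<omega>) {..<n} / \<bar>x k\<bar>"
        unfolding L2_set_scale by simp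
      also have "\<dots> \<le> (e / sqrt n) / (\<rho> / sqrt n)"
        using small xk pos n1 e by (intro frac_le) auto
      also have "\<dots> = e / \<rho>" using n1 by simp
      finally show False using e pos by (simp add: field_simps)
    qed
    then have "(\<Sum>k\<in>U. 1) \<le> (\<Sum>k\<in>U. indicator (D k) \<omega> :: real)" by (intro sum_mono) simp
    also have "\<dots> \<le> S \<omega>" unfolding S_def by (intro sum_mono2) (auto simp: U_def)
    finally have "\<delta> * n \<le> S \<omega>" using sp by (simp add: spread_def U_def)
    then show False using \<omega> unfolding H_def by blast
  qed
  moreover have "prob (E0 \<union> H) \<le> exp (- p0 / 8 * n) + \<beta> / \<delta>"
    using measure_Un_le[OF E0(1) Hm] E0(2) pH by linarith
  ultimately show ?thesis unfolding \<beta>_def[symmetric] using E0(1) Hm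
    by (intro bexI[of _ "E0 \<union> H"]) auto
qed

section \<open>Matrices with independent rows\<close>

context prob_space
begin

text \<open>The joint law of a row is that of \<xi>, hence a product; probabilities of boxes then
  factor twice, first over the independent rows and then within each row, and boxes suffice for a
  finite family.\<close>

lemma entries_indep:
  assumes rows: "rows_indep_copies n \<xi> A" and adm: "admissible_variables n B \<xi>" and n: "1 \<le> n"
  shows "\<And>i j. i < n \<Longrightarrow> j < n \<Longrightarrow> distr M borel (\<lambda>\<omega>. A \<omega> $$ (i, j)) = distr M borel (\<xi> j)"
    and "indep_vars (\<lambda>_. borel) (\<lambda>p \<omega>. A \<omega> $$ (fst p, snd p)) ({..<n} \<times> {..<n})"
proof -
  let ?V = "PiM {..<n} (\<lambda>_. borel :: real measure)"
  define R where "R i \<omega> = (\<lambda>j\<in>{..<n}. A \<omega> $$ (i, j))" for i \<omega>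
  define X where "X \<omega> = (\<lambda>j\<in>{..<n}. \<xi> j \<omega>)" for \<omega>
  have ind: "indep_vars (\<lambda>_. ?V) R {..<n}" and eq: "\<And>i. i < n \<Longrightarrow> distr M ?V (R i) = distr M ?V X"
    using rows by (auto simp: rows_indep_copies_def R_def[abs_def] X_def[abs_def])
  have indX: "indep_vars (\<lambda>_. borel) \<xi> {..<n}" using adm by (simp add: admissible_variables_def)
  have R[measurable]: "random_variable ?V (R i)" if "i < n" for i using ind that by (auto simp: indep_vars_def)
  have xi[measurable]: "random_variable borel (\<xi> j)" if "j < n" for j using indX that by (auto simp: indep_vars_def)
  have X[measurable]: "random_variable ?V X" unfolding X_def[abs_def] by (intro measurable_restrict xi) simp
  have comp: "(\<lambda>f. f j) \<in> borel_measurable ?V" if "j < n" for j using that by (intro measurable_component_singleton) simp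
  have Am: "random_variable borel (\<lambda>\<omega>. A \<omega> $$ (i, j))" if "i < n" "j < n" for i j
    using measurable_compose[OF R[OF that(1)] comp[OF that(2)]] that by (simp add: R_def)
  show marg: "distr M borel (\<lambda>\<omega>. A \<omega> $$ (i, j)) = distr M borel (\<xi> j)" if ij: "i < n" "j < n" for i j
  proof -
    have "distr M borel (\<lambda>\<omega>. A \<omega> $$ (i, j)) = distr (distr M ?V (R i)) borel (\<lambda>f. f j)"
      using ij by (subst distr_distr[OF comp R]) (auto simp: R_def comp_def)
    also have "\<dots> = distr (distr M ?V X) borel (\<lambda>f. f j)" using eq ij by simp
    also have "\<dots> = distr M borel (\<xi> j)"
      using ij by (subst distr_distr[OF comp X]) (auto simp: X_def comp_def)
    finally show ?thesis .
  qed
  have row: "prob (\<Inter>j\<in>{..<n}. (\<lambda>\<omega>. A \<omega> $$ (i, j)) -` S j \<inter> space M) = (\<Prod>j<n. prob ((\<lambda>\<omega>. A \<omega> $$ (i, j)) -` S j \<inter> space M))"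
    if i: "i < n" and S: "\<And>j. j < n \<Longrightarrow> S j \<in> sets borel" for i and S :: "nat \<Rightarrow> real set"
  proof -
    have ne: "{..<n} \<noteq> {}" using n by (simp add: lessThan_empty_iff)
    have PS: "PiE {..<n} S \<in> sets ?V" using S by (intro sets_PiM_I_finite) auto
    have "(\<Inter>j\<in>{..<n}. (\<lambda>\<omega>. A \<omega> $$ (i, j)) -` S j \<inter> space M) = R i -` PiE {..<n} S \<inter> space M"
      using ne by (auto simp: R_def PiE_iff)
    then have "prob (\<Inter>j\<in>{..<n}. (\<lambda>\<omega>. A \<omega> $$ (i, j)) -` S j \<inter> space M) = measure (distr M ?V (R i)) (PiE {..<n} S)"
      using measure_distr[OF R[OF i] PS] by simp
    also have "\<dots> = prob (X -` PiE {..<n} S \<inter> space M)" using measure_distr[OF X PS] eq[OF i] by simp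
    also have "X -` PiE {..<n} S \<inter> space M = (\<Inter>j\<in>{..<n}. \<xi> j -` S j \<inter> space M)"
      using ne by (auto simp: X_def PiE_iff)
    also have "prob \<dots> = (\<Prod>j<n. prob (\<xi> j -` S j \<inter> space M))"
      by (rule indep_varsD_finite[OF indX ne]) (use S in auto)
    also have "\<dots> = (\<Prod>j<n. prob ((\<lambda>\<omega>. A \<omega> $$ (i, j)) -` S j \<inter> space M))"
    proof (intro prod.cong refl)
      fix j assume "j \<in> {..<n}"
      then have j: "j < n" by simp
      show "prob (\<xi> j -` S j \<inter> space M) = prob ((\<lambda>\<omega>. A \<omega> $$ (i, j)) -` S j \<inter> space M)"
        using measure_distr[OF xi[OF j] S[OF j]] measure_distr[OF Am[OF i j] S[OF j]] marg[OF i j] by simp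
    qed
    finally show ?thesis .
  qed
  have bo: "sets (borel :: real measure) = sigma_sets (space borel) (sets borel)"
    using sets.sigma_sets_eq[of "borel :: real measure"] by simp
  show "indep_vars (\<lambda>_. borel) (\<lambda>p \<omega>. A \<omega> $$ (fst p, snd p)) ({..<n} \<times> {..<n})"
  proof (subst indep_vars_finite[where E = "\<lambda>_. sets borel"])
    show "{..<n} \<times> {..<n} \<noteq> {}" using n by (simp add: lessThan_empty_iff)
    show "\<And>i. i \<in> {..<n} \<times> {..<n} \<Longrightarrow> sets borel = sigma_sets (space borel) (sets (borel :: real measure))" by (rule bo)
    show "\<And>i. i \<in> {..<n} \<times> {..<n} \<Longrightarrow> random_variable borel (\<lambda>\<omega>. A \<omega> $$ (fst i, snd i))"
      by (rule Am) auto
    show "\<And>i. i \<in> {..<n} \<times> {..<n} \<Longrightarrow> Int_stable (sets (borel :: real measure))" by (rule sets.Int_stable)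
    show "\<forall>S\<in>{..<n} \<times> {..<n} \<rightarrow> sets borel.
        prob (\<Inter>p\<in>{..<n} \<times> {..<n}. (\<lambda>\<omega>. A \<omega> $$ (fst p, snd p)) -` S p \<inter> space M) =
        (\<Prod>p\<in>{..<n} \<times> {..<n}. prob ((\<lambda>\<omega>. A \<omega> $$ (fst p, snd p)) -` S p \<inter> space M))"
    proof
      fix S :: "nat \<times> nat \<Rightarrow> real set" assume S: "S \<in> {..<n} \<times> {..<n} \<rightarrow> sets borel"
      have S': "S (i, j) \<in> sets borel" if "i < n" "j < n" for i j using S that by auto
      have ne: "{..<n} \<noteq> {}" using n by (simp add: lessThan_empty_iff)
      have PS: "PiE {..<n} (\<lambda>j. S (i, j)) \<in> sets ?V" if "i < n" for i using S' that by (intro sets_PiM_I_finite) auto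
      have rv: "R i -` PiE {..<n} (\<lambda>j. S (i, j)) \<inter> space M = (\<Inter>j\<in>{..<n}. (\<lambda>\<omega>. A \<omega> $$ (i, j)) -` S (i, j) \<inter> space M)" for i
        using ne by (auto simp: R_def PiE_iff)
      have "(\<Inter>p\<in>{..<n} \<times> {..<n}. (\<lambda>\<omega>. A \<omega> $$ (fst p, snd p)) -` S p \<inter> space M)
          = (\<Inter>i\<in>{..<n}. R i -` PiE {..<n} (\<lambda>j. S (i, j)) \<inter> space M)"
        unfolding rv using ne by auto
      also have "prob \<dots> = (\<Prod>i<n. prob (R i -` PiE {..<n} (\<lambda>j. S (i, j)) \<inter> space M))"
        by (rule indep_varsD_finite[OF ind ne]) (use PS in auto)
      also have "\<dots> = (\<Prod>i<n. \<Prod>j<n. prob ((\<lambda>\<omega>. A \<omega> $$ (i, j)) -` S (i, j) \<inter> space M))"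
        unfolding rv by (intro prod.cong refl row) (use S' in auto)
      also have "\<dots> = (\<Prod>p\<in>{..<n} \<times> {..<n}. prob ((\<lambda>\<omega>. A \<omega> $$ (fst p, snd p)) -` S p \<inter> space M))"
        by (simp add: prod.cartesian_product split_def)
      finally show "prob (\<Inter>p\<in>{..<n} \<times> {..<n}. (\<lambda>\<omega>. A \<omega> $$ (fst p, snd p)) -` S p \<inter> space M) =
        (\<Prod>p\<in>{..<n} \<times> {..<n}. prob ((\<lambda>\<omega>. A \<omega> $$ (fst p, snd p)) -` S p \<inter> space M))" .
    qed
  qed auto
qed

lemma admissible_moment_class:
  assumes "admissible_variables n B \<xi>" "k < n"
  shows "moment_class B (distr M borel (\<xi> k))"
proof -
  have m[measurable]: "random_variable borel (\<xi> k)" using assms by (auto simp: admissible_variables_def indep_vars_def)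
  have *: "integrable M (\<lambda>\<omega>. \<xi> k \<omega> ^ 4)" "expectation (\<lambda>\<omega>. \<xi> k \<omega> ^ 4) \<le> B" "expectation (\<xi> k) = 0"
      "1 \<le> expectation (\<lambda>\<omega>. (\<xi> k \<omega>)\<^sup>2)"
    using assms by (auto simp: admissible_variables_def)
  show ?thesis unfolding moment_class_def using *
    by (simp add: real_distribution_distr integrable_distr_eq integral_distr)
qed

text \<open>The column is the first index on purpose: by \<open>entries_indep\<close> the entries of
  column k have the law of \<open>\<xi> k\<close> in every row, so all coordinates in the second
  index share one law.\<close>

lemma random_entries_columns:
  assumes "rows_indep_copies n \<xi> A" "admissible_variables n B \<xi>" "1 \<le> n"
  shows "random_entries M {..<n} n (\<lambda>k i \<omega>. A \<omega> $$ (i, k)) B"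
proof
  show "indep_vars (\<lambda>_. borel) (\<lambda>p \<omega>. A \<omega> $$ (snd p, fst p)) ({..<n} \<times> {..<n})"
    using indep_vars_transpose[where Y = "\<lambda>i j \<omega>. A \<omega> $$ (i, j)", OF entries_indep(2)[OF assms]] .
  show "moment_class B (distr M borel (\<lambda>\<omega>. A \<omega> $$ (j, i)))" if "i \<in> {..<n}" "j < n" for i j
    using entries_indep(1)[OF assms, of j i] admissible_moment_class[OF assms(2), of i] that by simp
qed simp

end

section \<open>Spectral norm and smallest singular value in coordinates\<close>

lemma euclid_norm_L2: "euclid_norm v = L2_set (\<lambda>i. v $ i) {..<dim_vec v}"
  by (simp add: euclid_norm_def scalar_prod_def L2_set_def power2_eq_square lessThan_atLeast0)

lemma euclid_norm_mult:
  assumes "A \<in> carrier_mat n n" "x \<in> carrier_vec n"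
  shows "euclid_norm (A *\<^sub>v x) = L2_set (\<lambda>i. \<Sum>j<n. x $ j * A $$ (i, j)) {..<n}"
proof -
  have "dim_vec (A *\<^sub>v x) = n" using assms by simp
  moreover have "(A *\<^sub>v x) $ i = (\<Sum>j<n. x $ j * A $$ (i, j))" if "i < n" for i
    using assms that by (auto simp: scalar_prod_def lessThan_atLeast0 mult.commute intro!: sum.cong)
  ultimately show ?thesis unfolding euclid_norm_L2 by (intro L2_set_cong) auto
qed

abbreviation unit_sphere :: "nat \<Rightarrow> real vec set" where
  "unit_sphere n \<equiv> {x \<in> carrier_vec n. euclid_norm x = 1}"

lemma unit_sphere_nonempty: "1 \<le> n \<Longrightarrow> unit_sphere n \<noteq> {}"
proof -
  assume n: "1 \<le> n"
  have "(\<Sum>i<n. (if i = 0 then 1 else 0 :: real)) = 1" using n by (subst sum.delta) auto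
  then have "euclid_norm (vec n (\<lambda>i. if i = 0 then 1 else 0)) = 1"
    by (simp add: euclid_norm_L2 L2_set_def if_distrib[of "\<lambda>x. x\<^sup>2"] cong: if_cong)
  then show ?thesis by fastforce
qed

lemma matrix_action_le:
  "L2_set (\<lambda>i. \<Sum>j<n. x j * A $$ (i, j)) {..<n} \<le> (\<Sum>j<n. \<bar>x j\<bar> * L2_set (\<lambda>i. A $$ (i, j)) {..<n})"
  by (rule L2_set_sum_le) simp

text \<open>Boundedness is what lets the real supremum in \<open>spectral_norm\<close> dominate its
  single values; the sum of the column norms serves as a bound.\<close>

lemma spectral_bdd_above:
  assumes A: "A \<in> carrier_mat n n"
  shows "bdd_above ((\<lambda>x. euclid_norm (A *\<^sub>v x)) ` unit_sphere n)"
proof (rule bdd_aboveI2)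
  fix x assume x: "x \<in> unit_sphere n"
  have x1: "\<bar>x $ j\<bar> \<le> 1" if "j < n" for j
  proof -
    have "L2_set (\<lambda>j. x $ j) {..<n} = 1" using x by (auto simp: euclid_norm_L2)
    then show ?thesis using member_le_L2_set[of "{..<n}" j "\<lambda>j. \<bar>x $ j\<bar>"] that by (simp add: L2_set_def)
  qed
  have "euclid_norm (A *\<^sub>v x) = L2_set (\<lambda>i. \<Sum>j<n. x $ j * A $$ (i, j)) {..<n}"
    using x by (intro euclid_norm_mult A) simp
  also have "\<dots> \<le> (\<Sum>j<n. \<bar>x $ j\<bar> * L2_set (\<lambda>i. A $$ (i, j)) {..<n})" by (rule matrix_action_le)
  also have "\<dots> \<le> (\<Sum>j<n. 1 * L2_set (\<lambda>i. A $$ (i, j)) {..<n})"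
    using x1 by (intro sum_mono mult_right_mono) auto
  finally show "euclid_norm (A *\<^sub>v x) \<le> (\<Sum>j<n. 1 * L2_set (\<lambda>i. A $$ (i, j)) {..<n})" .
qed

lemma op_le_spectral_norm:
  assumes A: "A \<in> carrier_mat n n" and le: "spectral_norm A \<le> \<kappa>"
  shows "op_le {..<n} n \<kappa> (\<lambda>i j. A $$ (i, j))"
  unfolding op_le_def
proof
  fix x
  define c where "c = L2_set x {..<n}"
  have c0: "0 \<le> c" by (simp add: c_def)
  show "L2_set (\<lambda>i. \<Sum>j<n. x j * A $$ (i, j)) {..<n} \<le> \<kappa> * L2_set x {..<n}"
  proof (cases "c = 0")
    case True
    then have "\<forall>j<n. x j = 0" by (simp add: c_def L2_set_eq_0_iff)
    then have "L2_set (\<lambda>i. \<Sum>j<n. x j * A $$ (i, j)) {..<n} = 0" by (simp add: L2_set_eq_0_iff)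
    then show ?thesis using True by (simp add: c_def)
  next
    case False
    define u where "u = vec n (\<lambda>j. (1 / c) * x j)"
    have uc: "u \<in> carrier_vec n" by (simp add: u_def)
    have "euclid_norm u = L2_set (\<lambda>j. (1 / c) * x j) {..<n}"
      unfolding euclid_norm_L2 by (intro L2_set_cong) (auto simp: u_def)
    also have "\<dots> = 1" unfolding L2_set_scale c_def[symmetric] using c0 False by simp
    finally have u: "u \<in> unit_sphere n" using uc by simp
    have "L2_set (\<lambda>i. \<Sum>j<n. ((1 / c) * x j) * A $$ (i, j)) {..<n} = L2_set (\<lambda>i. \<Sum>j<n. u $ j * A $$ (i, j)) {..<n}"
      by (intro L2_set_cong refl sum.cong) (auto simp: u_def)
    also have "\<dots> = euclid_norm (A *\<^sub>v u)" by (rule euclid_norm_mult[OF A uc, symmetric])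
    also have "\<dots> \<le> spectral_norm A"
      unfolding spectral_norm_def using A u by (intro cSUP_upper2[OF _ _ order_refl]) (auto intro: spectral_bdd_above)
    also have "\<dots> \<le> \<kappa>" by (rule le)
    finally have "(1 / c) * L2_set (\<lambda>i. \<Sum>j<n. x j * A $$ (i, j)) {..<n} \<le> \<kappa>"
      unfolding L2_set_scaled_row_sums using c0 by simp
    then show ?thesis using c0 False unfolding c_def[symmetric] by (simp add: field_simps)
  qed
qed

text \<open>A strict inequality yields a vector below t without attainment of the infimum; the price
  is the limit of e towards \<epsilon> in \<open>large_dimension\<close>.\<close>

lemma smallest_singular_value_less:
  assumes A: "A \<in> carrier_mat n n" and n: "1 \<le> n" and lt: "smallest_singular_value A < t"
  shows "\<exists>x. L2_set x {..<n} = 1 \<and> L2_set (\<lambda>i. \<Sum>j<n. x j * A $$ (i, j)) {..<n} < t"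
proof -
  have "\<exists>y\<in>(\<lambda>x. euclid_norm (A *\<^sub>v x)) ` unit_sphere n. y < t"
    using lt A unit_sphere_nonempty[OF n] unfolding smallest_singular_value_def by (intro cInf_lessD) auto
  then obtain x where x: "x \<in> carrier_vec n" "euclid_norm x = 1" "euclid_norm (A *\<^sub>v x) < t" by auto
  show ?thesis
    by (rule exI[of _ "\<lambda>j. x $ j"]) (use x euclid_norm_mult[OF A x(1)] in \<open>auto simp: euclid_norm_L2\<close>)
qed

text \<open>The homogeneous form t |q| < |A q| avoids normalizing rational vectors; it makes the
  norm event a countable union of measurable events.\<close>

lemma spectral_norm_gt_iff:
  assumes A: "A \<in> carrier_mat n n" and n: "1 \<le> n" and t: "0 \<le> t"
  shows "t < spectral_norm A \<longleftrightarrow>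
    (\<exists>q\<in>{..<n} \<rightarrow>\<^sub>E \<rat>. t * L2_set q {..<n} - L2_set (\<lambda>i. \<Sum>j<n. q j * A $$ (i, j)) {..<n} < 0)"
proof
  assume "t < spectral_norm A"
  then have "\<exists>y\<in>(\<lambda>x. euclid_norm (A *\<^sub>v x)) ` unit_sphere n. t < y"
    using A unit_sphere_nonempty[OF n] unfolding spectral_norm_def by (intro less_cSupD) auto
  then obtain x where x: "x \<in> carrier_vec n" "euclid_norm x = 1" "t < euclid_norm (A *\<^sub>v x)" by auto
  define G where "G q = t * L2_set q {..<n} - L2_set (\<lambda>i. \<Sum>j<n. q j * A $$ (i, j)) {..<n}" for q
  define CC where "CC = (\<Sum>j<n. L2_set (\<lambda>i. A $$ (i, j)) {..<n})"
  have "\<exists>q\<in>{..<n} \<rightarrow>\<^sub>E \<rat>. G q < 0"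
  proof (rule rational_approximation[where x = "\<lambda>j. x $ j" and C = "t + CC"])
    show "G (\<lambda>j. x $ j) < 0" using x euclid_norm_mult[OF A x(1)] by (simp add: G_def euclid_norm_L2)
    fix q
    have "L2_set q {..<n} \<le> L2_set (\<lambda>j. x $ j) {..<n} + L2_set (\<lambda>j. q j - x $ j) {..<n}"
      using L2_set_triangle_ineq[of "\<lambda>j. x $ j" "\<lambda>j. q j - x $ j" "{..<n}"] by simp
    also have "L2_set (\<lambda>j. q j - x $ j) {..<n} \<le> (\<Sum>j<n. \<bar>q j - x $ j\<bar>)" by (rule L2_set_le_sum_abs)
    finally have 1: "t * L2_set q {..<n} \<le> t * (L2_set (\<lambda>j. x $ j) {..<n} + (\<Sum>j<n. \<bar>x $ j - q j\<bar>))"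
      using t by (intro mult_left_mono) (auto simp: abs_minus_commute)
    have "L2_set (\<lambda>i. \<Sum>j<n. x $ j * A $$ (i, j)) {..<n} - L2_set (\<lambda>i. \<Sum>j<n. q j * A $$ (i, j)) {..<n}
        \<le> L2_set (\<lambda>i. \<Sum>j<n. (x $ j - q j) * A $$ (i, j)) {..<n}"
      by (rule L2_set_row_sums_triangle)
    also have "\<dots> \<le> (\<Sum>j<n. \<bar>x $ j - q j\<bar> * L2_set (\<lambda>i. A $$ (i, j)) {..<n})" by (rule matrix_action_le)
    also have "\<dots> \<le> (\<Sum>j<n. \<bar>x $ j - q j\<bar> * CC)"
      unfolding CC_def by (intro sum_mono mult_left_mono member_le_sum) auto
    also have "\<dots> = CC * (\<Sum>j<n. \<bar>x $ j - q j\<bar>)" by (simp add: sum_distrib_left mult.commute)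
    finally show "G q \<le> G (\<lambda>j. x $ j) + (t + CC) * (\<Sum>j<n. \<bar>x $ j - q j\<bar>)"
      using 1 by (simp add: G_def algebra_simps)
  qed simp
  then show "\<exists>q\<in>{..<n} \<rightarrow>\<^sub>E \<rat>. t * L2_set q {..<n} - L2_set (\<lambda>i. \<Sum>j<n. q j * A $$ (i, j)) {..<n} < 0"
    by (simp add: G_def)
next
  assume q: "\<exists>q\<in>{..<n} \<rightarrow>\<^sub>E \<rat>. t * L2_set q {..<n} - L2_set (\<lambda>i. \<Sum>j<n. q j * A $$ (i, j)) {..<n} < 0"
  show "t < spectral_norm A"
  proof (rule ccontr)
    assume "\<not> t < spectral_norm A"
    then have "op_le {..<n} n t (\<lambda>i j. A $$ (i, j))" by (intro op_le_spectral_norm[OF A]) simp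
    then show False using q unfolding op_le_def by (auto simp: not_less[symmetric])
  qed
qed

text \<open>The event is part of the covering set in \<open>large_dimension\<close>, and
  monotonicity of the measure requires that set to be measurable.\<close>

lemma (in random_entries) spectral_norm_event:
  assumes I: "I = {..<n}" and n: "1 \<le> n" and t: "0 \<le> t"
    and A: "\<And>\<omega>. \<omega> \<in> space M \<Longrightarrow> A \<omega> \<in> carrier_mat n n" "\<And>\<omega> i k. i < n \<Longrightarrow> k < n \<Longrightarrow> Y k i \<omega> = A \<omega> $$ (i, k)"
  shows "{\<omega>\<in>space M. t < spectral_norm (A \<omega>)} \<in> events"
proof -
  have "{\<omega>\<in>space M. t < spectral_norm (A \<omega>)} =
    (\<Union>q\<in>{..<n} \<rightarrow>\<^sub>E \<rat>. {\<omega>\<in>space M. t * L2_set q {..<n} - L2_set (\<lambda>i. \<Sum>j<n. q j * A \<omega> $$ (i, j)) {..<n} < 0})"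
    using spectral_norm_gt_iff[OF A(1) n t] by auto
  moreover have "(\<lambda>\<omega>. L2_set (\<lambda>i. \<Sum>j<n. q j * A \<omega> $$ (i, j)) {..<n}) \<in> borel_measurable M" for q
  proof -
    have "(\<lambda>\<omega>. A \<omega> $$ (i, k)) \<in> borel_measurable M" if "i < n" "k < n" for i k
      using Y_measurable[of k i] that I A(2)[of i k] by (simp add: fun_eq_iff[symmetric] cong: measurable_cong)
    then show ?thesis unfolding L2_set_def
      by (intro measurable_compose[OF _ borel_measurable_sqrt] borel_measurable_sum borel_measurable_power borel_measurable_times borel_measurable_const) auto
  qed
  ultimately show ?thesis by (simp only:) (intro sets.countable_UN'' countable_rational_vectors, auto)
qed

section \<open>Determinants and small dimension\<close>

lemma sum_fourth_le:
  fixes f :: "'i \<Rightarrow> real" assumes "finite I"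
  shows "(\<Sum>i\<in>I. f i) ^ 4 \<le> real (card I) ^ 3 * (\<Sum>i\<in>I. f i ^ 4)"
proof -
  have sq: "(\<Sum>i\<in>I. g i)\<^sup>2 \<le> real (card I) * (\<Sum>i\<in>I. (g i)\<^sup>2)" for g :: "'i \<Rightarrow> real"
    using sum_squared_le_sum_of_squares[of g I] by (simp add: mult.commute)
  have "((\<Sum>i\<in>I. f i)\<^sup>2)\<^sup>2 \<le> (real (card I) * (\<Sum>i\<in>I. (f i)\<^sup>2))\<^sup>2"
    by (intro power_mono sq) simp
  also have "\<dots> = (real (card I))\<^sup>2 * (\<Sum>i\<in>I. (f i)\<^sup>2)\<^sup>2" by (simp add: power_mult_distrib)
  also have "\<dots> \<le> (real (card I))\<^sup>2 * (real (card I) * (\<Sum>i\<in>I. ((f i)\<^sup>2)\<^sup>2))"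
    by (intro mult_left_mono sq) simp
  finally show ?thesis by (simp add: power3_eq_cube power2_eq_square power4_eq_xxxx mult_ac)
qed

text \<open>The variance \<open>s j\<close> depends on the column only; this makes the product of
  variances along a permutation the same for all permutations.\<close>

locale centered_entries = prob_space M for M :: "'w measure" +
  fixes n :: nat and Z :: "nat \<Rightarrow> nat \<Rightarrow> 'w \<Rightarrow> real" and s :: "nat \<Rightarrow> real"
  assumes ind: "indep_vars (\<lambda>_. borel) (\<lambda>p. Z (fst p) (snd p)) ({..<n} \<times> {..<n})"
    and Z2: "\<And>i j. i < n \<Longrightarrow> j < n \<Longrightarrow> integrable M (\<lambda>\<omega>. (Z i j \<omega>)\<^sup>2)"
    and Z1: "\<And>i j. i < n \<Longrightarrow> j < n \<Longrightarrow> integrable M (Z i j)"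
    and mean: "\<And>i j. i < n \<Longrightarrow> j < n \<Longrightarrow> expectation (Z i j) = 0"
    and var: "\<And>i j. i < n \<Longrightarrow> j < n \<Longrightarrow> expectation (\<lambda>\<omega>. (Z i j \<omega>)\<^sup>2) = s j"
begin

definition D :: "'w \<Rightarrow> real" where "D \<omega> = Determinant.det (mat n n (\<lambda>(i, j). Z i j \<omega>))"

lemma D_eq: "D \<omega> = (\<Sum>p\<in>{p. p permutes {0..<n}}. signof p * (\<Prod>i=0..<n. Z i (p i) \<omega>))"
proof -
  have "D \<omega> = (\<Sum>p\<in>{p. p permutes {0..<n}}. signof p * (\<Prod>i=0..<n. mat n n (\<lambda>(i, j). Z i j \<omega>) $$ (i, p i)))"
    unfolding D_def by (rule det_def') simp
  also have "\<dots> = (\<Sum>p\<in>{p. p permutes {0..<n}}. signof p * (\<Prod>i=0..<n. Z i (p i) \<omega>))"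
  proof (intro sum.cong refl arg_cong2[where f = "(*)"] prod.cong)
    fix p i assume "p \<in> {p. p permutes {0..<n}}" "i \<in> {0..<n}"
    then have "p i < n" "i < n" using permutes_in_image[of p "{0..<n}" i] by auto
    then show "mat n n (\<lambda>(i, j). Z i j \<omega>) $$ (i, p i) = Z i (p i) \<omega>" by simp
  qed
  finally show ?thesis .
qed

lemma Z_measurable[measurable]: "i < n \<Longrightarrow> j < n \<Longrightarrow> Z i j \<in> borel_measurable M"
  using Z1 by blast

lemma indep_selection:
  assumes h: "\<And>i. i < n \<Longrightarrow> h i \<in> borel_measurable (borel \<Otimes>\<^sub>M borel)"
    and pq: "\<And>i. i < n \<Longrightarrow> p i < n" "\<And>i. i < n \<Longrightarrow> q i < n"
  shows "indep_vars (\<lambda>_. borel) (\<lambda>i \<omega>. h i (Z i (p i) \<omega>, Z i (q i) \<omega>)) {0..<n}"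
proof -
  have "indep_vars (\<lambda>i. PiM ({i} \<times> {..<n}) (\<lambda>_. borel)) (\<lambda>i \<omega>. restrict (\<lambda>p. Z (fst p) (snd p) \<omega>) ({i} \<times> {..<n})) {0..<n}"
    by (rule indep_vars_restrict[OF ind]) (auto simp: disjoint_family_on_def)
  then have "indep_vars (\<lambda>_. borel) (\<lambda>i \<omega>. (\<lambda>f. h i (f (i, p i), f (i, q i))) (restrict (\<lambda>p. Z (fst p) (snd p) \<omega>) ({i} \<times> {..<n}))) {0..<n}"
  proof (rule indep_vars_compose2)
    fix i assume "i \<in> {0..<n}"
    then have i: "i < n" by simp
    have "(\<lambda>f. f (i, p i)) \<in> borel_measurable (PiM ({i} \<times> {..<n}) (\<lambda>_. borel :: real measure))"
      "(\<lambda>f. f (i, q i)) \<in> borel_measurable (PiM ({i} \<times> {..<n}) (\<lambda>_. borel :: real measure))"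
      using pq[OF i] by (auto intro!: measurable_component_singleton)
    then show "(\<lambda>f. h i (f (i, p i), f (i, q i))) \<in> borel_measurable (PiM ({i} \<times> {..<n}) (\<lambda>_. borel))"
      by (intro measurable_compose[OF _ h[OF i]] measurable_Pair)
  qed
  then show ?thesis using pq by (subst (asm) indep_vars_cong[OF refl _ refl]) (auto simp: fun_eq_iff)
qed

lemma indep_entries_pair:
  assumes "i < n" "j < n" "j' < n" "j \<noteq> j'"
  shows "indep_var borel (Z i j) borel (Z i j')"
proof -
  have row: "indep_vars (\<lambda>_. borel) (Z i) {..<n}" by (rule indep_vars_row[OF ind]) (use assms in simp)
  have "indep_var borel ((\<lambda>f. f j) \<circ> (\<lambda>\<omega>. restrict (\<lambda>i'. Z i i' \<omega>) {j})) borel ((\<lambda>f. f j') \<circ> (\<lambda>\<omega>. restrict (\<lambda>i'. Z i i' \<omega>) {j'}))"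
    by (rule indep_var_compose[OF indep_var_restrict[OF row]]) (use assms in auto)
  then show ?thesis by (simp add: comp_def)
qed

lemma cross:
  assumes "i < n" "j < n" "j' < n"
  shows "integrable M (\<lambda>\<omega>. Z i j \<omega> * Z i j' \<omega>)"
    and "expectation (\<lambda>\<omega>. Z i j \<omega> * Z i j' \<omega>) = (if j = j' then s j else 0)"
proof -
  show "integrable M (\<lambda>\<omega>. Z i j \<omega> * Z i j' \<omega>)"
  proof (cases "j = j'")
    case True then show ?thesis using Z2[OF assms(1,2)] by (simp add: power2_eq_square)
  next
    case False
    show ?thesis by (rule indep_var_integrable[OF indep_entries_pair[OF assms False] Z1 Z1]) (use assms in auto)
  qed
  show "expectation (\<lambda>\<omega>. Z i j \<omega> * Z i j' \<omega>) = (if j = j' then s j else 0)"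
  proof (cases "j = j'")
    case True then show ?thesis using var[OF assms(1,2)] by (simp add: power2_eq_square)
  next
    case False
    then show ?thesis using indep_var_lebesgue_integral[OF indep_entries_pair[OF assms False] Z1 Z1] assms mean by simp
  qed
qed

text \<open>The rows are independent, and in a row where p and q differ the two entries are
  independent and centered. So the products along different permutations are orthogonal.\<close>

lemma product_terms:
  assumes p: "p permutes {0..<n}" and q: "q permutes {0..<n}"
  shows "integrable M (\<lambda>\<omega>. \<Prod>i=0..<n. Z i (p i) \<omega> * Z i (q i) \<omega>)"
    and "expectation (\<lambda>\<omega>. \<Prod>i=0..<n. Z i (p i) \<omega> * Z i (q i) \<omega>) = (if p = q then \<Prod>j=0..<n. s j else 0)"
proof -
  have pn: "p i < n" "q i < n" if "i < n" for i
    using permutes_in_image[OF p, of i] permutes_in_image[OF q, of i] that by auto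
  have ind': "indep_vars (\<lambda>_. borel) (\<lambda>i \<omega>. Z i (p i) \<omega> * Z i (q i) \<omega>) {0..<n}"
    using indep_selection[of "\<lambda>i z. fst z * snd z" p q] pn by simp
  have int: "integrable M (\<lambda>\<omega>. Z i (p i) \<omega> * Z i (q i) \<omega>)" if "i \<in> {0..<n}" for i
    using cross(1)[of i "p i" "q i"] pn that by simp
  show "integrable M (\<lambda>\<omega>. \<Prod>i=0..<n. Z i (p i) \<omega> * Z i (q i) \<omega>)"
    by (rule indep_vars_integrable[OF _ ind' int]) auto
  have "expectation (\<lambda>\<omega>. \<Prod>i=0..<n. Z i (p i) \<omega> * Z i (q i) \<omega>) = (\<Prod>i=0..<n. expectation (\<lambda>\<omega>. Z i (p i) \<omega> * Z i (q i) \<omega>))"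
    by (rule indep_vars_lebesgue_integral[OF _ ind' int]) auto
  also have "\<dots> = (\<Prod>i=0..<n. if p i = q i then s (p i) else 0)"
    by (intro prod.cong refl) (use cross(2) pn in auto)
  also have "\<dots> = (if p = q then \<Prod>j=0..<n. s j else 0)"
  proof (cases "p = q")
    case True
    then show ?thesis using prod.permute[OF p, of s] by (simp add: comp_def)
  next
    case False
    then obtain i where i: "p i \<noteq> q i" by blast
    then have "i \<in> {0..<n}" using permutes_not_in[OF p, of i] permutes_not_in[OF q, of i] by metis
    then have "(\<Prod>i=0..<n. if p i = q i then s (p i) else 0) = 0" using i by (intro prod_zero) auto
    then show ?thesis using False by simp
  qed
  finally show "expectation (\<lambda>\<omega>. \<Prod>i=0..<n. Z i (p i) \<omega> * Z i (q i) \<omega>) = (if p = q then \<Prod>j=0..<n. s j else 0)" .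
qed

lemma D_square: "integrable M (\<lambda>\<omega>. (D \<omega>)\<^sup>2)" "expectation (\<lambda>\<omega>. (D \<omega>)\<^sup>2) = fact n * (\<Prod>j<n. s j)"
proof -
  let ?P = "{p. p permutes {0..<n}}"
  have fP: "finite ?P" by (rule finite_permutations) simp
  define T where "T p q \<omega> = signof p * signof q * (\<Prod>i=0..<n. Z i (p i) \<omega> * Z i (q i) \<omega>)" for p q \<omega>
  have eq: "(D \<omega>)\<^sup>2 = (\<Sum>p\<in>?P. \<Sum>q\<in>?P. T p q \<omega>)" for \<omega>
    unfolding D_eq power2_eq_square sum_product T_def
    by (intro sum.cong refl) (simp add: prod.distrib mult_ac)
  have iT: "integrable M (T p q)" if "p \<in> ?P" "q \<in> ?P" for p q
    using product_terms(1)[of p q] that unfolding T_def[abs_def] by (intro integrable_mult_right) auto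
  have eT: "expectation (T p q) = (if p = q then \<Prod>j=0..<n. s j else 0)" if "p \<in> ?P" "q \<in> ?P" for p q
  proof -
    have "expectation (T p q) = signof p * signof q * (if p = q then \<Prod>j=0..<n. s j else 0)"
      using product_terms[of p q] that unfolding T_def[abs_def] by simp
    also have "\<dots> = (if p = q then \<Prod>j=0..<n. s j else 0)"
      by (auto simp: sign_def)
    finally show ?thesis .
  qed
  show "integrable M (\<lambda>\<omega>. (D \<omega>)\<^sup>2)" unfolding eq by (intro Bochner_Integration.integrable_sum iT)
  have "expectation (\<lambda>\<omega>. (D \<omega>)\<^sup>2) = (\<Sum>p\<in>?P. \<Sum>q\<in>?P. expectation (T p q))"
  proof -
    have "expectation (\<lambda>\<omega>. \<Sum>p\<in>?P. \<Sum>q\<in>?P. T p q \<omega>) = (\<Sum>p\<in>?P. expectation (\<lambda>\<omega>. \<Sum>q\<in>?P. T p q \<omega>))"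
      by (intro Bochner_Integration.integral_sum Bochner_Integration.integrable_sum iT)
    also have "\<dots> = (\<Sum>p\<in>?P. \<Sum>q\<in>?P. expectation (T p q))"
      by (intro sum.cong refl Bochner_Integration.integral_sum iT)
    finally show ?thesis unfolding eq .
  qed
  also have "\<dots> = (\<Sum>p\<in>?P. \<Sum>q\<in>?P. if p = q then \<Prod>j=0..<n. s j else 0)"
    by (intro sum.cong refl eT)
  also have "\<dots> = (\<Sum>p\<in>?P. \<Prod>j=0..<n. s j)" using fP by (intro sum.cong refl) (simp add: sum.delta')
  also have "\<dots> = fact n * (\<Prod>j<n. s j)" by (simp add: card_permutations[of _ n] lessThan_atLeast0)
  finally show "expectation (\<lambda>\<omega>. (D \<omega>)\<^sup>2) = fact n * (\<Prod>j<n. s j)" .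
qed

text \<open>Cauchy-Schwarz applied twice to the n! terms of the determinant costs n!^3; each term
  has fourth moment at most B^n because its factors come from different rows.\<close>

lemma D_fourth:
  assumes Z4: "\<And>i j. i < n \<Longrightarrow> j < n \<Longrightarrow> integrable M (\<lambda>\<omega>. Z i j \<omega> ^ 4)"
    and B: "\<And>i j. i < n \<Longrightarrow> j < n \<Longrightarrow> expectation (\<lambda>\<omega>. Z i j \<omega> ^ 4) \<le> B" and B0: "0 \<le> B"
  shows "integrable M (\<lambda>\<omega>. D \<omega> ^ 4)" "expectation (\<lambda>\<omega>. D \<omega> ^ 4) \<le> fact n ^ 4 * B ^ n"
proof -
  let ?P = "{p. p permutes {0..<n}}"
  have fP: "finite ?P" by (rule finite_permutations) simp
  define T where "T p \<omega> = (\<Prod>i=0..<n. Z i (p i) \<omega> ^ 4)" for p \<omega>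
  have TT: "integrable M (T p) \<and> expectation (T p) \<le> B ^ n" if "p \<in> ?P" for p
  proof -
    have pn: "p i < n" if "i < n" for i using permutes_in_image[of p "{0..<n}" i] \<open>p \<in> ?P\<close> that by auto
    have ind': "indep_vars (\<lambda>_. borel) (\<lambda>i \<omega>. Z i (p i) \<omega> ^ 4) {0..<n}"
      using indep_selection[of "\<lambda>i z. fst z ^ 4" p p] pn by simp
    have int: "integrable M (\<lambda>\<omega>. Z i (p i) \<omega> ^ 4)" if "i \<in> {0..<n}" for i using Z4[of i "p i"] pn that by simp
    have 1: "integrable M (T p)" unfolding T_def[abs_def] by (rule indep_vars_integrable[OF _ ind' int]) auto
    have "expectation (T p) = (\<Prod>i=0..<n. expectation (\<lambda>\<omega>. Z i (p i) \<omega> ^ 4))"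
      unfolding T_def[abs_def] by (rule indep_vars_lebesgue_integral[OF _ ind' int]) auto
    also have "\<dots> \<le> (\<Prod>i=0..<n. B)" by (intro prod_mono conjI Bochner_Integration.integral_nonneg B) (use pn in auto)
    finally show ?thesis using 1 by simp
  qed
  have le: "D \<omega> ^ 4 \<le> fact n ^ 3 * (\<Sum>p\<in>?P. T p \<omega>)" for \<omega>
  proof -
    have "D \<omega> ^ 4 \<le> real (card ?P) ^ 3 * (\<Sum>p\<in>?P. (signof p * (\<Prod>i=0..<n. Z i (p i) \<omega>)) ^ 4)"
      unfolding D_eq by (rule sum_fourth_le[OF fP])
    also have "(\<Sum>p\<in>?P. (signof p * (\<Prod>i=0..<n. Z i (p i) \<omega>)) ^ 4) = (\<Sum>p\<in>?P. T p \<omega>)"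
      unfolding T_def by (intro sum.cong refl) (auto simp: power_mult_distrib prod_power_distrib sign_def)
    finally show ?thesis by (simp add: card_permutations[of _ n])
  qed
  have iS: "integrable M (\<lambda>\<omega>. fact n ^ 3 * (\<Sum>p\<in>?P. T p \<omega>))"
    using TT by (intro integrable_mult_right Bochner_Integration.integrable_sum) auto
  have Dm: "D \<in> borel_measurable M"
  proof -
    have "Z i (p i) \<in> borel_measurable M" if "i \<in> {0..<n}" "p \<in> ?P" for i p
      using permutes_in_image[of p "{0..<n}" i] that by auto
    then show ?thesis unfolding D_eq[abs_def]
      by (intro borel_measurable_sum borel_measurable_times borel_measurable_const borel_measurable_prod) auto
  qed
  show i4: "integrable M (\<lambda>\<omega>. D \<omega> ^ 4)"
    by (rule Bochner_Integration.integrable_bound[OF iS]) (use Dm le in \<open>auto intro!: AE_I2 order_trans[OF _ abs_ge_self]\<close>)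
  have "expectation (\<lambda>\<omega>. D \<omega> ^ 4) \<le> expectation (\<lambda>\<omega>. fact n ^ 3 * (\<Sum>p\<in>?P. T p \<omega>))"
    by (rule integral_mono[OF i4 iS le])
  also have "\<dots> = fact n ^ 3 * (\<Sum>p\<in>?P. expectation (T p))"
    using TT by (simp add: Bochner_Integration.integral_sum)
  also have "\<dots> \<le> fact n ^ 3 * (\<Sum>p\<in>?P. B ^ n)" using TT by (intro mult_left_mono sum_mono) auto
  also have "\<dots> = fact n ^ 4 * B ^ n" by (simp add: card_permutations[of _ n] power4_eq_xxxx power3_eq_cube)
  finally show "expectation (\<lambda>\<omega>. D \<omega> ^ 4) \<le> fact n ^ 4 * B ^ n" .
qed

end

text \<open>Enumerates the indices other than i in increasing order, as \<open>mat_delete\<close>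
  does; its injectivity lets a minor inherit the independence of the entries.\<close>

definition skip :: "nat \<Rightarrow> nat \<Rightarrow> nat" where "skip i k = (if k < i then k else Suc k)"

lemma skip_lt: "k < n - 1 \<Longrightarrow> skip i k < n" by (auto simp: skip_def)

lemma skip_inj: "inj (skip i)" by (auto simp: skip_def inj_def split: if_splits)

text \<open>Cramer's rule without the inverse: d x_k is the pairing of the cofactors of column k
  with the image y of x. Cauchy-Schwarz and summation over k give d^2 \<le> (sum of squared minors)
  |y|^2; this is the bound of the operator norm of the inverse by its Hilbert-Schmidt norm.\<close>

lemma norm_lower_bound_of_minors:
  fixes a :: "nat \<Rightarrow> nat \<Rightarrow> real"
  assumes n: "1 \<le> n" and d: "d = Determinant.det (mat n n (\<lambda>(i, j). a i j))"
    and m: "\<And>i j. i < n \<Longrightarrow> j < n \<Longrightarrow> mm i j = Determinant.det (mat (n - 1) (n - 1) (\<lambda>(i', j'). a (skip i i') (skip j j')))"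
    and lt: "(\<Sum>i<n. \<Sum>j<n. (mm i j)\<^sup>2) < c * d\<^sup>2" and x: "L2_set x {..<n} = 1"
  shows "1 < c * (L2_set (\<lambda>i. \<Sum>j<n. x j * a i j) {..<n})\<^sup>2"
proof -
  define A where "A = mat n n (\<lambda>(i, j). a i j)"
  have A: "A \<in> carrier_mat n n" by (simp add: A_def)
  define y where "y i = (\<Sum>j<n. x j * a i j)" for i
  have cof: "(cofactor A i j)\<^sup>2 = (mm i j)\<^sup>2" if "i < n" "j < n" for i j
  proof -
    have "mat_delete A i j = mat (n - 1) (n - 1) (\<lambda>(i', j'). a (skip i i') (skip j j'))"
      unfolding mat_delete_def using skip_lt[of _ n] by (intro eq_matI) (auto simp: A_def skip_def)
    moreover have "((- 1 :: real) ^ k)\<^sup>2 = 1" for k by (simp flip: power_mult)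
    ultimately show ?thesis using m[OF that] by (simp add: cofactor_def power_mult_distrib)
  qed
  have xd: "x k * d = (\<Sum>i<n. cofactor A i k * y i)" if k: "k < n" for k
  proof -
    have "adj_mat A * A = d \<cdot>\<^sub>m 1\<^sub>m n" using adj_mat(3)[OF A] by (simp add: d A_def)
    then have e: "(\<Sum>i<n. cofactor A i k * a i j) = (if j = k then d else 0)" if "j < n" for j
    proof -
      have "(adj_mat A * A) $$ (k, j) = (\<Sum>i<n. cofactor A i k * a i j)"
        using k that A by (simp add: adj_mat_def scalar_prod_def A_def lessThan_atLeast0)
      moreover have "(d \<cdot>\<^sub>m 1\<^sub>m n) $$ (k, j) = (if j = k then d else 0)" using k that by auto
      ultimately show ?thesis using \<open>adj_mat A * A = d \<cdot>\<^sub>m 1\<^sub>m n\<close> by simp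
    qed
    have "(\<Sum>i<n. cofactor A i k * y i) = (\<Sum>j<n. x j * (\<Sum>i<n. cofactor A i k * a i j))"
      unfolding y_def sum_distrib_left by (subst sum.swap) (simp add: mult_ac)
    also have "\<dots> = (\<Sum>j<n. if j = k then x j * d else 0)" by (intro sum.cong refl) (auto simp: e)
    also have "\<dots> = x k * d" using k by simp
    finally show ?thesis by simp
  qed
  define Y where "Y = (L2_set y {..<n})\<^sup>2"
  have Y: "Y = (\<Sum>i<n. (y i)\<^sup>2)" by (simp add: Y_def L2_set_def sum_nonneg)
  have x2: "(\<Sum>k<n. (x k)\<^sup>2) = 1" using x by (simp add: L2_set_def)
  have "d\<^sup>2 = (\<Sum>k<n. (x k * d)\<^sup>2)" by (simp add: power_mult_distrib x2 flip: sum_distrib_right)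
  also have "\<dots> \<le> (\<Sum>k<n. (\<Sum>i<n. (mm i k)\<^sup>2) * Y)"
  proof (rule sum_mono)
    fix k assume "k \<in> {..<n}"
    then have k: "k < n" by simp
    have "(x k * d)\<^sup>2 \<le> (\<Sum>i<n. (cofactor A i k)\<^sup>2) * (\<Sum>i<n. (y i)\<^sup>2)"
      unfolding xd[OF k] by (rule Cauchy_Schwarz_ineq_sum)
    then show "(x k * d)\<^sup>2 \<le> (\<Sum>i<n. (mm i k)\<^sup>2) * Y" using k by (simp add: Y cof)
  qed
  also have "\<dots> = (\<Sum>i<n. \<Sum>j<n. (mm i j)\<^sup>2) * Y"
    by (subst sum.swap) (simp add: sum_distrib_right)
  finally have le: "d\<^sup>2 \<le> (\<Sum>i<n. \<Sum>j<n. (mm i j)\<^sup>2) * Y" .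
  have s0: "0 \<le> (\<Sum>i<n. \<Sum>j<n. (mm i j)\<^sup>2)" by (intro sum_nonneg) simp
  then have cd: "0 < c * d\<^sup>2" using lt by linarith
  then have d0: "0 < d\<^sup>2" by (cases "d = 0") auto
  have "Y \<noteq> 0" using le d0 by auto
  then have Y0: "0 < Y" by (simp add: Y_def less_le)
  have "d\<^sup>2 < c * d\<^sup>2 * Y" using le mult_strict_right_mono[OF lt Y0] by linarith
  then have "d\<^sup>2 * 1 < d\<^sup>2 * (c * Y)" by (simp add: mult_ac)
  then have "1 < c * Y" using d0 by (simp only: mult_less_cancel_left_pos)
  then show ?thesis by (simp add: Y_def y_def[abs_def])
qed

text \<open>Each minor omits a column whose variance is at least 1, so with d the determinant the
  sum of the squared minors has mean at most n E d^2, and its difference H from 2 n d^2 has mean at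
  least n E d^2 \<ge> 1. Since H \<le> 2 n d^2, the fourth moment of d prevents H from being
  positive only on a tiny event.\<close>

lemma (in prob_space) small_dimension:
  assumes rows: "rows_indep_copies n \<xi> A" and adm: "admissible_variables n B \<xi>" and n: "1 \<le> n"
  shows "\<exists>E\<in>events. 1 / (4 * (real n)\<^sup>2 * (fact n ^ 4 * B ^ n)) \<le> prob E \<and>
    (\<forall>\<omega>\<in>E. \<forall>x. L2_set x {..<n} = 1 \<longrightarrow> 1 < 2 * real n * (L2_set (\<lambda>i. \<Sum>j<n. x j * A \<omega> $$ (i, j)) {..<n})\<^sup>2)"
proof -
  define Z where "Z i j \<omega> = A \<omega> $$ (i, j)" for i j \<omega>
  define s where "s j = expectation (\<lambda>\<omega>. (\<xi> j \<omega>)\<^sup>2)" for j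
  have mm: "moment_measure (distr M borel (Z i j)) B" and law: "distr M borel (Z i j) = distr M borel (\<xi> j)"
    and Zm: "random_variable borel (Z i j)" and xm: "random_variable borel (\<xi> j)" if "i < n" "j < n" for i j
  proof -
    interpret C: random_entries M "{..<n}" n "\<lambda>k i \<omega>. A \<omega> $$ (i, k)" B
      by (rule random_entries_columns[OF rows adm n])
    show "moment_measure (distr M borel (Z i j)) B" using C.moment[of j i] that by (simp add: Z_def[abs_def])
    show "distr M borel (Z i j) = distr M borel (\<xi> j)"
      using entries_indep(1)[OF rows adm n that] by (simp add: Z_def[abs_def])
    show "random_variable borel (Z i j)" using C.Y_measurable[of j i] that by (simp add: Z_def[abs_def])
    show "random_variable borel (\<xi> j)" using adm that by (auto simp: admissible_variables_def indep_vars_def)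
  qed
  have B1: "1 \<le> B" using moment_measure.B_ge_1[OF mm[of 0 0]] n by simp
  have Zpow: "integrable M (\<lambda>\<omega>. Z i j \<omega> ^ k)" if "i < n" "j < n" "k \<le> 4" for i j k
    using moment_measure.integrable_pow[OF mm[OF that(1,2)] that(3)] Zm[OF that(1,2)]
    by (simp add: integrable_distr_eq)
  have Zpow1: "integrable M (Z i j)" and Zpow2: "integrable M (\<lambda>\<omega>. (Z i j \<omega>)\<^sup>2)"
    and Zpow4: "integrable M (\<lambda>\<omega>. Z i j \<omega> ^ 4)" if "i < n" "j < n" for i j
    using Zpow[OF that, of 1] Zpow[OF that, of 2] Zpow[OF that, of 4] by simp_all
  have Zmean: "expectation (Z i j) = 0" if "i < n" "j < n" for i j
    using moment_measure.mean[OF mm[OF that]] Zm[OF that] by (simp add: integral_distr)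
  have Z4: "expectation (\<lambda>\<omega>. Z i j \<omega> ^ 4) \<le> B" if "i < n" "j < n" for i j
    using moment_measure.fourth[OF mm[OF that]] Zm[OF that] by (simp add: integral_distr)
  have Zs: "expectation (\<lambda>\<omega>. (Z i j \<omega>)\<^sup>2) = s j" if "i < n" "j < n" for i j
  proof -
    have "expectation (\<lambda>\<omega>. (Z i j \<omega>)\<^sup>2) = (\<integral>x. x\<^sup>2 \<partial>distr M borel (Z i j))" using Zm[OF that] by (simp add: integral_distr)
    also have "\<dots> = s j" unfolding law[OF that] s_def using xm[OF that] by (simp add: integral_distr)
    finally show ?thesis .
  qed
  have s1: "1 \<le> s j" if "j < n" for j
    using moment_measure.var_ge[OF mm[of 0 j]] Zs[of 0 j] Zm[of 0 j] that n by (simp add: integral_distr)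
  have indZ: "indep_vars (\<lambda>_. borel) (\<lambda>p. Z (fst p) (snd p)) ({..<n} \<times> {..<n})"
    using entries_indep(2)[OF rows adm n] by (simp add: Z_def[abs_def])
  interpret D: centered_entries M n Z s
    using indZ Zpow2 Zpow1 Zmean Zs by unfold_locales auto
  define d where "d = D.D"
  define m where "m i j \<omega> = Determinant.det (mat (n - 1) (n - 1) (\<lambda>(i', j'). Z (skip i i') (skip j j') \<omega>))" for i j \<omega>
  define S where "S = (\<Prod>j<n. s j)"
  have S1: "1 \<le> S" unfolding S_def by (intro prod_ge_1) (use s1 in auto)
  have minor: "integrable M (\<lambda>\<omega>. (m i j \<omega>)\<^sup>2)" "expectation (\<lambda>\<omega>. (m i j \<omega>)\<^sup>2) \<le> fact (n - 1) * S" if ij: "i < n" "j < n" for i j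
  proof -
    define g where "g p = (skip i (fst p), skip j (snd p))" for p
    have g: "inj_on g ({..<n - 1} \<times> {..<n - 1})" "g ` ({..<n - 1} \<times> {..<n - 1}) \<subseteq> {..<n} \<times> {..<n}"
      by (auto simp: inj_on_def g_def dest: injD[OF skip_inj] intro!: skip_lt)
    have "indep_vars (\<lambda>_. borel) (\<lambda>p. Z (skip i (fst p)) (skip j (snd p))) ({..<n - 1} \<times> {..<n - 1})"
      using indep_vars_reindex_inj[OF indZ g] by (simp add: g_def)
    then interpret m: centered_entries M "n - 1" "\<lambda>i' j'. Z (skip i i') (skip j j')" "\<lambda>j'. s (skip j j')"
      using Zpow2 Zpow1 Zmean Zs skip_lt[of _ n] by unfold_locales auto
    have mD: "m.D = m i j" by (rule ext) (simp only: m.D_def m_def)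
    show "integrable M (\<lambda>\<omega>. (m i j \<omega>)\<^sup>2)" using m.D_square(1) unfolding mD .
    have "(\<Prod>j'<n - 1. s (skip j j')) = (\<Prod>j'\<in>skip j ` {..<n - 1}. s j')"
      using skip_inj[of j] by (subst prod.reindex) (auto simp: inj_on_def inj_def)
    also have "\<dots> \<le> S" unfolding S_def
    proof (rule prod_mono2)
      show "skip j ` {..<n - 1} \<subseteq> {..<n}" using skip_lt[of _ n] by auto
      show "1 \<le> s b" if "b \<in> {..<n} - skip j ` {..<n - 1}" for b using that s1 by auto
      show "0 \<le> s a" if "a \<in> skip j ` {..<n - 1}" for a
        using that s1 skip_lt[of _ n] by (auto intro: order_trans[OF zero_le_one])
    qed simp
    finally show "expectation (\<lambda>\<omega>. (m i j \<omega>)\<^sup>2) \<le> fact (n - 1) * S" using m.D_square(2) unfolding mD by simp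
  qed
  define H where "H \<omega> = 2 * real n * (d \<omega>)\<^sup>2 - (\<Sum>i<n. \<Sum>j<n. (m i j \<omega>)\<^sup>2)" for \<omega>
  have id2: "integrable M (\<lambda>\<omega>. (d \<omega>)\<^sup>2)" and ed2: "expectation (\<lambda>\<omega>. (d \<omega>)\<^sup>2) = fact n * S"
    using D.D_square by (auto simp: d_def S_def)
  have imm: "integrable M (\<lambda>\<omega>. \<Sum>i<n. \<Sum>j<n. (m i j \<omega>)\<^sup>2)"
    by (intro Bochner_Integration.integrable_sum minor(1)) auto
  have iH: "integrable M H" unfolding H_def[abs_def]
    by (intro Bochner_Integration.integrable_diff integrable_mult_right id2 imm)
  have fn: "(fact n :: real) = real n * fact (n - 1)" using n fact_reduce[of n] by simp
  have "expectation (\<lambda>\<omega>. \<Sum>i<n. \<Sum>j<n. (m i j \<omega>)\<^sup>2) = (\<Sum>i<n. \<Sum>j<n. expectation (\<lambda>\<omega>. (m i j \<omega>)\<^sup>2))"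
  proof -
    have "expectation (\<lambda>\<omega>. \<Sum>i<n. \<Sum>j<n. (m i j \<omega>)\<^sup>2) = (\<Sum>i<n. expectation (\<lambda>\<omega>. \<Sum>j<n. (m i j \<omega>)\<^sup>2))"
      by (intro Bochner_Integration.integral_sum Bochner_Integration.integrable_sum minor(1)) auto
    also have "\<dots> = (\<Sum>i<n. \<Sum>j<n. expectation (\<lambda>\<omega>. (m i j \<omega>)\<^sup>2))"
      by (intro sum.cong refl Bochner_Integration.integral_sum minor(1)) auto
    finally show ?thesis .
  qed
  also have "\<dots> \<le> (\<Sum>i<n. \<Sum>j<n. fact (n - 1) * S)" by (intro sum_mono minor(2)) auto
  also have "\<dots> = n * (fact n * S)" by (simp add: fn mult_ac)
  finally have emm: "expectation (\<lambda>\<omega>. \<Sum>i<n. \<Sum>j<n. (m i j \<omega>)\<^sup>2) \<le> n * (fact n * S)" .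
  have "expectation H = 2 * (n * (fact n * S)) - expectation (\<lambda>\<omega>. \<Sum>i<n. \<Sum>j<n. (m i j \<omega>)\<^sup>2)"
    unfolding H_def[abs_def] using id2 imm by (simp add: ed2 mult.assoc)
  then have "n * (fact n * S) \<le> expectation H" using emm by linarith
  moreover have "1 * (1 * 1) \<le> n * (fact n * S)" using n S1 by (intro mult_mono) auto
  ultimately have eH: "1 \<le> expectation H" by linarith
  define M4 where "M4 = fact n ^ 4 * B ^ n"
  have d4: "integrable M (\<lambda>\<omega>. d \<omega> ^ 4)" "expectation (\<lambda>\<omega>. d \<omega> ^ 4) \<le> M4"
    using D.D_fourth[of B] Zpow4 Z4 B1 by (auto simp: d_def M4_def)
  have M4: "0 < M4" using B1 by (simp add: M4_def)
  define G where "G = {\<omega>\<in>space M. 0 < H \<omega>}"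
  have G: "G \<in> events" unfolding G_def using iH by measurable
  \<comment> \<open>The weight in AM-GM for d^2 on G: with this l the fourth moment contributes at
    most 1 / 2, while the mean of H is at least 1, so the other half must come from the probability
    of G.\<close>
  define l where "l = 1 / (2 * n * M4)"
  have l: "0 < l" using M4 n by (simp add: l_def)
  have iG: "integrable M (indicator G :: _ \<Rightarrow> real)" using G by (simp add: integrable_real_indicator emeasure_eq_measure)
  have "expectation H \<le> expectation (\<lambda>\<omega>. n * l * d \<omega> ^ 4 + n / l * indicator G \<omega>)"
  proof (rule integral_mono_AE[OF iH])
    show "integrable M (\<lambda>\<omega>. n * l * d \<omega> ^ 4 + n / l * indicator G \<omega>)"
      by (intro Bochner_Integration.integrable_add integrable_mult_right d4 iG)
    show "AE \<omega> in M. H \<omega> \<le> n * l * d \<omega> ^ 4 + n / l * indicator G \<omega>"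
    proof (rule AE_I2)
      fix \<omega> assume w: "\<omega> \<in> space M"
      show "H \<omega> \<le> n * l * d \<omega> ^ 4 + n / l * indicator G \<omega>"
      proof (cases "\<omega> \<in> G")
        case True
        have "0 \<le> (sqrt l * (d \<omega>)\<^sup>2 - 1 / sqrt l)\<^sup>2" by simp
        also have "\<dots> = l * d \<omega> ^ 4 - 2 * (d \<omega>)\<^sup>2 + 1 / l"
          using l by (simp add: power2_diff power_mult_distrib power_divide flip: power_mult)
        finally have "n * (2 * (d \<omega>)\<^sup>2) \<le> n * (l * d \<omega> ^ 4 + 1 / l)" by (intro mult_left_mono) auto
        moreover have "H \<omega> \<le> n * (2 * (d \<omega>)\<^sup>2)" unfolding H_def by (simp add: sum_nonneg)
        ultimately show ?thesis using True by (simp add: distrib_left mult.assoc)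
      next
        case False
        then have "H \<omega> \<le> 0" using w by (simp add: G_def)
        also have "0 \<le> n * l * d \<omega> ^ 4" using l by simp
        finally show ?thesis using False by simp
      qed
    qed
  qed
  also have "\<dots> = n * l * expectation (\<lambda>\<omega>. d \<omega> ^ 4) + n / l * prob G" using d4 iG G by simp
  also have "\<dots> \<le> n * l * M4 + n / l * prob G" using d4 l by (intro add_right_mono mult_left_mono) auto
  also have "n * l * M4 = 1 / 2" using n M4 by (simp add: l_def)
  also have "n / l = 2 * (real n)\<^sup>2 * M4" by (simp add: l_def power2_eq_square)
  finally have "1 / 2 \<le> 2 * (real n)\<^sup>2 * M4 * prob G" using eH by simp
  then have "1 \<le> prob G * (4 * (real n)\<^sup>2 * M4)" by (simp add: mult_ac)
  then have hG: "1 / (4 * (real n)\<^sup>2 * M4) \<le> prob G" using n M4 by (subst pos_divide_le_eq) auto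
  have hx: "1 < 2 * real n * (L2_set (\<lambda>i. \<Sum>j<n. x j * A \<omega> $$ (i, j)) {..<n})\<^sup>2"
    if "\<omega> \<in> G" and x: "L2_set x {..<n} = 1" for \<omega> x
  proof -
    have "(\<Sum>i<n. \<Sum>j<n. (m i j \<omega>)\<^sup>2) < (2 * real n) * (d \<omega>)\<^sup>2" using that(1) by (simp add: G_def H_def)
    from norm_lower_bound_of_minors[OF n _ _ this x, of "\<lambda>i j. Z i j \<omega>"]
    show ?thesis by (simp add: d_def D.D_def m_def Z_def)
  qed
  show ?thesis unfolding M4_def[symmetric]
    by (rule bexI[OF _ G], intro conjI ballI allI impI, rule hG, rule hx)
qed

section \<open>Assembly of the bounds for large and for small dimensions\<close>

context rv_constants
begin

text \<open>\<open>rate\<close> is the coefficient of e in \<open>invertibility\<close>, namely 64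
  (2 / \<rho>) / (\<gamma> b) divided by \<delta>. In \<open>threshold\<close> the first two
  summands are the demands of \<open>normal_lcd\<close>; the third lets
  \<open>exponential_decay\<close> absorb its constant.\<close>

definition "rate = 128 / (\<delta> * \<rho> * (\<gamma> * b))"
definition "threshold = 768 / lam + 1 / \<mu>\<^sup>2 + 38 / (\<gamma> * b * \<delta> * \<eta>)"

lemma gb_bounds: "0 < \<gamma> * b" "\<gamma> * b \<le> 1"
  using gam_bounds b_bounds by (auto intro: mult_le_one)

lemma rate_bounds: "0 < rate" "1 / rate \<le> \<rho>" "2 \<le> rate"
proof -
  have d1: "\<delta> \<le> 1" "\<rho> \<le> 1" using delta_bounds rho_bounds p0_bounds by auto
  have "\<delta> * (\<gamma> * b) \<le> 1" using mult_le_one[of \<delta> "\<gamma> * b"] d1 gb_bounds by simp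
  then have le: "\<rho> * (\<delta> * (\<gamma> * b)) \<le> \<rho> * 1" using rho_bounds by (intro mult_left_mono) auto
  show r0: "0 < rate" using delta_bounds rho_bounds gb_bounds by (simp add: rate_def)
  have inv: "1 / rate = \<rho> * (\<delta> * (\<gamma> * b)) / 128" by (simp add: rate_def mult_ac)
  have "1 / rate \<le> \<rho> * 1 / 128" unfolding inv by (rule divide_right_mono[OF le]) simp
  then show "1 / rate \<le> \<rho>" using rho_bounds by simp
  then have "1 / rate \<le> 1 / 2" using rho_bounds p0_bounds by linarith
  then show "2 \<le> rate" using r0 by (simp add: field_simps)
qed

text \<open>All exponentials are at most x = exp (- \<eta> n), and with g = \<gamma> b \<delta>
  their coefficients are at most 1 / g, 16 / g and 2 / g. Beyond the threshold 19 / g \<le> \<eta> n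
  / 2, so half of the decay pays for the constant; the other half leaves a base whose distance
  \<eta> / 4 from 1 is of polynomial size.\<close>

lemma exponential_decay:
  assumes n: "threshold \<le> n"
  shows "exp (- p0 / 8 * n) + (16 * exp (- \<eta> * n) / (\<gamma> * b) + (exp (- p0 / 8 * n) + exp (- real n / 2))) / \<delta>
    \<le> (1 - \<eta> / 4) ^ n"
proof -
  define x where "x = exp (- \<eta> * n)"
  define g where "g = \<gamma> * b * \<delta>"
  have pos: "0 < \<delta>" "\<delta> \<le> 1" "0 < \<gamma> * b" "\<gamma> * b \<le> 1" "0 < g" "0 \<le> x" "0 < \<eta>"
    using delta_bounds rho_bounds p0_bounds gb_bounds eta_bounds by (auto simp: g_def x_def)
  have e1: "exp (- p0 / 8 * n) \<le> x"
    using mult_right_mono[OF eta_bounds(3), of "real n"] by (simp add: x_def)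
  have e2: "exp (- real n / 2) \<le> x"
    using mult_right_mono[OF eta_bounds(2), of "real n"] by (simp add: x_def)
  have g1: "g \<le> \<delta>" using pos by (simp add: g_def mult_left_le_one_le)
  then have "x / \<delta> \<le> x / g" using pos by (intro divide_left_mono) auto
  moreover have "x \<le> x / g"
  proof -
    have "x / 1 \<le> x / g" using pos g1 by (intro divide_left_mono) auto
    then show ?thesis by simp
  qed
  moreover have "(16 * x / (\<gamma> * b) + (exp (- p0 / 8 * n) + exp (- real n / 2))) / \<delta> \<le> (16 * x / (\<gamma> * b) + (x + x)) / \<delta>"
    using e1 e2 pos by (intro divide_right_mono add_left_mono add_mono) auto
  moreover have "(16 * x / (\<gamma> * b) + (x + x)) / \<delta> = 16 * (x / g) + 2 * (x / \<delta>)"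
    using pos by (simp add: g_def field_simps)
  ultimately have "exp (- p0 / 8 * n) + (16 * x / (\<gamma> * b) + (exp (- p0 / 8 * n) + exp (- real n / 2))) / \<delta> \<le> 19 / g * x"
    using e1 by simp
  also have "19 / g \<le> exp (\<eta> * n / 2)"
  proof -
    have "38 / (g * \<eta>) \<le> threshold" using lam_bounds mu_bounds by (simp add: threshold_def g_def)
    then have "38 / (g * \<eta>) * (\<eta> / 2) \<le> real n * (\<eta> / 2)" using n pos by (intro mult_right_mono) auto
    also have "38 / (g * \<eta>) * (\<eta> / 2) = 19 / g" using pos by simp
    also have "real n * (\<eta> / 2) \<le> exp (\<eta> * n / 2)"
    proof -
      have "real n * (\<eta> / 2) = \<eta> * n / 2" by simp
      then show ?thesis using exp_ge_add_one_self[of "\<eta> * n / 2"] by linarith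
    qed
    finally show ?thesis .
  qed
  also have "exp (\<eta> * n / 2) * x = exp (- (\<eta> / 2)) ^ n"
    by (simp add: x_def flip: exp_add exp_of_nat_mult)
  also have "\<dots> \<le> (1 - \<eta> / 4) ^ n"
  proof (rule power_mono)
    define u where "u = \<eta> / 2"
    have u: "0 < u" "u \<le> 1" using eta_bounds by (auto simp: u_def)
    have "exp (- u) = 1 / exp u" by (simp add: exp_minus inverse_eq_divide)
    also have "\<dots> \<le> 1 / (1 + u)" using u exp_ge_add_one_self[of u] by (intro divide_left_mono) auto
    also have "\<dots> \<le> 1 - u / 2"
    proof -
      have "u * u \<le> u * 1" using u by (intro mult_left_mono) auto
      then have "1 \<le> (1 - u / 2) * (1 + u)" by (simp add: algebra_simps)
      then show ?thesis using u by (subst pos_divide_le_eq) auto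
    qed
    finally show "exp (- (\<eta> / 2)) \<le> 1 - \<eta> / 4" by (simp add: u_def)
  qed simp
  finally show ?thesis using pos by (simp add: x_def mult_right_mono)
qed

end

text \<open>For \<epsilon> \<ge> 1 / rate the bound is at least 1. Otherwise the estimate is applied
  to e slightly above \<epsilon>, which supplies the positivity and the strict comparison that are
  required, and e tends to \<epsilon>. The restriction e < 1 / rate \<le> \<rho> ensures e \<le>
  \<rho> K n.\<close>

lemma (in prob_space) large_dimension:
  assumes c: "rv_constants B K p0 b \<rho> \<delta> lam \<gamma> \<mu> \<eta>"
    and rows: "rows_indep_copies n \<xi> A" and adm: "admissible_variables n B \<xi>" and n: "1 \<le> n"
    and thr: "rv_constants.threshold b \<delta> lam \<gamma> \<mu> \<eta> \<le> n" and eps: "0 \<le> \<epsilon>"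
  shows "measure M {\<omega> \<in> space M. smallest_singular_value (A \<omega>) \<le> \<epsilon> / sqrt n}
    \<le> rv_constants.rate b \<rho> \<delta> \<gamma> * \<epsilon> + (1 - \<eta> / 4) ^ n + measure M {\<omega> \<in> space M. K * sqrt n < spectral_norm (A \<omega>)}"
proof -
  interpret rv_constants B K p0 b \<rho> \<delta> lam \<gamma> \<mu> \<eta> by fact
  interpret Y: random_entries M "{..<n}" n "\<lambda>k i \<omega>. A \<omega> $$ (i, k)" B
    by (rule random_entries_columns[OF rows adm n])
  have A: "A \<omega> \<in> carrier_mat n n" if "\<omega> \<in> space M" for \<omega> using rows that by (simp add: rows_indep_copies_def)
  define U where "U = {\<omega> \<in> space M. smallest_singular_value (A \<omega>) \<le> \<epsilon> / sqrt n}"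
  define V where "V = {\<omega> \<in> space M. K * sqrt n < spectral_norm (A \<omega>)}"
  have V: "V \<in> events" unfolding V_def by (rule Y.spectral_norm_event[OF refl n _ A]) (use K in auto)
  have eta4: "0 \<le> (1 - \<eta> / 4) ^ n" using eta_bounds by simp
  have "prob U \<le> rate * \<epsilon> + (1 - \<eta> / 4) ^ n + prob V"
  proof (cases "1 / rate \<le> \<epsilon>")
    case True
    then have "1 \<le> rate * \<epsilon>" using rate_bounds by (simp add: field_simps)
    moreover have "prob U \<le> 1" by simp
    moreover have "0 \<le> prob V" by simp
    ultimately show ?thesis using eta4 by linarith
  next
    case False
    then have e1: "\<epsilon> < 1 / rate" by simp
    have bound: "prob U \<le> rate * e + (1 - \<eta> / 4) ^ n + prob V" if e: "\<epsilon> < e" "e < 1 / rate" for e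
    proof -
      have e0: "0 < e" using e eps by linarith
      have "\<rho> * 1 \<le> \<rho> * (K * n)" using K n rho_bounds mult_mono[of 1 K 1 "real n"] by (intro mult_left_mono) auto
      then have erho: "e \<le> \<rho> * K * n" using e rate_bounds by (simp add: mult.assoc)
      have t1: "0 \<le> 768 / lam" "0 \<le> 1 / \<mu>\<^sup>2" "0 \<le> 38 / (\<gamma> * b * \<delta> * \<eta>)"
        using lam_bounds gb_bounds delta_bounds eta_bounds by auto
      have n1: "768 / lam \<le> n" and n2: "1 / \<mu>\<^sup>2 \<le> n" using thr t1 unfolding threshold_def by linarith+
      have iid: "distr M borel (\<lambda>\<omega>. A \<omega> $$ (j, i)) = distr M borel (\<xi> i)" if "i \<in> {..<n}" "j < n" for i j
        using entries_indep(1)[OF rows adm n, of j i] that by simp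
      obtain E where E: "E \<in> events"
        "prob E \<le> exp (- p0 / 8 * n) + ((64 * (2 * e / \<rho>) + 16 * exp (- \<eta> * n)) / (\<gamma> * b) + (exp (- p0 / 8 * n) + exp (- real n / 2))) / \<delta>"
        "\<And>\<omega> x. \<omega> \<in> space M - E \<Longrightarrow> op_le {..<n} n (K * sqrt n) (\<lambda>k i. A \<omega> $$ (i, k)) \<Longrightarrow>
           L2_set x {..<n} = 1 \<Longrightarrow> e / sqrt n < L2_set (\<lambda>i. \<Sum>j<n. x j * A \<omega> $$ (i, j)) {..<n}"
        using Y.invertibility[OF c n1 n2 refl iid e0 erho] by auto
      have "U \<subseteq> E \<union> V"
      proof
        fix \<omega> assume w: "\<omega> \<in> U"
        show "\<omega> \<in> E \<union> V"
        proof (rule ccontr)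
          assume nw: "\<omega> \<notin> E \<union> V"
          have ws: "\<omega> \<in> space M" using w by (simp add: U_def)
          have "spectral_norm (A \<omega>) \<le> K * sqrt n" using nw ws by (simp add: V_def not_less)
          from op_le_spectral_norm[OF A[OF ws] this]
          have op: "op_le {..<n} n (K * sqrt n) (\<lambda>k i. A \<omega> $$ (i, k))"
            using op_le_transpose[of n "K * sqrt n" "\<lambda>i j. A \<omega> $$ (i, j)"] K by simp
          have "\<epsilon> / sqrt n < e / sqrt n" using e n by (intro divide_strict_right_mono) auto
          then have "smallest_singular_value (A \<omega>) < e / sqrt n" using w unfolding U_def by auto
          then obtain x where x: "L2_set x {..<n} = 1" "L2_set (\<lambda>i. \<Sum>j<n. x j * A \<omega> $$ (i, j)) {..<n} < e / sqrt n"
            using smallest_singular_value_less[OF A[OF ws] n] by blast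
          from E(3)[OF _ op x(1)] x(2) nw ws show False by auto
        qed
      qed
      then have "prob U \<le> prob (E \<union> V)" using E V by (intro finite_measure_mono) auto
      also have "\<dots> \<le> prob E + prob V" by (rule measure_Un_le[OF E(1) V])
      finally have "prob U \<le> prob E + prob V" .
      moreover have "(64 * (2 * e / \<rho>) + 16 * exp (- \<eta> * n)) / (\<gamma> * b) + (exp (- p0 / 8 * n) + exp (- real n / 2))
          = 128 * e / (\<rho> * (\<gamma> * b)) + (16 * exp (- \<eta> * n) / (\<gamma> * b) + (exp (- p0 / 8 * n) + exp (- real n / 2)))"
        by (simp add: add_divide_distrib)
      moreover have "128 * e / (\<rho> * (\<gamma> * b)) / \<delta> = rate * e" by (simp add: rate_def mult_ac)
      ultimately show ?thesis using E(2) exponential_decay[OF thr] by (simp only: add_divide_distrib)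
    qed
    show ?thesis
    proof (rule field_le_epsilon)
      fix h :: real assume h: "0 < h"
      define e where "e = min ((\<epsilon> + 1 / rate) / 2) (\<epsilon> + h / rate)"
      have mid: "x < (x + y) / 2 \<and> (x + y) / 2 < y" if "x < y" for x y :: real using that by (simp add: field_simps)
      have "0 < h / rate" using h rate_bounds by simp
      then have h': "\<epsilon> < \<epsilon> + h / rate" by simp
      have mid1: "\<epsilon> < (\<epsilon> + 1 / rate) / 2" and mid2: "(\<epsilon> + 1 / rate) / 2 < 1 / rate" using mid[OF e1] by blast+
      have e: "\<epsilon> < e" "e < 1 / rate"
        unfolding e_def min_less_iff_conj by (rule conjI[OF mid1 h']) (rule min.strict_coboundedI1[OF mid2])
      have "rate * e \<le> rate * (\<epsilon> + h / rate)" using rate_bounds by (intro mult_left_mono) (auto simp: e_def)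
      also have "\<dots> = rate * \<epsilon> + h" using rate_bounds by (simp add: distrib_left)
      finally show "prob U \<le> rate * \<epsilon> + (1 - \<eta> / 4) ^ n + prob V + h" using bound[OF e] by linarith
    qed
  qed
  then show ?thesis by (simp add: U_def V_def)
qed

text \<open>The probability in \<open>small_dimension\<close> has a lower bound g n that decreases
  in n, so \<open>g N\<close> serves all n \<le> N, and Bernoulli's inequality gives c^n \<ge> 1 - g
  N; the division by N in the condition on c pays for the exponent. The event used there keeps every
  image of a unit vector above 1 / \<surd>(2 n), which settles \<epsilon> < 1 / 2; for larger
  \<epsilon> already C \<epsilon> \<ge> 1.\<close>

lemma (in prob_space) moderate_dimension:
  assumes rows: "rows_indep_copies n \<xi> A" and adm: "admissible_variables n B \<xi>" and n: "1 \<le> n" "n \<le> N"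
    and eps: "0 \<le> \<epsilon>" and C: "2 \<le> C" and c: "1 - 1 / (4 * (real N)\<^sup>2 * (fact N ^ 4 * B ^ N)) / N \<le> c" "c < 1"
  shows "measure M {\<omega> \<in> space M. smallest_singular_value (A \<omega>) \<le> \<epsilon> / sqrt n} \<le> C * \<epsilon> + c ^ n"
proof -
  define U where "U = {\<omega> \<in> space M. smallest_singular_value (A \<omega>) \<le> \<epsilon> / sqrt n}"
  have A: "A \<omega> \<in> carrier_mat n n" if "\<omega> \<in> space M" for \<omega> using rows that by (simp add: rows_indep_copies_def)
  interpret Y: random_entries M "{..<n}" n "\<lambda>k i \<omega>. A \<omega> $$ (i, k)" B
    by (rule random_entries_columns[OF rows adm n(1)])
  have B1: "1 \<le> B" using moment_measure.B_ge_1[OF Y.moment[of 0 0]] n by simp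
  define g where "g k = 1 / (4 * (real k)\<^sup>2 * (fact k ^ 4 * B ^ k))" for k
  have N: "1 \<le> N" using n by simp
  have "1 * 1 * (1 * 1) \<le> 4 * (real N)\<^sup>2 * (fact N ^ 4 * B ^ N)"
    using N B1 by (intro mult_mono one_le_power) auto
  then have gN: "0 < g N" "g N \<le> 1" unfolding g_def by (simp_all add: field_simps)
  have gmono: "g N \<le> g n"
    unfolding g_def using n B1 
    by (intro divide_left_mono mult_mono power_mono power_increasing fact_mono mult_pos_pos) auto
  define y where "y = 1 - g N / N"
  have "g N / N \<le> 1 / 1" using gN N by (intro frac_le) auto
  then have y: "0 \<le> y" "y \<le> c" using c(1) unfolding y_def g_def by auto
  have "1 + real n * (- g N / N) \<le> (1 + (- g N / N)) ^ n"
    using gN N by (intro Bernoulli_inequality) (auto simp: field_simps)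
  also have "\<dots> = y ^ n" by (simp add: y_def)
  also have "\<dots> \<le> c ^ n" using y by (intro power_mono) auto
  finally have "1 - g N * (n / N) \<le> c ^ n" by (simp add: mult.commute)
  moreover have "g N * (n / N) \<le> g N * 1" using gN n by (intro mult_left_mono) auto
  ultimately have cn: "1 - g N \<le> c ^ n" by simp
  have c0: "0 \<le> c ^ n" using y by simp
  show ?thesis
  proof (cases "1 / 2 \<le> \<epsilon>")
    case True
    have "2 * (1 / 2) \<le> C * \<epsilon>" using True C by (intro mult_mono) auto
    then have "1 \<le> C * \<epsilon> + c ^ n" using c0 by simp
    then show ?thesis using prob_le_1[of U] unfolding U_def by linarith
  next
    case False
    obtain E where E1: "E \<in> events" and E23: "g n \<le> prob E \<and>
        (\<forall>\<omega>\<in>E. \<forall>x. L2_set x {..<n} = 1 \<longrightarrow> 1 < 2 * real n * (L2_set (\<lambda>i. \<Sum>j<n. x j * A \<omega> $$ (i, j)) {..<n})\<^sup>2)"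
      using small_dimension[OF rows adm n(1)] unfolding g_def by (rule bexE)
    have E: "E \<in> events" "g n \<le> prob E"
      "\<And>\<omega> x. \<omega> \<in> E \<Longrightarrow> L2_set x {..<n} = 1 \<Longrightarrow> 1 < 2 * real n * (L2_set (\<lambda>i. \<Sum>j<n. x j * A \<omega> $$ (i, j)) {..<n})\<^sup>2"
      using E1 E23 by simp_all
    have "U \<subseteq> space M - E"
    proof
      fix \<omega> assume w: "\<omega> \<in> U"
      then have ws: "\<omega> \<in> space M" by (simp add: U_def)
      have "\<epsilon> / sqrt n < (1 / 2) / sqrt n" using False n by (intro divide_strict_right_mono) auto
      then have "smallest_singular_value (A \<omega>) < (1 / 2) / sqrt n" using w unfolding U_def by auto
      then obtain x where x: "L2_set x {..<n} = 1" "L2_set (\<lambda>i. \<Sum>j<n. x j * A \<omega> $$ (i, j)) {..<n} < (1 / 2) / sqrt n"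
        using smallest_singular_value_less[OF A[OF ws] n(1)] by blast
      then have "(L2_set (\<lambda>i. \<Sum>j<n. x j * A \<omega> $$ (i, j)) {..<n})\<^sup>2 \<le> ((1 / 2) / sqrt n)\<^sup>2"
        by (intro power_mono) auto
      also have "\<dots> = 1 / (4 * n)" by (simp add: power_divide)
      finally have "2 * real n * (L2_set (\<lambda>i. \<Sum>j<n. x j * A \<omega> $$ (i, j)) {..<n})\<^sup>2 \<le> 2 * real n * (1 / (4 * n))"
        by (intro mult_left_mono) auto
      also have "\<dots> \<le> 1" using n by simp
      finally have "\<omega> \<notin> E" using E(3)[OF _ x(1)] by force
      then show "\<omega> \<in> space M - E" using ws by simp
    qed
    then have "prob U \<le> prob (space M - E)" using E by (intro finite_measure_mono) auto
    also have "\<dots> = 1 - prob E" using E by (simp add: prob_compl)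
    finally have "prob U \<le> c ^ n" using E(2) gmono cn by linarith
    moreover have "0 \<le> C * \<epsilon>" using C eps by simp
    ultimately show ?thesis by (simp add: U_def)
  qed
qed

section \<open>Polynomial dependence of the constants\<close>

definition inverse_polynomial :: "(real \<Rightarrow> real \<Rightarrow> real) \<Rightarrow> bool" where
  "inverse_polynomial f \<longleftrightarrow> (\<exists>a m. \<forall>B\<ge>1. \<forall>K\<ge>1. 0 < f B K \<and> 1 / f B K \<le> a * (B * K) ^ m)"

text \<open>Positivity, included in the definition, permits multiplying the two bounds. Closure
  under products carries the basic constants, each a product of 1 / B, 1 / K, positive numbers and
  earlier constants.\<close>

lemma inverse_polynomial_mult:
  assumes "inverse_polynomial f" "inverse_polynomial g"
  shows "inverse_polynomial (\<lambda>B K. f B K * g B K)"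
proof -
  obtain a m where f: "\<And>B K. 1 \<le> B \<Longrightarrow> 1 \<le> K \<Longrightarrow> 0 < f B K \<and> 1 / f B K \<le> a * (B * K) ^ m"
    using assms(1) unfolding inverse_polynomial_def by blast
  obtain a' m' where g: "\<And>B K. 1 \<le> B \<Longrightarrow> 1 \<le> K \<Longrightarrow> 0 < g B K \<and> 1 / g B K \<le> a' * (B * K) ^ m'"
    using assms(2) unfolding inverse_polynomial_def by blast
  have "0 < f B K * g B K \<and> 1 / (f B K * g B K) \<le> (a * a') * (B * K) ^ (m + m')" if "1 \<le> B" "1 \<le> K" for B K
  proof -
    have pos: "0 < f B K" "0 < g B K" using f[OF that] g[OF that] by auto
    have fb: "1 / f B K \<le> a * (B * K) ^ m" and gb: "1 / g B K \<le> a' * (B * K) ^ m'" using f[OF that] g[OF that] by auto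
    have "0 \<le> a * (B * K) ^ m" using fb pos(1) by (meson less_imp_le order_trans zero_less_divide_1_iff)
    then have "(1 / f B K) * (1 / g B K) \<le> (a * (B * K) ^ m) * (a' * (B * K) ^ m')"
      using fb gb pos by (intro mult_mono) auto
    then show ?thesis using pos by (simp add: power_add mult_ac)
  qed
  then show ?thesis unfolding inverse_polynomial_def by blast
qed

lemma inverse_polynomial_const: "0 < c \<Longrightarrow> inverse_polynomial (\<lambda>B K. c)"
  unfolding inverse_polynomial_def by (intro exI[of _ "1 / c"] exI[of _ 0]) simp

lemma inverse_polynomial_B: "inverse_polynomial (\<lambda>B K. 1 / B)"
  unfolding inverse_polynomial_def by (intro exI[of _ 1] exI[of _ 1]) (auto simp: mult_le_cancel_left1)

lemma inverse_polynomial_K: "inverse_polynomial (\<lambda>B K. 1 / K)"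
  unfolding inverse_polynomial_def by (intro exI[of _ 1] exI[of _ 1]) (auto simp: mult_le_cancel_right1)

lemma inverse_polynomialD: "inverse_polynomial f \<Longrightarrow> polynomially_bounded (\<lambda>B K. 1 / f B K)"
  unfolding inverse_polynomial_def polynomially_bounded_def by blast

lemma polynomially_bounded_cong:
  "(\<And>B K. 1 \<le> B \<Longrightarrow> 1 \<le> K \<Longrightarrow> f B K = g B K) \<Longrightarrow> polynomially_bounded f \<longleftrightarrow> polynomially_bounded g"
  unfolding polynomially_bounded_def by simp

text \<open>Since B K \<ge> 1, both bounds can be raised to a common degree once their coefficients
  are replaced by absolute values. The threshold, a sum, needs this.\<close>

lemma polynomially_bounded_add:
  assumes "polynomially_bounded f" "polynomially_bounded g"
  shows "polynomially_bounded (\<lambda>B K. f B K + g B K)"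
proof -
  obtain a m where f: "\<And>B K. 1 \<le> B \<Longrightarrow> 1 \<le> K \<Longrightarrow> f B K \<le> a * (B * K) ^ m"
    using assms(1) unfolding polynomially_bounded_def by blast
  obtain a' m' where g: "\<And>B K. 1 \<le> B \<Longrightarrow> 1 \<le> K \<Longrightarrow> g B K \<le> a' * (B * K) ^ m'"
    using assms(2) unfolding polynomially_bounded_def by blast
  have "f B K + g B K \<le> (\<bar>a\<bar> + \<bar>a'\<bar>) * (B * K) ^ (m + m')" if "1 \<le> B" "1 \<le> K" for B K
  proof -
    have BK: "1 \<le> B * K" using mult_mono[of 1 B 1 K] that by simp
    have "a * (B * K) ^ m \<le> \<bar>a\<bar> * (B * K) ^ (m + m')"
      using BK by (intro mult_mono power_increasing) auto
    moreover have "a' * (B * K) ^ m' \<le> \<bar>a'\<bar> * (B * K) ^ (m + m')"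
      using BK by (intro mult_mono power_increasing) auto
    ultimately show ?thesis using f[OF that] g[OF that] by (simp add: distrib_right)
  qed
  then show ?thesis unfolding polynomially_bounded_def by blast
qed

theorem theorem5p1:
  shows "\<exists>(C :: real \<Rightarrow> real \<Rightarrow> real) (c :: real \<Rightarrow> real \<Rightarrow> real)
          (c' :: real \<Rightarrow> real \<Rightarrow> real) (N :: real \<Rightarrow> real \<Rightarrow> real).
    polynomially_bounded C \<and>
    polynomially_bounded (\<lambda>B K. 1 / (1 - c' B K)) \<and>
    polynomially_bounded N \<and>
    (\<forall>(B::real) (K::real). K \<ge> 1 \<longrightarrow>
       C B K > 0 \<and> c B K \<in> {0<..<1} \<and> c' B K \<in> {0<..<1} \<and>
       (\<forall>(n::nat) (M :: 'w measure) (\<xi> :: nat \<Rightarrow> 'w \<Rightarrow> real) (A :: 'w \<Rightarrow> real mat) (\<epsilon>::real).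
          n \<ge> 1 \<longrightarrow> prob_space M \<longrightarrow>
          prob_space.admissible_variables M n B \<xi> \<longrightarrow>
          prob_space.rows_indep_copies M n \<xi> A \<longrightarrow>
          \<epsilon> \<ge> 0 \<longrightarrow>
          measure M {\<omega> \<in> space M. smallest_singular_value (A \<omega>) \<le> \<epsilon> * real n powr (- 1 / 2)}
            \<le> C B K * \<epsilon> + c B K ^ n
              + measure M {\<omega> \<in> space M. spectral_norm (A \<omega>) > K * real n powr (1 / 2)} \<and>
          (real n \<ge> N B K \<longrightarrow>
            measure M {\<omega> \<in> space M. smallest_singular_value (A \<omega>) \<le> \<epsilon> * real n powr (- 1 / 2)}
              \<le> C B K * \<epsilon> + c' B K ^ n
                + measure M {\<omega> \<in> space M. spectral_norm (A \<omega>) > K * real n powr (1 / 2)})))"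
proof -
  define p0 :: "real \<Rightarrow> real \<Rightarrow> real" where "p0 B K = 1 / (400 * B ^ 3)" for B K
  define b :: "real \<Rightarrow> real \<Rightarrow> real" where "b B K = 1 / (16 * B)" for B K
  define \<rho> where "\<rho> B K = p0 B K / (9 * K)" for B K
  define \<delta> where "\<delta> B K = (p0 B K)\<^sup>2 * \<rho> B K / 768" for B K
  define lam where "lam B K = \<delta> B K / 4" for B K
  define \<gamma> where "\<gamma> B K = \<rho> B K * \<delta> B K / 2" for B K
  define \<mu> where "\<mu> B K = lam B K * \<gamma> B K * b B K / (9600 * K)" for B K
  define \<eta> where "\<eta> B K = b B K * (\<mu> B K)\<^sup>2" for B K
  have rv: "rv_constants B K (p0 B K) (b B K) (\<rho> B K) (\<delta> B K) (lam B K) (\<gamma> B K) (\<mu> B K) (\<eta> B K)"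
    if "1 \<le> B" "1 \<le> K" for B K
    using that by unfold_locales (simp_all add: p0_def b_def \<rho>_def \<delta>_def lam_def \<gamma>_def \<mu>_def \<eta>_def)
  note ip = inverse_polynomial_mult inverse_polynomial_const inverse_polynomial_B inverse_polynomial_K
  have "p0 = (\<lambda>B K. 1 / 400 * (1 / B * (1 / B * (1 / B))))" by (intro ext) (simp add: p0_def power3_eq_cube)
  then have ip_p0: "inverse_polynomial p0" by (simp only:) (intro ip, simp)
  have "b = (\<lambda>B K. 1 / 16 * (1 / B))" by (intro ext) (simp add: b_def)
  then have ip_b: "inverse_polynomial b" by (simp only:) (intro ip, simp)
  have "\<rho> = (\<lambda>B K. 1 / 9 * (p0 B K * (1 / K)))" by (intro ext) (simp add: \<rho>_def)
  then have ip_rho: "inverse_polynomial \<rho>" by (simp only:) (intro ip ip_p0, simp)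
  have "\<delta> = (\<lambda>B K. 1 / 768 * (p0 B K * (p0 B K * \<rho> B K)))" by (intro ext) (simp add: \<delta>_def power2_eq_square)
  then have ip_delta: "inverse_polynomial \<delta>" by (simp only:) (intro ip ip_p0 ip_rho, simp)
  have "lam = (\<lambda>B K. 1 / 4 * \<delta> B K)" by (intro ext) (simp add: lam_def)
  then have ip_lam: "inverse_polynomial lam" by (simp only:) (intro ip ip_delta, simp)
  have "\<gamma> = (\<lambda>B K. 1 / 2 * (\<rho> B K * \<delta> B K))" by (intro ext) (simp add: \<gamma>_def)
  then have ip_gam: "inverse_polynomial \<gamma>" by (simp only:) (intro ip ip_delta ip_rho, simp)
  have "\<mu> = (\<lambda>B K. 1 / 9600 * (lam B K * (\<gamma> B K * (b B K * (1 / K)))))" by (intro ext) (simp add: \<mu>_def)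
  then have ip_mu: "inverse_polynomial \<mu>" by (simp only:) (intro ip ip_lam ip_gam ip_b, simp)
  have "\<eta> = (\<lambda>B K. b B K * (\<mu> B K * \<mu> B K))" by (intro ext) (simp add: \<eta>_def power2_eq_square)
  then have ip_eta: "inverse_polynomial \<eta>" by (simp only:) (intro ip ip_mu ip_b)
  \<comment> \<open>Positivity of C and the ranges of c and c' are required for every real B, so the
    constants are evaluated at max 1 B. Whenever n \<ge> 1 and admissible variables exist, their
    moments force B \<ge> 1 and the maximum is B.\<close>
  define m :: "real \<Rightarrow> real" where "m B = max 1 B" for B
  define C where "C B K = 128 / (\<delta> (m B) K * \<rho> (m B) K * (\<gamma> (m B) K * b (m B) K))" for B K
  define N where "N B K = 768 / lam (m B) K + 1 / (\<mu> (m B) K)\<^sup>2 + 38 / (\<gamma> (m B) K * b (m B) K * \<delta> (m B) K * \<eta> (m B) K)" for B K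
  define N0 where "N0 B K = nat \<lceil>N B K\<rceil>" for B K
  define c' where "c' B K = 1 - \<eta> (m B) K / 4" for B K
  \<comment> \<open>One base for all dimensions: at least c', for n from N on, and close enough to 1
    for \<open>moderate_dimension\<close> below N.\<close>
  define c where "c B K = max (c' B K) (1 - 1 / (4 * (real (N0 B K))\<^sup>2 * (fact (N0 B K) ^ 4 * m B ^ N0 B K)) / N0 B K)" for B K
  have poly_C: "polynomially_bounded C"
  proof -
    have "polynomially_bounded (\<lambda>B K. 1 / (1 / 128 * (\<delta> B K * (\<rho> B K * (\<gamma> B K * b B K)))))"
      by (rule inverse_polynomialD) (intro ip ip_delta ip_rho ip_gam ip_b, simp)
    then show ?thesis by (subst polynomially_bounded_cong) (auto simp: C_def m_def mult_ac)
  qed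
  have poly_N: "polynomially_bounded N"
  proof -
    have "polynomially_bounded (\<lambda>B K. 1 / (1 / 768 * lam B K) + 1 / (\<mu> B K * \<mu> B K)
        + 1 / (1 / 38 * (\<gamma> B K * (b B K * (\<delta> B K * \<eta> B K)))))"
      by (intro polynomially_bounded_add inverse_polynomialD ip ip_lam ip_mu ip_gam ip_b ip_delta ip_eta) simp_all
    then show ?thesis by (subst polynomially_bounded_cong) (auto simp: N_def m_def mult_ac power2_eq_square)
  qed
  have poly_c': "polynomially_bounded (\<lambda>B K. 1 / (1 - c' B K))"
  proof -
    have "polynomially_bounded (\<lambda>B K. 1 / (1 / 4 * \<eta> B K))"
      by (rule inverse_polynomialD) (intro ip ip_eta, simp)
    then show ?thesis by (subst polynomially_bounded_cong) (auto simp: c'_def m_def)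
  qed
  have main: "C B K > 0 \<and> c B K \<in> {0<..<1} \<and> c' B K \<in> {0<..<1} \<and>
       (\<forall>(n::nat) (M :: 'w measure) (\<xi> :: nat \<Rightarrow> 'w \<Rightarrow> real) (A :: 'w \<Rightarrow> real mat) (\<epsilon>::real).
          n \<ge> 1 \<longrightarrow> prob_space M \<longrightarrow>
          prob_space.admissible_variables M n B \<xi> \<longrightarrow>
          prob_space.rows_indep_copies M n \<xi> A \<longrightarrow>
          \<epsilon> \<ge> 0 \<longrightarrow>
          measure M {\<omega> \<in> space M. smallest_singular_value (A \<omega>) \<le> \<epsilon> * real n powr (- 1 / 2)}
            \<le> C B K * \<epsilon> + c B K ^ n
              + measure M {\<omega> \<in> space M. spectral_norm (A \<omega>) > K * real n powr (1 / 2)} \<and>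
          (real n \<ge> N B K \<longrightarrow>
            measure M {\<omega> \<in> space M. smallest_singular_value (A \<omega>) \<le> \<epsilon> * real n powr (- 1 / 2)}
              \<le> C B K * \<epsilon> + c' B K ^ n
                + measure M {\<omega> \<in> space M. spectral_norm (A \<omega>) > K * real n powr (1 / 2)}))"
    if K: "K \<ge> 1" for B K
  proof -
    have m1: "1 \<le> m B" by (simp add: m_def)
    interpret rv_constants "m B" K "p0 (m B) K" "b (m B) K" "\<rho> (m B) K" "\<delta> (m B) K" "lam (m B) K" "\<gamma> (m B) K" "\<mu> (m B) K" "\<eta> (m B) K"
      by (rule rv[OF m1 K])
    have C_eq: "rate = C B K" by (simp add: rate_def C_def)
    have N_eq: "threshold = N B K" by (simp add: threshold_def N_def)
    have "0 < 768 / lam (m B) K" "0 \<le> 1 / (\<mu> (m B) K)\<^sup>2" "0 \<le> 38 / (\<gamma> (m B) K * b (m B) K * \<delta> (m B) K * \<eta> (m B) K)"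
      using lam_bounds gb_bounds delta_bounds eta_bounds by auto
    then have N_pos: "0 < N B K" unfolding N_def by linarith
    then have N0: "1 \<le> N0 B K" by (simp add: N0_def Suc_le_eq)
    have C2: "2 \<le> C B K" using rate_bounds(3) unfolding C_eq .
    have c': "0 < c' B K" "c' B K < 1" using eta_bounds by (auto simp: c'_def)
    have "0 < 1 / (4 * (real (N0 B K))\<^sup>2 * (fact (N0 B K) ^ 4 * m B ^ N0 B K)) / N0 B K"
      using N0 m1 by simp
    then have c: "c' B K \<le> c B K" "1 - 1 / (4 * (real (N0 B K))\<^sup>2 * (fact (N0 B K) ^ 4 * m B ^ N0 B K)) / N0 B K \<le> c B K" "c B K < 1"
      using c' unfolding c_def by auto
    have "measure M {\<omega> \<in> space M. smallest_singular_value (A \<omega>) \<le> \<epsilon> / sqrt n}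
            \<le> C B K * \<epsilon> + c B K ^ n + measure M {\<omega> \<in> space M. K * sqrt n < spectral_norm (A \<omega>)} \<and>
          (N B K \<le> n \<longrightarrow> measure M {\<omega> \<in> space M. smallest_singular_value (A \<omega>) \<le> \<epsilon> / sqrt n}
            \<le> C B K * \<epsilon> + c' B K ^ n + measure M {\<omega> \<in> space M. K * sqrt n < spectral_norm (A \<omega>)})"
      if n: "1 \<le> n" and M: "prob_space M" and adm: "prob_space.admissible_variables M n B \<xi>"
        and rows: "prob_space.rows_indep_copies M n \<xi> A" and eps: "0 \<le> \<epsilon>"
      for n and M :: "'w measure" and \<xi> A \<epsilon>
    proof -
      interpret prob_space M by (rule M)
      have "random_entries M {..<n} n (\<lambda>k i \<omega>. A \<omega> $$ (i, k)) B"
        by (rule random_entries_columns[OF rows adm n])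
      from random_entries.moment[OF this, of 0 0] have "1 \<le> B" using n by (auto dest: moment_measure.B_ge_1)
      then have mB: "m B = B" by (simp add: m_def)
      have large: "measure M {\<omega> \<in> space M. smallest_singular_value (A \<omega>) \<le> \<epsilon> / sqrt n}
            \<le> C B K * \<epsilon> + c' B K ^ n + measure M {\<omega> \<in> space M. K * sqrt n < spectral_norm (A \<omega>)}" if "N B K \<le> n"
        using large_dimension[OF rv_constants_axioms[unfolded mB] rows adm n _ eps] that
        unfolding C_eq[unfolded mB] N_eq[unfolded mB] c'_def mB by simp
      show ?thesis
      proof (cases "N B K \<le> n")
        case True
        have "c' B K ^ n \<le> c B K ^ n" using c c' by (intro power_mono) auto
        then show ?thesis using large[OF True] by linarith
      next
        case False
        then have nN: "n \<le> N0 B K" by (simp add: N0_def) linarith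
        have "measure M {\<omega> \<in> space M. smallest_singular_value (A \<omega>) \<le> \<epsilon> / sqrt n} \<le> C B K * \<epsilon> + c B K ^ n"
          by (rule moderate_dimension[OF rows adm n nN eps C2 c(2)[unfolded mB] c(3)])
        then show ?thesis using False measure_nonneg[of M "{\<omega> \<in> space M. K * sqrt n < spectral_norm (A \<omega>)}"] by linarith
      qed
    qed
    moreover have "\<epsilon> * real n powr (- 1 / 2) = \<epsilon> / sqrt n" "K * real n powr (1 / 2) = K * sqrt n" for n \<epsilon>
      by (simp_all add: powr_half_sqrt powr_minus_divide)
    ultimately show ?thesis using rate_bounds(1) c' c unfolding C_eq by (simp only: greaterThanLessThan_iff) auto
  qed
  show ?thesis
    by (rule exI[of _ C], rule exI[of _ c], rule exI[of _ c'], rule exI[of _ N], rule conjI[OF poly_C],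
      rule conjI[OF poly_c'], rule conjI[OF poly_N], rule allI, rule allI, rule impI, rule main)
qed

end
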